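(* Let $X=(X_1,X_2)$ be a random variable with values in $\mathbb{R}^2$ such that (i) $X$ is not constrained to a hyperplane (there is no line in $\mathbb{R}^2$ containing $X$ almost surely), and (ii) $\mathbb{P}[X\in(0,\infty)^2]>0$. Let $X(n)$, $n\ge 1$, be i.i.d. copies of $X$ and let $W(n)=W^x(n)$ be the associated 2-dimensional Lindley process, $W^x(0)=x\in\mathbb{R}_+^2$, $W^x(n)=\max\{0,W^x(n-1)-X(n)\}$ (maximum taken coordinate-wise). Then the following hold. (a) If for at least one $i\in\{1,2\}$ one has $\mathbb{E}(X_i^+)<\mathbb{E}(X_i^-)\le\infty$, then $W(n)$ is transient. (b) If for both $i\in\{1,2\}$ one has $\mathbb{E}(X_i^-)<\mathbb{E}(X_i^+)<\infty$, then $W(n)$ is positive recurrent. (c) If for both $i\in\{1,2\}$ $$\mathbb{E}(X_i)=0\quad\text{and}\quad \mathbb{E}\bigl(|X_i|^{\max\{2+\delta,\ \pi/\arccos(-\rho)\}}\bigr)<\infty,$$ where $\delta>0$ is arbitrary and $\rho=\rho(X_1,X_2)$ is the correlation coefficient of $X_1$ and $X_2$, then $W(n)$ is null recurrent if $\rho\ge 0$, and transient otherwise. (d) If for some $\delta>0$, up to a possible exchange of the two coordinates, $$\mathbb{E}(|X_i|^{2+\delta})<\infty\ \text{ for } i=1,2,\quad \mathbb{E}(X_1)=0,\quad \mathbb{E}(X_2)>0,\quad\text{and}\quad \mathbb{E}\bigl((X_2^-)^{3+\delta}\bigr)<\infty,$$ then $W(n)$ is null recurrent.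
   Context: Notation: $\mathbb{R}_+=[0,\infty)$; $X_i^+=\max\{X_i,0\}$ and $X_i^-=\max\{-X_i,0\}$. The process $W(n)$ is called transient if, for every starting point $x\in\mathbb{R}_+^2$, $W^x(n)\to\infty$ almost surely, i.e. $|W^x(n)|\to\infty$ almost surely. It is called recurrent if there is a closed, non-empty set $L\subset\mathbb{R}_+^2$ (the limit set) such that for every open set $U$ which intersects $L$ and every starting point $x\in\mathbb{R}_+^2$, $\mathbb{P}[W^x(n)\in U\text{ for infinitely many }n]=1$. In the recurrent case the process has an invariant (Radon) measure $\nu$, supported on $L$, unique up to constant factors; the process is called positive recurrent if it is recurrent and $\nu$ has finite total mass, and null recurrent if it is recurrent and $\nu$ has infinite total mass. *)

theory Defs
  imports "HOL-Probability.Probability"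
begin

definition quadrant :: "(real^2) set" where
  "quadrant = {w. \<forall>i. 0 \<le> w $ i}"

definition lindley_step :: "real^2 \<Rightarrow> real^2 \<Rightarrow> real^2" where
  "lindley_step w y = (\<chi> i. max 0 (w $ i - y $ i))"

text \<open>The increments are indexed by \<open>n \<ge> 1\<close>; \<open>Xs 0\<close> is never used.\<close>

primrec lindley :: "(nat \<Rightarrow> 'a \<Rightarrow> real^2) \<Rightarrow> real^2 \<Rightarrow> nat \<Rightarrow> 'a \<Rightarrow> real^2" where
  "lindley Xs x 0 \<omega> = x"
| "lindley Xs x (Suc n) \<omega> = lindley_step (lindley Xs x n \<omega>) (Xs (Suc n) \<omega>)"

definition iid_copies :: "'a measure \<Rightarrow> ('a \<Rightarrow> real^2) \<Rightarrow> (nat \<Rightarrow> 'a \<Rightarrow> real^2) \<Rightarrow> bool" where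
  "iid_copies M X Xs \<longleftrightarrow>
     prob_space.indep_vars M (\<lambda>_. borel) Xs {1..} \<and>
     (\<forall>n\<ge>1. distr M borel (Xs n) = distr M borel X)"

definition transient :: "'a measure \<Rightarrow> (nat \<Rightarrow> 'a \<Rightarrow> real^2) \<Rightarrow> bool" where
  "transient M Xs \<longleftrightarrow>
     (\<forall>x\<in>quadrant. AE \<omega> in M. filterlim (\<lambda>n. norm (lindley Xs x n \<omega>)) at_top sequentially)"

definition recurrent_on :: "'a measure \<Rightarrow> (nat \<Rightarrow> 'a \<Rightarrow> real^2) \<Rightarrow> (real^2) set \<Rightarrow> bool" where
  "recurrent_on M Xs L \<longleftrightarrow>
     closed L \<and> L \<noteq> {} \<and> L \<subseteq> quadrant \<and>
     (\<forall>U. open U \<longrightarrow> U \<inter> L \<noteq> {} \<longrightarrow>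
        (\<forall>x\<in>quadrant. AE \<omega> in M. \<exists>\<^sub>\<infinity>n. lindley Xs x n \<omega> \<in> U))"

definition recurrent :: "'a measure \<Rightarrow> (nat \<Rightarrow> 'a \<Rightarrow> real^2) \<Rightarrow> bool" where
  "recurrent M Xs \<longleftrightarrow> (\<exists>L. recurrent_on M Xs L)"

text \<open>
  The defining property of \<open>L\<close> is inherited by closed non-empty subsets, so it does not
  determine \<open>L\<close>. The limit set is the largest such \<open>L\<close>.
\<close>

definition limit_set :: "'a measure \<Rightarrow> (nat \<Rightarrow> 'a \<Rightarrow> real^2) \<Rightarrow> (real^2) set" where
  "limit_set M Xs = \<Union>{L. recurrent_on M Xs L}"

lemma closed_quadrant: "closed quadrant"
proof -
  have "quadrant = (\<Inter>i. {w :: real^2. 0 \<le> w $ i})"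
    by (auto simp: quadrant_def)
  moreover have "closed {w :: real^2. 0 \<le> w $ i}" for i
    by (intro closed_Collect_le continuous_intros)
  ultimately show ?thesis
    by (metis (no_types, lifting) closed_INT)
qed

lemma recurrent_on_limit_set:
  assumes "recurrent M Xs"
  shows "recurrent_on M Xs (limit_set M Xs)"
proof -
  let ?L = "limit_set M Xs"
  obtain L0 where L0: "recurrent_on M Xs L0"
    using assms by (auto simp: recurrent_def)
  have sub: "?L \<subseteq> quadrant"
    by (auto simp: limit_set_def recurrent_on_def)
  have io: "\<forall>x\<in>quadrant. AE \<omega> in M. \<exists>\<^sub>\<infinity>n. lindley Xs x n \<omega> \<in> U"
    if U: "open U" "U \<inter> ?L \<noteq> {}" for U
  proof -
    obtain L where "recurrent_on M Xs L" "U \<inter> L \<noteq> {}"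
      using U(2) by (auto simp: limit_set_def)
    then show ?thesis
      using U(1) by (simp add: recurrent_on_def)
  qed
  have "recurrent_on M Xs (closure ?L)"
    unfolding recurrent_on_def
  proof (intro conjI allI impI)
    have "L0 \<noteq> {}" "L0 \<subseteq> ?L"
      using L0 by (simp add: recurrent_on_def, auto simp: limit_set_def)
    then show "closure ?L \<noteq> {}"
      by auto
    show "closure ?L \<subseteq> quadrant"
      by (rule closure_minimal[OF sub closed_quadrant])
    fix U :: "(real^2) set"
    assume "open U" "U \<inter> closure ?L \<noteq> {}"
    then show "\<forall>x\<in>quadrant. AE \<omega> in M. \<exists>\<^sub>\<infinity>n. lindley Xs x n \<omega> \<in> U"
      using io open_Int_closure_eq_empty by blast
  qed simp
  moreover from this have "closure ?L \<subseteq> ?L"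
    by (subst (2) limit_set_def) blast
  ultimately show ?thesis
    by (metis closure_subset subset_antisym)
qed

text \<open>
  A Borel measure on \<open>\<real>\<^sup>2\<close> which is finite on compact sets is automatically regular. Measures on
  the quadrant are encoded as measures on \<open>\<real>\<^sup>2\<close> which vanish outside of it; the zero measure is
  excluded.
\<close>

definition invariant_radon_measure ::
    "'a measure \<Rightarrow> ('a \<Rightarrow> real^2) \<Rightarrow> (real^2) measure \<Rightarrow> bool" where
  "invariant_radon_measure M X \<nu> \<longleftrightarrow>
     sets \<nu> = sets borel \<and>
     emeasure \<nu> (- quadrant) = 0 \<and>
     emeasure \<nu> UNIV \<noteq> 0 \<and>
     (\<forall>K. compact K \<longrightarrow> emeasure \<nu> K < \<infinity>) \<and>
     (\<forall>B\<in>sets borel.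
        emeasure \<nu> B = (\<integral>\<^sup>+ w. emeasure M {\<omega> \<in> space M. lindley_step w (X \<omega>) \<in> B} \<partial>\<nu>))"

definition invariant_on_limit_set ::
    "'a measure \<Rightarrow> ('a \<Rightarrow> real^2) \<Rightarrow> (nat \<Rightarrow> 'a \<Rightarrow> real^2) \<Rightarrow> (real^2) measure \<Rightarrow> bool" where
  "invariant_on_limit_set M X Xs \<nu> \<longleftrightarrow>
     invariant_radon_measure M X \<nu> \<and> emeasure \<nu> (- limit_set M Xs) = 0"

text \<open>
  The invariant measure is only unique up to constant factors, and this uniqueness is not part of
  the definitions: they ask that such a measure exists and that all of them have finite,
  respectively infinite, total mass.
\<close>

definition positive_recurrent ::
    "'a measure \<Rightarrow> ('a \<Rightarrow> real^2) \<Rightarrow> (nat \<Rightarrow> 'a \<Rightarrow> real^2) \<Rightarrow> bool" where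
  "positive_recurrent M X Xs \<longleftrightarrow>
     recurrent M Xs \<and>
     (\<exists>\<nu>. invariant_on_limit_set M X Xs \<nu>) \<and>
     (\<forall>\<nu>. invariant_on_limit_set M X Xs \<nu> \<longrightarrow> emeasure \<nu> UNIV < \<infinity>)"

definition null_recurrent ::
    "'a measure \<Rightarrow> ('a \<Rightarrow> real^2) \<Rightarrow> (nat \<Rightarrow> 'a \<Rightarrow> real^2) \<Rightarrow> bool" where
  "null_recurrent M X Xs \<longleftrightarrow>
     recurrent M Xs \<and>
     (\<exists>\<nu>. invariant_on_limit_set M X Xs \<nu>) \<and>
     (\<forall>\<nu>. invariant_on_limit_set M X Xs \<nu> \<longrightarrow> emeasure \<nu> UNIV = \<infinity>)"

text \<open>Only meant for \<open>Y \<ge> 0\<close>, as \<open>ennreal\<close> maps negative reals to \<open>0\<close>.\<close>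

definition nn_expectation :: "'a measure \<Rightarrow> ('a \<Rightarrow> real) \<Rightarrow> ennreal" where
  "nn_expectation M Y = (\<integral>\<^sup>+ \<omega>. ennreal (Y \<omega>) \<partial>M)"

definition pos_part :: "real \<Rightarrow> real" where
  "pos_part t = max t 0"

definition neg_part :: "real \<Rightarrow> real" where
  "neg_part t = max (- t) 0"

definition covariance :: "'a measure \<Rightarrow> ('a \<Rightarrow> real) \<Rightarrow> ('a \<Rightarrow> real) \<Rightarrow> real" where
  "covariance M Y Z =
     (\<integral>\<omega>. (Y \<omega> - (\<integral>\<eta>. Y \<eta> \<partial>M)) * (Z \<omega> - (\<integral>\<eta>. Z \<eta> \<partial>M)) \<partial>M)"

definition correlation :: "'a measure \<Rightarrow> ('a \<Rightarrow> real) \<Rightarrow> ('a \<Rightarrow> real) \<Rightarrow> real" where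
  "correlation M Y Z = covariance M Y Z / (sqrt (covariance M Y Y) * sqrt (covariance M Z Z))"

end

theory Submission
  imports Defs
begin

text \<open>
  Everything is expressed through the transition operator of the Lindley chain,
  \<open>T \<phi> w = E \<phi> (max 0 (w - X))\<close>, and through the atom at the origin. As both
  coordinates of \<open>X\<close> are positive with positive probability, there is some \<open>\<epsilon> > 0\<close> such that both
  are at least \<open>\<epsilon>\<close> with positive probability. Hence from a bounded set the chain reaches the point
  \<open>0\<close> in a fixed number of steps with probability bounded below (\<open>reach_zero\<close>). So recurrence
  follows once \<open>0\<close> is hit with probability one from every starting point, and transience follows from
  finiteness of the Green function \<open>\<Sum>n. (T ^^ n) (indicator {0}) 0\<close>.

  If \<open>0\<close> is always hit, then every open set that can be reached from \<open>0\<close> is visited infinitely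
  often. The expected occupation time of an excursion from \<open>0\<close> is an invariant Radon measure which
  lives on the set of reachable points. The total mass of any invariant measure \<open>\<nu>\<close> is read off from
  \<open>\<nu> {0} = \<integral> (T ^^ n) (indicator {0}) d\<nu>\<close>: if the return probabilities stay bounded below for
  every starting point, Fatou's lemma gives \<open>\<nu> UNIV < \<infinity>\<close>; if they come arbitrarily close to zero,
  then a finite \<open>\<nu>\<close> has \<open>\<nu> {0} = 0\<close> and therefore vanishes on every bounded set.

  A negative drift, or two positive ones, are treated pathwise. Partial sums of i.i.d. variables whose expectation is positive,
  possibly \<open>+\<infinity>\<close>, tend to infinity almost surely (\<open>partial_sums_at_top\<close>, a maximal ergodic
  argument). A coordinate with negative drift thus escapes. If both drifts are positive, one runs the
  iteration backwards: \<open>W(n)\<close> has the law of an iterate which vanishes as soon as all partial sums up to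
  time \<open>n\<close> are nonnegative and the last one dominates the starting point, and this has a probability
  bounded away from zero.

  When a drift vanishes, the proof uses Lyapunov functions \<open>\<phi> (1 + Q w)\<close> with a quadratic form
  \<open>Q\<close>. Two things have to fit together: the generator of the unreflected walk, whose second order part is the
  covariance matrix \<open>\<Sigma>\<close>, and the effect of the reflection.

  \<^item> If \<open>\<rho> \<ge> 0\<close>, take \<open>Q\<close> proportional to \<open>\<Sigma>\<close> inverse. Its mixed coefficient is nonpositive, so
    projecting a point to the quadrant never increases \<open>Q\<close>. In the metric of \<open>Q\<close> the walk is isotropic in
    the plane, where \<open>ln\<close> is harmonic; subtracting a small negative power makes it strictly
    superharmonic and still unbounded. This gives recurrence.
  \<^item> If \<open>\<rho> < 0\<close>, the mixed coefficient of \<open>Q\<close> is given the opposite sign of that of \<open>\<Sigma>\<close> and half of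
    its size. Near the axes reflection now increases \<open>Q\<close>, and on the quadrant a small negative power
    of \<open>1 + Q\<close> is superharmonic. A superharmonic function vanishing at infinity gives transience.
  \<^item> If the first coordinate is centred and the second has positive drift, take
    \<open>Q w = w\<^sub>1\<^sup>2 + \<kappa> w\<^sub>2\<^sup>2\<close> with small \<open>\<kappa>\<close> and \<open>\<phi> = ln\<close>. For large \<open>w\<^sub>2\<close> the drift
    dominates; for bounded \<open>w\<^sub>2\<close> the concavity of the logarithm in the first coordinate does.

  In the two recurrent cases of this list one coordinate is centred, so its second moment grows at most linearly and
  its mean at most like the square root of time, while each visit to \<open>0\<close> increases the mean by a fixed
  amount. So the return probabilities cannot stay bounded below, and the recurrence is null.
\<close>

section \<open>Transition operators and hitting probabilities\<close>

lemma lindley_step_in_quadrant [simp]: "lindley_step w y \<in> quadrant"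
  by (simp add: lindley_step_def quadrant_def)

lemma lindley_step_nth [simp]: "lindley_step w y $ i = max 0 (w $ i - y $ i)"
  by (simp add: lindley_step_def)

lemma zero_in_quadrant [simp]: "0 \<in> quadrant"
  by (simp add: quadrant_def)

lemma measurable_lindley_step [measurable]:
  assumes [measurable]: "f \<in> borel_measurable N" "g \<in> borel_measurable N"
  shows "(\<lambda>x. lindley_step (f x) (g x)) \<in> borel_measurable N"
proof -
  have "continuous_on UNIV (\<lambda>p. lindley_step (fst p) (snd p))"
    unfolding lindley_step_def
    by (intro continuous_on_vec_lambda continuous_intros)
  then have "(\<lambda>p. lindley_step (fst p) (snd p)) \<in> borel_measurable borel"
    by (rule borel_measurable_continuous_onI)
  from measurable_compose[OF _ this, of "\<lambda>x. (f x, g x)" N] show ?thesis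
    by (simp add: borel_prod[symmetric])
qed

locale lindley_chain = sequence_space \<mu> for \<mu> :: "(real^2) measure" +
  assumes sets_law [measurable_cong, simp]: "sets \<mu> = sets borel"
    and positive_up: "emeasure \<mu> {y. \<forall>i. 0 < y $ i} > 0"
begin

lemma space_law [simp]: "space \<mu> = UNIV"
  using sets_eq_imp_space_eq[OF sets_law] by simp

lemma emeasure_law_UNIV [simp]: "emeasure \<mu> UNIV = 1"
  using M.emeasure_space_1 by simp

lemma nn_integral_law_const [simp]: "(\<integral>\<^sup>+ y. c \<partial>\<mu>) = c"
  by simp

definition T :: "(real^2 \<Rightarrow> ennreal) \<Rightarrow> real^2 \<Rightarrow> ennreal" where
  "T \<phi> w = (\<integral>\<^sup>+ y. \<phi> (lindley_step w y) \<partial>\<mu>)"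

text \<open>
  The killing takes place before the step is made, so that \<open>(avoid U ^^ n) (\<lambda>_. 1) w\<close> is the
  probability that the positions at the times \<open>0, \<dots>, n - 1\<close> all miss \<open>U\<close>.
\<close>

definition avoid :: "(real^2) set \<Rightarrow> (real^2 \<Rightarrow> ennreal) \<Rightarrow> real^2 \<Rightarrow> ennreal" where
  "avoid U \<phi> w = indicator (- U) w * T \<phi> w"

definition avoid_forever :: "(real^2) set \<Rightarrow> real^2 \<Rightarrow> ennreal" where
  "avoid_forever U w = (INF n. (avoid U ^^ n) (\<lambda>_. 1) w)"

lemma T_measurable [measurable]:
  assumes [measurable]: "\<phi> \<in> borel_measurable borel"
  shows "T \<phi> \<in> borel_measurable borel"
  unfolding T_def by measurable

lemma T_iter_measurable [measurable]:
  "\<phi> \<in> borel_measurable borel \<Longrightarrow> (T ^^ n) \<phi> \<in> borel_measurable borel"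
  by (induction n) auto

lemma avoid_measurable [measurable]:
  assumes [measurable]: "\<phi> \<in> borel_measurable borel" "U \<in> sets borel"
  shows "avoid U \<phi> \<in> borel_measurable borel"
  unfolding avoid_def by measurable

lemma avoid_iter_measurable [measurable]:
  "\<phi> \<in> borel_measurable borel \<Longrightarrow> U \<in> sets borel \<Longrightarrow> (avoid U ^^ n) \<phi> \<in> borel_measurable borel"
  by (induction n) auto

lemma T_mono: "(\<And>v. v \<in> quadrant \<Longrightarrow> \<phi> v \<le> \<psi> v) \<Longrightarrow> T \<phi> w \<le> T \<psi> w"
  unfolding T_def by (intro nn_integral_mono) auto

lemma T_iter_mono:
  assumes "\<And>v. v \<in> quadrant \<Longrightarrow> \<phi> v \<le> \<psi> v" "w \<in> quadrant"
  shows "(T ^^ n) \<phi> w \<le> (T ^^ n) \<psi> w"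
  using assms(2) by (induction n arbitrary: w) (auto intro: assms T_mono)

lemma avoid_mono: "(\<And>v. v \<in> quadrant \<Longrightarrow> \<phi> v \<le> \<psi> v) \<Longrightarrow> avoid U \<phi> w \<le> avoid U \<psi> w"
  unfolding avoid_def by (intro mult_left_mono T_mono) auto

lemma avoid_iter_mono:
  assumes "\<And>v. v \<in> quadrant \<Longrightarrow> \<phi> v \<le> \<psi> v" "w \<in> quadrant"
  shows "(avoid U ^^ n) \<phi> w \<le> (avoid U ^^ n) \<psi> w"
  using assms(2) by (induction n arbitrary: w) (auto intro: assms avoid_mono)

lemma T_const [simp]: "T (\<lambda>_. c) = (\<lambda>_. c)"
  by (simp add: T_def fun_eq_iff)

lemma T_iter_const [simp]: "(T ^^ n) (\<lambda>_. c) = (\<lambda>_. c)"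
  by (induction n) simp_all

lemma T_add:
  assumes [measurable]: "\<phi> \<in> borel_measurable borel" "\<psi> \<in> borel_measurable borel"
  shows "T (\<lambda>v. \<phi> v + \<psi> v) = (\<lambda>w. T \<phi> w + T \<psi> w)"
  unfolding T_def fun_eq_iff by (intro allI nn_integral_add) measurable

lemma T_cmult:
  assumes [measurable]: "\<phi> \<in> borel_measurable borel"
  shows "T (\<lambda>v. c * \<phi> v) = (\<lambda>w. c * T \<phi> w)"
  unfolding T_def fun_eq_iff by (intro allI nn_integral_cmult) measurable

lemma T_iter_add:
  assumes [measurable]: "\<phi> \<in> borel_measurable borel" "\<psi> \<in> borel_measurable borel"
  shows "(T ^^ n) (\<lambda>v. \<phi> v + \<psi> v) = (\<lambda>v. (T ^^ n) \<phi> v + (T ^^ n) \<psi> v)"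
  by (induction n) (simp_all add: T_add)

lemma T_iter_cmult:
  assumes [measurable]: "\<phi> \<in> borel_measurable borel"
  shows "(T ^^ n) (\<lambda>v. c * \<phi> v) = (\<lambda>v. c * (T ^^ n) \<phi> v)"
  by (induction n) (simp_all add: T_cmult)

lemma avoid_add:
  assumes [measurable]: "\<phi> \<in> borel_measurable borel" "\<psi> \<in> borel_measurable borel"
  shows "avoid U (\<lambda>v. \<phi> v + \<psi> v) = (\<lambda>w. avoid U \<phi> w + avoid U \<psi> w)"
  by (simp add: avoid_def fun_eq_iff T_add distrib_left)

lemma avoid_cmult:
  assumes [measurable]: "\<phi> \<in> borel_measurable borel"
  shows "avoid U (\<lambda>v. c * \<phi> v) = (\<lambda>w. c * avoid U \<phi> w)"
  by (simp add: avoid_def fun_eq_iff T_cmult mult.left_commute)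

lemma avoid_iter_add:
  assumes [measurable]: "\<phi> \<in> borel_measurable borel" "\<psi> \<in> borel_measurable borel" "U \<in> sets borel"
  shows "(avoid U ^^ n) (\<lambda>v. \<phi> v + \<psi> v) = (\<lambda>v. (avoid U ^^ n) \<phi> v + (avoid U ^^ n) \<psi> v)"
  by (induction n) (simp_all add: avoid_add)

lemma avoid_iter_cmult:
  assumes [measurable]: "\<phi> \<in> borel_measurable borel" "U \<in> sets borel"
  shows "(avoid U ^^ n) (\<lambda>v. c * \<phi> v) = (\<lambda>v. c * (avoid U ^^ n) \<phi> v)"
  by (induction n) (simp_all add: avoid_cmult)

lemma avoid_le_T: "avoid U \<phi> w \<le> T \<phi> w"
  by (auto simp: avoid_def indicator_def)

lemma avoid_iter_le_one: "(avoid U ^^ n) (\<lambda>_. 1) w \<le> 1"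
proof (induction n arbitrary: w)
  case (Suc n)
  have "avoid U ((avoid U ^^ n) (\<lambda>_. 1)) w \<le> T ((avoid U ^^ n) (\<lambda>_. 1)) w"
    by (rule avoid_le_T)
  also have "\<dots> \<le> T (\<lambda>_. 1) w"
    by (intro T_mono Suc)
  finally show ?case by simp
qed simp

lemma avoid_iter_decseq: "decseq (\<lambda>n. (avoid U ^^ n) (\<lambda>_. 1) w)"
proof (rule decseq_SucI)
  fix n show "(avoid U ^^ Suc n) (\<lambda>_. 1) w \<le> (avoid U ^^ n) (\<lambda>_. 1) w"
  proof (induction n arbitrary: w)
    case 0 show ?case using avoid_iter_le_one[of 1 U] by simp
  next
    case (Suc n) then show ?case by (auto intro: avoid_mono)
  qed
qed

lemma avoid_iter_tendsto:
  "(\<lambda>n. (avoid U ^^ n) (\<lambda>_. 1) w) \<longlonglongrightarrow> avoid_forever U w"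
  unfolding avoid_forever_def by (rule LIMSEQ_INF[OF avoid_iter_decseq])

lemma avoid_forever_le: "avoid_forever U w \<le> (avoid U ^^ n) (\<lambda>_. 1) w"
  unfolding avoid_forever_def by (rule INF_lower) simp

lemma avoid_forever_le_one: "avoid_forever U w \<le> 1"
  using avoid_forever_le[of U w 0] by simp

lemma avoid_forever_measurable [measurable]:
  "U \<in> sets borel \<Longrightarrow> avoid_forever U \<in> borel_measurable borel"
  unfolding avoid_forever_def by (intro borel_measurable_INF) auto

lemma T_avoid_forever_tendsto:
  assumes [measurable]: "U \<in> sets borel"
  shows "(\<lambda>n. T ((avoid U ^^ n) (\<lambda>_. 1)) w) \<longlonglongrightarrow> T (avoid_forever U) w"
proof -
  have "T (avoid_forever U) w = (INF n. T ((avoid U ^^ n) (\<lambda>_. 1)) w)"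
    unfolding T_def avoid_forever_def
  proof (rule nn_integral_monotone_convergence_INF_decseq)
    show "decseq (\<lambda>i y. (avoid U ^^ i) (\<lambda>_. 1) (lindley_step w y))"
      by (intro decseq_SucI le_funI) (rule decseqD[OF avoid_iter_decseq], simp)
    show "(\<integral>\<^sup>+ y. (avoid U ^^ 0) (\<lambda>_. 1) (lindley_step w y) \<partial>\<mu>) < \<infinity>"
      by simp
  qed measurable
  moreover have "decseq (\<lambda>n. T ((avoid U ^^ n) (\<lambda>_. 1)) w)"
    by (intro decseq_SucI T_mono decseqD[OF avoid_iter_decseq]) simp
  ultimately show ?thesis
    by (simp add: LIMSEQ_INF)
qed

lemma avoid_avoid_forever:
  assumes [measurable]: "U \<in> sets borel"
  shows "avoid U (avoid_forever U) w = avoid_forever U w"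
proof (rule LIMSEQ_unique)
  show "(\<lambda>n. avoid U ((avoid U ^^ n) (\<lambda>_. 1)) w) \<longlonglongrightarrow> avoid U (avoid_forever U) w"
    using T_avoid_forever_tendsto[OF assms, of w]
    by (cases "w \<in> U") (auto simp: avoid_def[of U _ w])
  show "(\<lambda>n. avoid U ((avoid U ^^ n) (\<lambda>_. 1)) w) \<longlonglongrightarrow> avoid_forever U w"
    using LIMSEQ_Suc[OF avoid_iter_tendsto[of U w]] by simp
qed

lemma avoid_iter_avoid_forever:
  assumes "U \<in> sets borel"
  shows "(avoid U ^^ n) (avoid_forever U) w = avoid_forever U w"
proof -
  have "avoid U (avoid_forever U) = avoid_forever U"
    using avoid_avoid_forever[OF assms] by (simp add: fun_eq_iff)
  then have "(avoid U ^^ n) (avoid_forever U) = avoid_forever U"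
    by (induction n) auto
  then show ?thesis by simp
qed

text \<open>
  The avoidance probability \<open>r\<close> is a fixed point of the killed operator. A uniform bound \<open>r \<le> d\<close>
  therefore improves to \<open>r \<le> d * (avoid U ^^ n) (\<lambda>_. 1)\<close> for all \<open>n\<close>, and in the limit to
  \<open>r \<le> d * r\<close>.
\<close>

lemma avoid_forever_eq_0_of_bound:
  assumes [measurable]: "U \<in> sets borel"
    and d: "d < 1" "\<And>v. v \<in> quadrant \<Longrightarrow> avoid_forever U v \<le> d"
    and w: "w \<in> quadrant"
  shows "avoid_forever U w = 0"
proof -
  let ?r = "avoid_forever U"
  have "?r w \<le> d * (avoid U ^^ n) (\<lambda>_. 1) w" for n
  proof -
    have "?r w = (avoid U ^^ n) ?r w"
      by (simp add: avoid_iter_avoid_forever)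
    also have "\<dots> \<le> (avoid U ^^ n) (\<lambda>v. d * 1) w"
      by (rule avoid_iter_mono) (use d w in auto)
    also have "\<dots> = d * (avoid U ^^ n) (\<lambda>_. 1) w"
      by (subst avoid_iter_cmult) auto
    finally show ?thesis .
  qed
  moreover have "(\<lambda>n. d * (avoid U ^^ n) (\<lambda>_. 1) w) \<longlonglongrightarrow> d * ?r w"
    by (intro ennreal_tendsto_cmult avoid_iter_tendsto)
       (use d in \<open>auto intro: less_trans[OF _ ennreal_one_less_top]\<close>)
  ultimately have le: "?r w \<le> d * ?r w"
    using LIMSEQ_le_const[of _ "d * ?r w" "?r w"] by blast
  obtain a where a: "?r w = ennreal a" "0 \<le> a" "a \<le> 1"
    using avoid_forever_le_one[of U w] by (cases "?r w") (auto simp: top_unique ennreal_1[symmetric] simp del: ennreal_1)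
  obtain b where b: "d = ennreal b" "0 \<le> b" "b < 1"
    using d(1) by (cases d) (auto simp: ennreal_1[symmetric] ennreal_less_iff simp del: ennreal_1)
  have "a \<le> b * a"
    using le a b by (simp add: ennreal_mult[symmetric])
  with a b have "a = 0"
    by (metis mult_le_cancel_right1 not_le order_antisym_conv)
  then show ?thesis by (simp add: a)
qed

text \<open>
  The chain almost surely gets to \<open>B\<close>, and from there it has a fixed chance of hitting \<open>U\<close>. By
  induction on the number of steps this chance is, up to the probability of not having met \<open>B\<close> yet,
  a lower bound for all starting points.
\<close>

lemma avoid_forever_relay:
  assumes [measurable]: "U \<in> sets borel" "B \<in> sets borel"
    and B: "\<And>v. v \<in> quadrant \<Longrightarrow> avoid_forever B v = 0"
    and d: "d < 1" "\<And>v. v \<in> quadrant \<inter> B \<Longrightarrow> avoid_forever U v \<le> d"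
    and w: "w \<in> quadrant"
  shows "avoid_forever U w = 0"
proof (rule avoid_forever_eq_0_of_bound[OF assms(1) d(1) _ w])
  fix v :: "real^2" assume v: "v \<in> quadrant"
  have "avoid_forever U v \<le> d + (avoid B ^^ n) (\<lambda>_. 1) v" for n
    using v
  proof (induction n arbitrary: v)
    case 0
    then show ?case
      using avoid_forever_le_one[of U v] by (simp add: add_increasing)
  next
    case (Suc n)
    show ?case
    proof (cases "v \<in> B")
      case True
      with d(2)[of v] Suc.prems show ?thesis by (simp add: add_increasing2)
    next
      case False
      have "avoid_forever U v \<le> T (avoid_forever U) v"
        by (subst avoid_avoid_forever[symmetric]) (auto intro: avoid_le_T)
      also have "\<dots> \<le> T (\<lambda>v. d + (avoid B ^^ n) (\<lambda>_. 1) v) v"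
        by (intro T_mono Suc.IH)
      also have "\<dots> = d + (avoid B ^^ Suc n) (\<lambda>_. 1) v"
        using False by (subst T_add) (auto simp: avoid_def)
      finally show ?thesis .
    qed
  qed
  moreover have "(\<lambda>n. d + (avoid B ^^ n) (\<lambda>_. 1) v) \<longlonglongrightarrow> d + 0"
    using avoid_iter_tendsto[of B v] B[OF v] by (intro tendsto_add) auto
  ultimately show "avoid_forever U v \<le> d"
    using LIMSEQ_le_const[of _ "d + 0" "avoid_forever U v"] by auto
qed

lemma avoid_plus_reach_le_one:
  assumes [measurable]: "U \<in> sets borel"
  shows "(avoid U ^^ Suc n) (\<lambda>_. 1) w + (T ^^ n) (indicator U) w \<le> 1"
proof (induction n arbitrary: w)
  case 0
  then show ?case by (auto simp: avoid_def indicator_def)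
next
  case (Suc n)
  let ?a = "(avoid U ^^ Suc n) (\<lambda>_. 1)" and ?h = "(T ^^ n) (indicator U)"
  have "avoid U ?a w + T ?h w \<le> T ?a w + T ?h w"
    by (intro add_right_mono avoid_le_T)
  also have "\<dots> = T (\<lambda>v. ?a v + ?h v) w"
    by (simp add: T_add)
  also have "\<dots> \<le> T (\<lambda>_. 1) w"
    by (intro T_mono Suc)
  finally show ?case by simp
qed

lemma avoid_forever_le_of_reach:
  assumes "U \<in> sets borel" "ennreal c \<le> (T ^^ n) (indicator U) w" "0 \<le> c"
  shows "avoid_forever U w \<le> ennreal (1 - c)"
proof -
  have "avoid_forever U w + ennreal c \<le> (avoid U ^^ Suc n) (\<lambda>_. 1) w + (T ^^ n) (indicator U) w"
    by (intro add_mono avoid_forever_le assms)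
  also have "\<dots> \<le> 1"
    by (rule avoid_plus_reach_le_one) fact
  finally have "avoid_forever U w + ennreal c \<le> ennreal 1" by simp
  then show ?thesis
    by (cases "avoid_forever U w") (auto simp: ennreal_plus[symmetric] top_unique assms(3) intro!: ennreal_leI simp del: ennreal_plus ennreal_1)
qed

text \<open>
  Foster's criterion. As long as \<open>B\<close> is avoided, \<open>f\<close> is a supermartingale, so with high probability
  the chain sits in a sublevel set; but there it would lose a fixed fraction of its surviving mass in
  every \<open>N\<close> steps.
\<close>

lemma avoid_forever_Foster:
  fixes f :: "real^2 \<Rightarrow> real"
  assumes [measurable]: "B \<in> sets borel" "f \<in> borel_measurable borel"
    and f: "\<And>v. v \<in> quadrant \<Longrightarrow> v \<notin> B \<Longrightarrow> T (\<lambda>v. ennreal (f v)) v \<le> ennreal (f v)"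
    and reach: "\<And>l. \<exists>N. \<exists>c>0. \<forall>v\<in>quadrant. f v \<le> l \<longrightarrow> ennreal c \<le> (T ^^ N) (indicator B) v"
    and w: "w \<in> quadrant"
  shows "avoid_forever B w = 0"
proof -
  let ?K = "\<lambda>n. (avoid B ^^ n) (\<lambda>_. 1) w" and ?r = "avoid_forever B w"
  have Kf: "(avoid B ^^ n) (\<lambda>v. ennreal (f v)) w \<le> ennreal (f w)" for n
    using w
  proof (induction n arbitrary: w)
    case (Suc n)
    have "avoid B ((avoid B ^^ n) (\<lambda>v. ennreal (f v))) w \<le> avoid B (\<lambda>v. ennreal (f v)) w"
      by (intro avoid_mono Suc)
    also have "\<dots> \<le> ennreal (f w)"
      using f[OF Suc.prems] by (cases "w \<in> B") (auto simp: avoid_def)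
    finally show ?case by simp
  qed simp
  have bound: "?r \<le> ennreal (inverse l) * ennreal (f w)" if l: "l > 0" for l
  proof -
    obtain N c where c: "c > 0" "\<And>v. v \<in> quadrant \<Longrightarrow> f v \<le> l \<Longrightarrow> ennreal c \<le> (T ^^ N) (indicator B) v"
      using reach[of l] by blast
    let ?I = "indicator {v. f v \<le> l} :: real^2 \<Rightarrow> ennreal"
    let ?g = "\<lambda>v. ennreal (inverse l) * ennreal (f v)"
    \<comment> \<open>Markov's inequality, under the chain killed at \<open>B\<close>\<close>
    have 1: "?K n \<le> (avoid B ^^ n) ?I w + ?g w" for n
    proof -
      have "?K n \<le> (avoid B ^^ n) (\<lambda>v. ?I v + ?g v) w"
      proof (rule avoid_iter_mono[OF _ w])
        fix v :: "real^2"
        show "1 \<le> ?I v + ?g v"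
          using l by (auto simp: indicator_def ennreal_mult'[symmetric] field_simps
              simp flip: ennreal_1 split: if_splits intro!: ennreal_leI)
      qed
      also have "\<dots> = (avoid B ^^ n) ?I w + ennreal (inverse l) * (avoid B ^^ n) (\<lambda>v. ennreal (f v)) w"
        by (subst avoid_iter_add) (auto simp: avoid_iter_cmult)
      also have "\<dots> \<le> (avoid B ^^ n) ?I w + ?g w"
        by (intro add_left_mono mult_left_mono Kf) auto
      finally show ?thesis .
    qed
    \<comment> \<open>each visit to the sublevel set costs a fixed fraction of the surviving mass\<close>
    have 2: "ennreal c * (avoid B ^^ n) ?I w + ?r \<le> ?K n" for n
    proof -
      have "ennreal c * (avoid B ^^ n) ?I w + ?r
          \<le> ennreal c * (avoid B ^^ n) ?I w + (avoid B ^^ n) ((avoid B ^^ Suc N) (\<lambda>_. 1)) w"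
        using avoid_forever_le[of B w "n + Suc N", unfolded funpow_add o_apply] by (rule add_left_mono)
      also have "\<dots> = (avoid B ^^ n) (\<lambda>v. ennreal c * ?I v + (avoid B ^^ Suc N) (\<lambda>_. 1) v) w"
        by (subst avoid_iter_add) (auto simp: avoid_iter_cmult)
      also have "\<dots> \<le> (avoid B ^^ n) (\<lambda>_. 1) w"
      proof (rule avoid_iter_mono[OF _ w])
        fix v :: "real^2" assume v: "v \<in> quadrant"
        have "ennreal c * ?I v \<le> (T ^^ N) (indicator B) v"
          using c(2)[OF v] by (auto simp: indicator_def)
        then have "ennreal c * ?I v + (avoid B ^^ Suc N) (\<lambda>_. 1) v
            \<le> (T ^^ N) (indicator B) v + (avoid B ^^ Suc N) (\<lambda>_. 1) v"
          by (rule add_right_mono)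
        also have "\<dots> \<le> 1"
          using avoid_plus_reach_le_one[of B N v] by (simp add: add.commute)
        finally show "ennreal c * ?I v + (avoid B ^^ Suc N) (\<lambda>_. 1) v \<le> 1" .
      qed
      finally show ?thesis .
    qed
    have 3: "ennreal c * ?K n + ?r \<le> ?K n + ennreal c * ?g w" for n
    proof -
      have "ennreal c * ?K n + ?r \<le> ennreal c * ((avoid B ^^ n) ?I w + ?g w) + ?r"
        by (intro add_right_mono mult_left_mono 1) auto
      also have "\<dots> = (ennreal c * (avoid B ^^ n) ?I w + ?r) + ennreal c * ?g w"
        by (simp add: distrib_left add_ac)
      also have "\<dots> \<le> ?K n + ennreal c * ?g w"
        by (intro add_right_mono 2)
      finally show ?thesis .
    qed
    have "ennreal c * ?r + ?r \<le> ?r + ennreal c * ?g w"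
    proof (rule LIMSEQ_le)
      show "(\<lambda>n. ennreal c * ?K n + ?r) \<longlonglongrightarrow> ennreal c * ?r + ?r"
        by (intro tendsto_add ennreal_tendsto_cmult avoid_iter_tendsto) auto
      show "(\<lambda>n. ?K n + ennreal c * ?g w) \<longlonglongrightarrow> ?r + ennreal c * ?g w"
        by (intro tendsto_add avoid_iter_tendsto) auto
    qed (use 3 in auto)
    moreover have "?r \<noteq> \<top>"
      using avoid_forever_le_one[of B w] by (auto simp: top_unique)
    ultimately have "ennreal c * ?r \<le> ennreal c * ?g w"
      by (simp add: add.commute ennreal_add_left_cancel_le)
    then show ?thesis
      using c(1) by (simp add: ennreal_mult_le_mult_iff)
  qed
  have "(\<lambda>n. ennreal (inverse (real (Suc n))) * ennreal (f w)) \<longlonglongrightarrow> ennreal 0 * ennreal (f w)"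
    by (intro tendsto_mult_ennreal tendsto_ennrealI LIMSEQ_inverse_real_of_nat tendsto_const) auto
  then have "?r \<le> ennreal 0 * ennreal (f w)"
    by (rule LIMSEQ_le_const) (use bound in auto)
  then show ?thesis by simp
qed

end

section \<open>Paths\<close>

context lindley_chain
begin

lemma component_set_measurable [measurable]:
  "{y. \<forall>i. e \<le> y $ i} \<in> sets (borel :: (real^2) measure)" "{y. \<forall>i. e < y $ i} \<in> sets (borel :: (real^2) measure)"
  by measurable

text \<open>
  By continuity from below along the thresholds \<open>1 / (n + 1)\<close>.
\<close>

lemma positive_threshold:
  fixes g :: "real^2 \<Rightarrow> real"
  assumes [measurable]: "g \<in> borel_measurable borel" and pos: "emeasure \<mu> {y. 0 < g y} \<noteq> 0"
  obtains \<epsilon> c where "\<epsilon> > 0" "c > 0" "ennreal c \<le> emeasure \<mu> {y. \<epsilon> \<le> g y}"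
proof -
  let ?A = "\<lambda>n. {y. inverse (real (Suc n)) \<le> g y}"
  have A [measurable]: "?A n \<in> sets borel" for n
    by measurable
  have un: "{y. 0 < g y} \<subseteq> (\<Union>n. ?A n)"
  proof
    fix y assume "y \<in> {y. 0 < g y}"
    then obtain n where "inverse (real (Suc n)) < g y"
      using reals_Archimedean[of "g y"] by auto
    then show "y \<in> (\<Union>n. ?A n)" by (auto intro!: exI[of _ n])
  qed
  have "\<exists>n. emeasure \<mu> (?A n) \<noteq> 0"
  proof (rule ccontr)
    assume "\<not> ?thesis"
    then have "emeasure \<mu> (\<Union>n. ?A n) = 0"
      using A by (intro emeasure_UN_eq_0) auto
    moreover have "emeasure \<mu> {y. 0 < g y} \<le> emeasure \<mu> (\<Union>n. ?A n)"
      using A by (intro emeasure_mono[OF un]) auto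
    ultimately show False using pos by simp
  qed
  then obtain n where n: "emeasure \<mu> (?A n) \<noteq> 0" by blast
  show ?thesis
  proof (rule that)
    show "inverse (real (Suc n)) > 0" by simp
    show "measure \<mu> (?A n) > 0"
      using n by (simp add: M.emeasure_eq_measure zero_less_measure_iff)
    show "ennreal (measure \<mu> (?A n)) \<le> emeasure \<mu> (?A n)"
      by (simp add: M.emeasure_eq_measure)
  qed
qed

lemma uniform_up:
  obtains \<epsilon> c where "\<epsilon> > 0" "c > 0" "ennreal c \<le> emeasure \<mu> {y. \<forall>i. \<epsilon> \<le> y $ i}"
proof -
  have m: "(\<lambda>y :: real^2. min (y $ 1) (y $ 2)) \<in> borel_measurable borel"
    by measurable
  have "emeasure \<mu> {y. 0 < min (y $ 1) (y $ 2)} \<noteq> 0"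
    using positive_up by (simp add: forall_2)
  then obtain \<epsilon> c where "\<epsilon> > 0" "c > 0" "ennreal c \<le> emeasure \<mu> {y. \<epsilon> \<le> min (y $ 1) (y $ 2)}"
    using positive_threshold[OF m] by blast
  then show ?thesis
    by (intro that[of \<epsilon> c]) (simp_all add: forall_2)
qed

lemma T_indicator_lower_bound:
  assumes [measurable]: "A \<in> sets borel" and c: "ennreal c \<le> emeasure \<mu> A"
    and \<phi>: "\<And>y. y \<in> A \<Longrightarrow> d \<le> \<phi> (lindley_step w y)"
  shows "d * ennreal c \<le> T \<phi> w"
proof -
  have "d * ennreal c \<le> d * emeasure \<mu> A"
    using c by (intro mult_left_mono) auto
  also have "\<dots> = (\<integral>\<^sup>+ y. d * indicator A y \<partial>\<mu>)"
    by (subst nn_integral_cmult_indicator) auto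
  also have "\<dots> \<le> T \<phi> w"
    unfolding T_def by (intro nn_integral_mono) (auto simp: indicator_def \<phi>)
  finally show ?thesis .
qed

text \<open>
  Each step with both coordinates at least \<open>\<epsilon>\<close> lowers both coordinates of the chain by \<open>\<epsilon>\<close>, until
  they are cut off at \<open>0\<close>.
\<close>

lemma reach_zero:
  "\<exists>N. \<exists>c>0. \<forall>v\<in>quadrant. norm v \<le> R \<longrightarrow> ennreal c \<le> (T ^^ N) (indicator {0}) v"
proof -
  obtain \<epsilon> c where \<epsilon>: "\<epsilon> > 0" and c: "c > 0" "ennreal c \<le> emeasure \<mu> {y. \<forall>i. \<epsilon> \<le> y $ i}"
    by (rule uniform_up)
  have reach: "ennreal (c ^ n) \<le> (T ^^ n) (indicator {0}) v"
    if "v \<in> quadrant" "\<And>i. v $ i \<le> real n * \<epsilon>" for n v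
    using that
  proof (induction n arbitrary: v)
    case 0
    then have "v = 0" by (auto simp: vec_eq_iff quadrant_def intro: antisym)
    then show ?case by simp
  next
    case (Suc n)
    have "ennreal (c ^ n) * ennreal c \<le> T ((T ^^ n) (indicator {0})) v"
    proof (rule T_indicator_lower_bound[OF _ c(2)])
      fix y :: "real^2" assume y: "y \<in> {y. \<forall>i. \<epsilon> \<le> y $ i}"
      have "v $ i - y $ i \<le> real n * \<epsilon>" for i
        using y Suc.prems(2)[of i] by (auto simp: algebra_simps dest: spec[of _ i])
      with \<epsilon> show "ennreal (c ^ n) \<le> (T ^^ n) (indicator {0}) (lindley_step v y)"
        by (intro Suc.IH) auto
    qed simp
    then show ?case
      using c(1) by (simp add: ennreal_mult[symmetric] mult.commute)
  qed
  obtain N where N: "R / \<epsilon> \<le> real N"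
    using real_arch_simple by blast
  show ?thesis
  proof (intro exI[of _ N] exI[of _ "c ^ N"] conjI ballI impI)
    fix v :: "real^2" assume v: "v \<in> quadrant" "norm v \<le> R"
    have "v $ i \<le> real N * \<epsilon>" for i
      using component_le_norm_cart[of v i] v(2) N \<epsilon> by (simp add: field_simps)
    then show "ennreal (c ^ N) \<le> (T ^^ N) (indicator {0}) v"
      by (intro reach v)
  qed (use c in auto)
qed

text \<open>
  Two chains driven by the same increments stay ordered, so the lower one is at the origin whenever
  the upper one is.
\<close>

lemma return_probability_antimono:
  assumes "\<And>i. v $ i \<le> w $ i" "v \<in> quadrant"
  shows "(T ^^ n) (indicator {0}) w \<le> (T ^^ n) (indicator {0}) v"
  using assms
proof (induction n arbitrary: v w)
  case 0
  then have "w = 0 \<Longrightarrow> v = 0" by (auto simp: vec_eq_iff quadrant_def intro: antisym)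
  then show ?case by (auto simp: indicator_def)
next
  case (Suc n)
  show ?case
    unfolding funpow.simps o_apply T_def[of "(T ^^ n) _" w] T_def[of "(T ^^ n) _" v]
  proof (intro nn_integral_mono Suc.IH)
    fix y i
    show "lindley_step v y $ i \<le> lindley_step w y $ i"
      using Suc.prems(1)[of i] unfolding lindley_step_nth by (intro max.mono) auto
  qed simp
qed

lemma return_probability_le_origin:
  "w \<in> quadrant \<Longrightarrow> (T ^^ n) (indicator {0}) w \<le> (T ^^ n) (indicator {0}) 0"
  by (rule return_probability_antimono) (auto simp: quadrant_def)

text \<open>
  The increments of a sequence are indexed from \<open>0\<close> here, whereas \<open>lindley\<close> starts with index \<open>1\<close>.
\<close>

definition path :: "real^2 \<Rightarrow> (nat \<Rightarrow> real^2) \<Rightarrow> nat \<Rightarrow> real^2" where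
  "path w \<omega> n = lindley (\<lambda>n \<omega>. \<omega> (n - 1)) w n \<omega>"

lemma path_0 [simp]: "path w \<omega> 0 = w"
  by (simp add: path_def)

lemma path_Suc: "path w \<omega> (Suc n) = lindley_step (path w \<omega> n) (\<omega> n)"
  by (simp add: path_def)

lemma path_front [simp]: "path w (case_nat y \<omega>) (Suc n) = path (lindley_step w y) \<omega> n"
  by (induction n) (simp_all add: path_Suc)

lemma component_measurable [measurable]: "(\<lambda>\<omega>. \<omega> n) \<in> borel_measurable S"
proof -
  have "(\<lambda>\<omega>. \<omega> n) \<in> measurable S \<mu>" by (rule measurable_component_singleton) simp
  also have "measurable S \<mu> = borel_measurable S" by (rule measurable_cong_sets) simp_all
  finally show ?thesis .
qed

lemma path_measurable [measurable]: "(\<lambda>\<omega>. path w \<omega> n) \<in> borel_measurable S"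
  by (induction n) (simp_all add: path_Suc)

lemma space_S [simp]: "space S = UNIV"
  by (auto simp: space_PiM)

lemma measurable_case_nat_S: "(\<lambda>(s, \<omega>). case_nat s \<omega>) \<in> measurable (\<mu> \<Otimes>\<^sub>M S) S"
  by measurable

text \<open>
  The Markov property at time \<open>1\<close>. Later times are always reached by induction on this first step.
\<close>

lemma nn_integral_S_first_step:
  assumes [measurable]: "F \<in> borel_measurable S"
  shows "(\<integral>\<^sup>+ \<omega>. F \<omega> \<partial>S) = (\<integral>\<^sup>+ y. (\<integral>\<^sup>+ \<omega>. F (case_nat y \<omega>) \<partial>S) \<partial>\<mu>)"
proof -
  note measurable_case_nat_S [measurable]
  have "(\<integral>\<^sup>+ \<omega>. F \<omega> \<partial>S) = (\<integral>\<^sup>+ \<omega>. F \<omega> \<partial>distr (\<mu> \<Otimes>\<^sub>M S) S (\<lambda>(s, \<omega>). case_nat s \<omega>))"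
    by (simp add: PiM_iter)
  also have "\<dots> = (\<integral>\<^sup>+ p. F (case_nat (fst p) (snd p)) \<partial>(\<mu> \<Otimes>\<^sub>M S))"
    by (subst nn_integral_distr) (auto simp: split_beta')
  also have "\<dots> = (\<integral>\<^sup>+ y. (\<integral>\<^sup>+ \<omega>. F (case_nat y \<omega>) \<partial>S) \<partial>\<mu>)"
    by (subst P.nn_integral_fst[symmetric]) auto
  finally show ?thesis .
qed

lemma emeasure_S_first_step:
  assumes [measurable]: "{\<omega>. Q \<omega>} \<in> sets S"
  shows "emeasure S {\<omega>. Q \<omega>} = (\<integral>\<^sup>+ y. emeasure S {\<omega>. Q (case_nat y \<omega>)} \<partial>\<mu>)"
proof -
  note measurable_case_nat_S [measurable]
  have m: "{\<omega>. Q (case_nat y \<omega>)} \<in> sets S" for y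
  proof -
    have "(\<lambda>\<omega>. case_nat y \<omega>) \<in> measurable S S"
      using measurable_compose[OF measurable_Pair1'[of y \<mu> S] measurable_case_nat_S] by simp
    from measurable_sets[OF this assms] show ?thesis by (simp add: vimage_def)
  qed
  have "emeasure S {\<omega>. Q \<omega>} = (\<integral>\<^sup>+ \<omega>. indicator {\<omega>. Q \<omega>} \<omega> \<partial>S)"
    by simp
  also have "\<dots> = (\<integral>\<^sup>+ y. (\<integral>\<^sup>+ \<omega>. indicator {\<omega>. Q (case_nat y \<omega>)} \<omega> \<partial>S) \<partial>\<mu>)"
    by (subst nn_integral_S_first_step) (auto intro!: nn_integral_cong simp: indicator_def)
  also have "\<dots> = (\<integral>\<^sup>+ y. emeasure S {\<omega>. Q (case_nat y \<omega>)} \<partial>\<mu>)"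
    using m by simp
  finally show ?thesis .
qed

lemma path_law:
  assumes [measurable]: "A \<in> sets borel"
  shows "emeasure S {\<omega>. path w \<omega> n \<in> A} = (T ^^ n) (indicator A) w"
proof (induction n arbitrary: w)
  case 0
  then show ?case using P.emeasure_space_1 by (auto simp: indicator_def)
next
  case (Suc n)
  have [measurable]: "{\<omega>. path w \<omega> (Suc n) \<in> A} \<in> sets S"
    using measurable_sets[OF path_measurable[of w "Suc n"] assms] by (simp add: vimage_def)
  have "emeasure S {\<omega>. path w \<omega> (Suc n) \<in> A}
      = (\<integral>\<^sup>+ y. emeasure S {\<omega>. path (lindley_step w y) \<omega> n \<in> A} \<partial>\<mu>)"
    by (subst emeasure_S_first_step) simp_all
  also have "\<dots> = T ((T ^^ n) (indicator A)) w"
    unfolding Suc by (rule T_def[symmetric])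
  finally show ?case by simp
qed

lemma path_avoid_sets [measurable]:
  "U \<in> sets borel \<Longrightarrow> {\<omega>. \<forall>k<n. path w \<omega> k \<notin> U} \<in> sets S"
  "U \<in> sets borel \<Longrightarrow> {\<omega>. \<forall>k. path w \<omega> (m + k) \<notin> U} \<in> sets S"
proof -
  assume [measurable]: "U \<in> sets borel"
  have "{\<omega> \<in> space S. \<forall>k<n. path w \<omega> k \<notin> U} \<in> sets S" "{\<omega> \<in> space S. \<forall>k. path w \<omega> (m + k) \<notin> U} \<in> sets S"
    by measurable
  then show "{\<omega>. \<forall>k<n. path w \<omega> k \<notin> U} \<in> sets S" "{\<omega>. \<forall>k. path w \<omega> (m + k) \<notin> U} \<in> sets S"
    by simp_all
qed

lemma path_avoid_law:
  assumes [measurable]: "U \<in> sets borel"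
  shows "emeasure S {\<omega>. \<forall>k<n. path w \<omega> k \<notin> U} = (avoid U ^^ n) (\<lambda>_. 1) w"
proof (induction n arbitrary: w)
  case 0
  then show ?case using P.emeasure_space_1 by simp
next
  case (Suc n)
  have "emeasure S {\<omega>. \<forall>k<Suc n. path w \<omega> k \<notin> U}
      = (\<integral>\<^sup>+ y. emeasure S {\<omega>. w \<notin> U \<and> (\<forall>k<n. path (lindley_step w y) \<omega> k \<notin> U)} \<partial>\<mu>)"
    by (subst emeasure_S_first_step[OF path_avoid_sets(1)[OF assms]]) (simp add: All_less_Suc2)
  also have "\<dots> = indicator (- U) w * T ((avoid U ^^ n) (\<lambda>_. 1)) w"
    unfolding T_def[of "(avoid U ^^ n) (\<lambda>_. 1)" w] Suc[symmetric] by (cases "w \<in> U") simp_all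
  finally show ?case by (simp add: avoid_def[of U "(avoid U ^^ n) (\<lambda>_. 1)"])
qed

lemma AE_path_infinitely_often:
  assumes [measurable]: "U \<in> sets borel"
    and r: "\<And>v. v \<in> quadrant \<Longrightarrow> avoid_forever U v = 0" and w: "w \<in> quadrant"
  shows "AE \<omega> in S. \<exists>\<^sub>\<infinity>n. path w \<omega> n \<in> U"
proof -
  have 0: "emeasure S {\<omega>. \<forall>k. path w \<omega> (m + k) \<notin> U} = 0" for m
    using w
  proof (induction m arbitrary: w)
    case 0
    have "emeasure S {\<omega>. \<forall>k. path w \<omega> (0 + k) \<notin> U} \<le> (avoid U ^^ n) (\<lambda>_. 1) w" for n
      unfolding path_avoid_law[OF assms(1), symmetric]
      by (intro emeasure_mono path_avoid_sets assms) auto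
    then have "emeasure S {\<omega>. \<forall>k. path w \<omega> (0 + k) \<notin> U} \<le> avoid_forever U w"
      unfolding avoid_forever_def by (intro INF_greatest)
    with r[OF 0] show ?case by simp
  next
    case (Suc m)
    show ?case
      by (subst emeasure_S_first_step[OF path_avoid_sets(2)[OF assms(1)]]) (simp add: Suc.IH)
  qed
  have "AE \<omega> in S. \<not> (\<forall>k. path w \<omega> (m + k) \<notin> U)" for m
    using 0[of m] by (intro AE_I[of _ _ "{\<omega>. \<forall>k. path w \<omega> (m + k) \<notin> U}"]) (auto intro: path_avoid_sets assms)
  then have "AE \<omega> in S. \<forall>m. \<not> (\<forall>k. path w \<omega> (m + k) \<notin> U)"
    by (simp add: AE_all_countable)
  then show ?thesis
    by eventually_elim (auto simp: INFM_nat_le intro: le_add1)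
qed

lemma AE_path_norm_at_top:
  assumes "\<And>R. (\<Sum>n. (T ^^ n) (indicator (cball 0 R)) w) < \<infinity>"
  shows "AE \<omega> in S. filterlim (\<lambda>n. norm (path w \<omega> n)) at_top sequentially"
proof -
  have "AE \<omega> in S. \<forall>R::nat. eventually (\<lambda>n. path w \<omega> n \<notin> cball 0 (real R)) sequentially"
    unfolding AE_all_countable
  proof
    fix R :: nat
    let ?A = "\<lambda>n. {\<omega>. path w \<omega> n \<in> cball 0 (real R)}"
    have [measurable]: "?A n \<in> sets S" for n
      using measurable_sets[OF path_measurable[of w n], of "cball 0 (real R)"]
      by (simp add: vimage_def del: mem_cball_0)
    have e: "emeasure S (?A n) = (T ^^ n) (indicator (cball 0 (real R))) w" for n
      by (rule path_law) simp
    have "AE \<omega> in S. eventually (\<lambda>n. \<omega> \<in> space S - ?A n) sequentially"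
    proof (rule borel_cantelli_AE1)
      show "emeasure S (?A n) < \<infinity>" for n
        by (simp add: P.emeasure_eq_measure)
      have "(\<Sum>n. ennreal (measure S (?A n))) \<noteq> \<top>"
        using assms[of "real R"] by (simp add: e[symmetric] P.emeasure_eq_measure)
      then show "summable (\<lambda>n. measure S (?A n))"
        by (intro summable_suminf_not_top) auto
    qed fact
    then show "AE \<omega> in S. eventually (\<lambda>n. path w \<omega> n \<notin> cball 0 (real R)) sequentially"
      by simp
  qed
  then show ?thesis
  proof eventually_elim
    case (elim \<omega>)
    show ?case
      unfolding filterlim_at_top_dense
    proof
      fix Z :: real
      obtain R :: nat where "Z \<le> real R" using real_arch_simple by blast
      with elim[THEN spec, of R] show "eventually (\<lambda>n. Z < norm (path w \<omega> n)) sequentially"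
        by (auto elim: eventually_mono)
    qed
  qed
qed

end

section \<open>Invariant measures\<close>

lemma suminf_swap_ennreal:
  fixes f :: "nat \<Rightarrow> nat \<Rightarrow> ennreal"
  shows "(\<Sum>i. \<Sum>n. f i n) = (\<Sum>n. \<Sum>i. f i n)"
  using nn_integral_suminf[of f "count_space UNIV"] by (simp add: nn_integral_count_space_nat)

context lindley_chain
begin

text \<open>
  The topological support of the occupation measure of the chain started at the origin.
\<close>

definition reachable :: "(real^2) set" where
  "reachable = {w. \<forall>U. open U \<longrightarrow> w \<in> U \<longrightarrow> (\<exists>n. (T ^^ n) (indicator U) 0 \<noteq> 0)}"

lemma closed_reachable: "closed reachable"
proof -
  have "- reachable = \<Union>{U. open U \<and> (\<forall>n. (T ^^ n) (indicator U) 0 = 0)}"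
    unfolding reachable_def by blast
  moreover have "open (\<Union>{U. open U \<and> (\<forall>n. (T ^^ n) (indicator U) 0 = 0)})"
    by blast
  ultimately show ?thesis by (simp add: closed_def)
qed

lemma zero_reachable: "0 \<in> reachable"
  unfolding reachable_def by (auto intro!: exI[of _ 0])

lemma reachable_subset_quadrant: "reachable \<subseteq> quadrant"
proof -
  have "(T ^^ n) (indicator (- quadrant)) w = 0" if "w \<in> quadrant" for n w
    using that
  proof (induction n arbitrary: w)
    case (Suc n)
    have "T ((T ^^ n) (indicator (- quadrant))) w \<le> T (\<lambda>_. 0) w"
      by (intro T_mono) (simp add: Suc.IH)
    then show ?case by simp
  qed auto
  then have "\<forall>n. (T ^^ n) (indicator (- quadrant)) 0 = 0"
    by simp
  moreover have "open (- quadrant)"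
    using closed_quadrant by auto
  ultimately show ?thesis
    unfolding reachable_def by blast
qed

text \<open>
  From the origin \<open>U\<close> is hit with positive probability, and the origin is hit from everywhere.
\<close>

lemma avoid_forever_reachable:
  assumes rec: "\<And>v. v \<in> quadrant \<Longrightarrow> avoid_forever {0} v = 0"
    and U: "open U" "U \<inter> reachable \<noteq> {}" and w: "w \<in> quadrant"
  shows "avoid_forever U w = 0"
proof -
  have [measurable]: "U \<in> sets borel" using U by simp
  obtain n where n: "(T ^^ n) (indicator U) 0 \<noteq> 0"
    using U unfolding reachable_def by blast
  have le1: "(T ^^ n) (indicator U) 0 \<le> 1"
    using path_law[OF \<open>U \<in> sets borel\<close>, of 0 n, symmetric] P.emeasure_le_1 by simp
  obtain c where c: "(T ^^ n) (indicator U) 0 = ennreal c" "0 < c"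
    using n le1 by (cases "(T ^^ n) (indicator U) 0") (auto simp: top_unique less_le)
  show ?thesis
  proof (rule avoid_forever_relay[OF _ _ rec _ _ w])
    show "ennreal (1 - c) < 1"
      using c(2) by (simp add: ennreal_less_one_iff)
    fix v :: "real^2" assume "v \<in> quadrant \<inter> {0}"
    then show "avoid_forever U v \<le> ennreal (1 - c)"
      using c by (intro avoid_forever_le_of_reach[of U c n]) auto
  qed auto
qed

text \<open>
  Invariance on sets says that \<open>\<nu>\<close> equals the image of \<open>\<nu> \<Otimes>\<^sub>M \<mu>\<close> under the step map, which gives it
  for all nonnegative functions at once.
\<close>

lemma nn_integral_invariant:
  assumes [measurable_cong]: "sets \<nu> = sets borel"
    and inv: "\<And>B. B \<in> sets borel \<Longrightarrow> emeasure \<nu> B = (\<integral>\<^sup>+ w. T (indicator B) w \<partial>\<nu>)"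
    and [measurable]: "\<phi> \<in> borel_measurable borel"
  shows "(\<integral>\<^sup>+ w. (T ^^ n) \<phi> w \<partial>\<nu>) = (\<integral>\<^sup>+ w. \<phi> w \<partial>\<nu>)"
proof -
  let ?D = "distr (\<nu> \<Otimes>\<^sub>M \<mu>) borel (\<lambda>p. lindley_step (fst p) (snd p))"
  have *: "(\<integral>\<^sup>+ w. \<psi> w \<partial>?D) = (\<integral>\<^sup>+ w. T \<psi> w \<partial>\<nu>)"
    if [measurable]: "\<psi> \<in> borel_measurable borel" for \<psi>
    unfolding T_def by (subst nn_integral_distr) (auto simp: M.nn_integral_fst[symmetric])
  have "\<nu> = ?D"
  proof (rule measure_eqI)
    fix B assume "B \<in> sets \<nu>"
    then have [measurable]: "B \<in> sets borel" by (simp add: assms)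
    show "emeasure \<nu> B = emeasure ?D B"
      using *[of "indicator B"] inv[of B] by simp
  qed (simp add: assms)
  then have step: "(\<integral>\<^sup>+ w. T \<psi> w \<partial>\<nu>) = (\<integral>\<^sup>+ w. \<psi> w \<partial>\<nu>)" if "\<psi> \<in> borel_measurable borel" for \<psi>
    using *[OF that] by simp
  show ?thesis
    by (induction n) (simp_all add: step)
qed

context
  fixes \<nu> :: "(real^2) measure"
  assumes sets_nu [measurable_cong, simp]: "sets \<nu> = sets borel"
    and inv: "\<And>B. B \<in> sets borel \<Longrightarrow> emeasure \<nu> B = (\<integral>\<^sup>+ w. T (indicator B) w \<partial>\<nu>)"
    and quad: "emeasure \<nu> (- quadrant) = 0"
begin

lemma AE_quadrant: "AE w in \<nu>. w \<in> quadrant"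
  using closed_quadrant quad by (intro AE_I[of _ _ "- quadrant"]) auto

text \<open>
  The atom at the origin controls the mass of bounded sets, because a fixed fraction of that mass is
  transported to the origin in a fixed number of steps.
\<close>

lemma invariant_bounded_bound:
  "\<exists>c>0. ennreal c * emeasure \<nu> (cball 0 R) \<le> emeasure \<nu> {0}"
proof -
  obtain N c where c: "c > 0" "\<And>v. v \<in> quadrant \<Longrightarrow> norm v \<le> R \<Longrightarrow> ennreal c \<le> (T ^^ N) (indicator {0}) v"
    using reach_zero[of R] by blast
  have "ennreal c * emeasure \<nu> (cball 0 R) = (\<integral>\<^sup>+ w. ennreal c * indicator (cball 0 R) w \<partial>\<nu>)"
    by (subst nn_integral_cmult_indicator) auto
  also have "\<dots> \<le> (\<integral>\<^sup>+ w. (T ^^ N) (indicator {0}) w \<partial>\<nu>)"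
    using AE_quadrant by (intro nn_integral_mono_AE, eventually_elim) (auto simp: indicator_def c)
  also have "\<dots> = emeasure \<nu> {0}"
    by (subst nn_integral_invariant[OF sets_nu inv]) auto
  finally show ?thesis using c(1) by blast
qed

lemma invariant_finite_on_compact:
  assumes "emeasure \<nu> {0} < \<infinity>" "compact K"
  shows "emeasure \<nu> K < \<infinity>"
proof -
  obtain R where R: "K \<subseteq> cball 0 R"
    using bounded_subset_ballD[OF compact_imp_bounded[OF assms(2)], of 0] ball_subset_cball by blast
  obtain c where c: "c > 0" "ennreal c * emeasure \<nu> (cball 0 R) \<le> emeasure \<nu> {0}"
    using invariant_bounded_bound by blast
  have "emeasure \<nu> (cball 0 R) \<noteq> \<top>"
    using c assms(1) by (auto simp: ennreal_mult_top top_unique)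
  moreover have "emeasure \<nu> K \<le> emeasure \<nu> (cball 0 R)"
    by (rule emeasure_mono[OF R]) auto
  ultimately show ?thesis
    by (auto simp: top_unique less_top)
qed

text \<open>
  If \<open>\<nu>\<close> were finite, then \<open>\<nu> {0} = \<integral> (T ^^ n) (indicator {0}) d\<nu>\<close> would be at most the total mass
  times the return probability at the origin, hence zero, and all bounded sets would be null sets.
\<close>

lemma invariant_infinite:
  assumes nz: "emeasure \<nu> UNIV \<noteq> 0"
    and small: "\<And>e. e > 0 \<Longrightarrow> \<exists>n. (T ^^ n) (indicator {0}) 0 \<le> ennreal e"
  shows "emeasure \<nu> UNIV = \<infinity>"
proof (rule ccontr)
  assume "emeasure \<nu> UNIV \<noteq> \<infinity>"
  then obtain m where m: "emeasure \<nu> UNIV = ennreal m" "0 \<le> m"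
    by (cases "emeasure \<nu> UNIV") auto
  have "emeasure \<nu> {0} \<le> ennreal e" if e: "e > 0" for e
  proof -
    obtain n where n: "(T ^^ n) (indicator {0}) 0 \<le> ennreal (e / (m + 1))"
      using small[of "e / (m + 1)"] e m by auto
    have "emeasure \<nu> {0} = (\<integral>\<^sup>+ w. (T ^^ n) (indicator {0}) w \<partial>\<nu>)"
      by (subst nn_integral_invariant[OF sets_nu inv]) auto
    also have "\<dots> \<le> (\<integral>\<^sup>+ w. ennreal (e / (m + 1)) \<partial>\<nu>)"
      using AE_quadrant
      by (intro nn_integral_mono_AE, eventually_elim) (meson n order.trans return_probability_le_origin)
    also have "\<dots> = ennreal (e / (m + 1) * m)"
      using m e sets_eq_imp_space_eq[OF sets_nu] by (simp add: ennreal_mult[symmetric])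
    also have "\<dots> \<le> ennreal e"
      using m e by (intro ennreal_leI) (simp add: field_simps)
    finally show ?thesis .
  qed
  then have zero: "emeasure \<nu> {0} = 0"
    by (metis ennreal_le_epsilon add.left_neutral le_zero_eq)
  have "emeasure \<nu> (cball 0 (real R)) = 0" for R :: nat
    using invariant_bounded_bound[of "real R"] by (auto simp: zero)
  then have "emeasure \<nu> (\<Union>R::nat. cball 0 (real R)) = 0"
    by (intro emeasure_UN_eq_0) auto
  moreover have "(\<Union>R::nat. cball 0 (real R)) = (UNIV :: (real^2) set)"
    using real_arch_simple by auto
  ultimately show False using nz by simp
qed

text \<open>
  Fatou's lemma applied to \<open>\<nu> {0} = \<integral> (T ^^ n) (indicator {0}) d\<nu>\<close>.
\<close>

lemma invariant_finite:
  assumes fin: "emeasure \<nu> {0} < \<infinity>" and p: "p > 0"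
    and return: "\<And>w. w \<in> quadrant \<Longrightarrow> eventually (\<lambda>n. ennreal p \<le> (T ^^ n) (indicator {0}) w) sequentially"
  shows "emeasure \<nu> UNIV < \<infinity>"
proof -
  have "ennreal p * emeasure \<nu> UNIV = (\<integral>\<^sup>+ w. ennreal p \<partial>\<nu>)"
    using sets_eq_imp_space_eq[OF sets_nu] by simp
  also have "\<dots> \<le> (\<integral>\<^sup>+ w. liminf (\<lambda>n. (T ^^ n) (indicator {0}) w) \<partial>\<nu>)"
    using AE_quadrant
    by (intro nn_integral_mono_AE, eventually_elim) (intro Liminf_bounded return)
  also have "\<dots> \<le> liminf (\<lambda>n. \<integral>\<^sup>+ w. (T ^^ n) (indicator {0}) w \<partial>\<nu>)"
    by (rule nn_integral_liminf) (simp add: measurable_cong_sets[OF sets_nu refl] T_iter_measurable)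
  also have "\<dots> = emeasure \<nu> {0}"
    by (subst nn_integral_invariant[OF sets_nu inv]) (auto simp: Liminf_const)
  finally have "ennreal p * emeasure \<nu> UNIV < \<top>"
    using fin by simp
  then show ?thesis
    using p by (auto simp: ennreal_mult_less_top less_top)
qed

end

text \<open>
  In contrast to \<open>avoid {0}\<close> the chain is killed upon arrival at the origin, so it can be started there.
  Thus \<open>(T_off ^^ n) \<phi> 0\<close> is the expectation of \<open>\<phi>\<close> at time \<open>n\<close> on the event that the chain has not
  returned yet.
\<close>

definition T_off :: "(real^2 \<Rightarrow> ennreal) \<Rightarrow> real^2 \<Rightarrow> ennreal" where
  "T_off \<phi> = T (\<lambda>v. indicator (- {0}) v * \<phi> v)"

text \<open>
  The expected number of visits to \<open>B\<close> during an excursion from the origin; the starting point counts,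
  the endpoint does not.
\<close>

definition excursion_measure :: "(real^2) measure" where
  "excursion_measure = measure_of UNIV (sets borel) (\<lambda>B. \<Sum>n. (T_off ^^ n) (indicator B) 0)"

lemma T_off_measurable [measurable]:
  assumes [measurable]: "\<phi> \<in> borel_measurable borel"
  shows "T_off \<phi> \<in> borel_measurable borel"
  unfolding T_off_def by measurable

lemma T_off_iter_measurable [measurable]:
  "\<phi> \<in> borel_measurable borel \<Longrightarrow> (T_off ^^ n) \<phi> \<in> borel_measurable borel"
  by (induction n) auto

lemma T_off_integrand_measurable:
  assumes [measurable]: "\<phi> \<in> borel_measurable borel"
  shows "(\<lambda>y. indicator (- {0}) (lindley_step w y) * (T_off ^^ n) \<phi> (lindley_step w y)) \<in> borel_measurable \<mu>"
proof (rule measurable_compose[where f = "lindley_step w"])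
  show "lindley_step w \<in> borel_measurable \<mu>"
    using measurable_lindley_step[of "\<lambda>_. w" \<mu> "\<lambda>y. y", OF measurable_const measurable_ident_sets[OF sets_law]]
    by simp
  have "(\<lambda>v. indicator (- {0}) v :: ennreal) \<in> borel_measurable (borel :: (real^2) measure)"
    by (intro borel_measurable_indicator) auto
  then show "(\<lambda>v. indicator (- {0}) v * (T_off ^^ n) \<phi> v) \<in> borel_measurable borel"
    by (rule borel_measurable_times_ennreal) (rule T_off_iter_measurable[OF assms])
qed

lemma T_off_iter_add:
  assumes [measurable]: "\<phi> \<in> borel_measurable borel" "\<psi> \<in> borel_measurable borel"
  shows "(T_off ^^ n) (\<lambda>v. \<phi> v + \<psi> v) = (\<lambda>v. (T_off ^^ n) \<phi> v + (T_off ^^ n) \<psi> v)"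
proof (induction n)
  case (Suc n)
  have "(T_off ^^ Suc n) (\<lambda>v. \<phi> v + \<psi> v) = T_off (\<lambda>v. (T_off ^^ n) \<phi> v + (T_off ^^ n) \<psi> v)"
    by (simp add: Suc)
  also have "\<dots> = (\<lambda>v. (T_off ^^ Suc n) \<phi> v + (T_off ^^ Suc n) \<psi> v)"
    by (simp add: T_off_def[of "\<lambda>v. _ v + _ v"] T_off_def[of "(_ ^^ n) _"] distrib_left T_add)
  finally show ?case .
qed simp

lemma T_off_iter_cmult:
  assumes [measurable]: "\<phi> \<in> borel_measurable borel"
  shows "(T_off ^^ n) (\<lambda>v. c * \<phi> v) = (\<lambda>v. c * (T_off ^^ n) \<phi> v)"
proof (induction n)
  case (Suc n)
  have "(T_off ^^ Suc n) (\<lambda>v. c * \<phi> v) = T (\<lambda>v. c * (indicator (- {0}) v * (T_off ^^ n) \<phi> v))"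
    by (simp add: Suc T_off_def[of "\<lambda>v. c * _ v"] mult.left_commute)
  also have "\<dots> = (\<lambda>v. c * (T_off ^^ Suc n) \<phi> v)"
    by (subst T_cmult) (simp_all add: T_off_def[of "(_ ^^ n) _"])
  finally show ?case .
qed simp

lemma T_off_iter_SUP:
  assumes [measurable]: "\<And>i. \<phi> i \<in> borel_measurable borel" and inc: "incseq \<phi>"
  shows "(T_off ^^ n) (\<lambda>v. SUP i. \<phi> i v) w = (SUP i. (T_off ^^ n) (\<phi> i) w) \<and>
     incseq (\<lambda>i. (T_off ^^ n) (\<phi> i))"
proof (induction n arbitrary: w)
  case 0
  then show ?case using inc by simp
next
  case (Suc n)
  let ?f = "\<lambda>i. (T_off ^^ n) (\<phi> i)"
  have inc': "incseq ?f" using Suc by blast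
  then have mono: "?f i v \<le> ?f j v" if "i \<le> j" for i j v
    using that by (auto simp: incseq_def le_fun_def)
  have eq: "(T_off ^^ n) (\<lambda>v. SUP i. \<phi> i v) = (\<lambda>v. SUP i. ?f i v)"
    using Suc by (auto simp: fun_eq_iff)
  have "(T_off ^^ Suc n) (\<lambda>v. SUP i. \<phi> i v) w
      = (\<integral>\<^sup>+ y. (SUP i. indicator (- {0}) (lindley_step w y) * ?f i (lindley_step w y)) \<partial>\<mu>)"
    by (simp add: eq T_off_def[of "\<lambda>v. SUP i. _ i v"] T_def SUP_mult_left_ennreal)
  also have "\<dots> = (SUP i. \<integral>\<^sup>+ y. indicator (- {0}) (lindley_step w y) * ?f i (lindley_step w y) \<partial>\<mu>)"
  proof (rule nn_integral_monotone_convergence_SUP)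
    show "incseq (\<lambda>i y. indicator (- {0}) (lindley_step w y) * ?f i (lindley_step w y))"
      by (intro incseq_SucI le_funI mult_left_mono mono) auto
  qed (rule T_off_integrand_measurable, simp)
  also have "\<dots> = (SUP i. (T_off ^^ Suc n) (\<phi> i) w)"
    by (simp add: T_off_def[of "(_ ^^ n) _"] T_def)
  finally have 1: "(T_off ^^ Suc n) (\<lambda>v. SUP i. \<phi> i v) w = (SUP i. (T_off ^^ Suc n) (\<phi> i) w)" .
  have "incseq (\<lambda>i. (T_off ^^ Suc n) (\<phi> i))"
    by (intro incseq_SucI le_funI)
       (auto simp: T_off_def[of "(_ ^^ n) _"] intro!: T_mono mult_left_mono mono)
  with 1 show ?case by blast
qed

lemma T_off_iter_suminf:
  assumes [measurable]: "\<And>i. \<phi> i \<in> borel_measurable borel"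
  shows "(T_off ^^ n) (\<lambda>v. \<Sum>i. \<phi> i v) w = (\<Sum>i. (T_off ^^ n) (\<phi> i) w)"
proof (induction n arbitrary: w)
  case (Suc n)
  have eq: "(T_off ^^ n) (\<lambda>v. \<Sum>i. \<phi> i v) = (\<lambda>v. \<Sum>i. (T_off ^^ n) (\<phi> i) v)"
    using Suc by (auto simp: fun_eq_iff)
  have "(T_off ^^ Suc n) (\<lambda>v. \<Sum>i. \<phi> i v) w
      = (\<integral>\<^sup>+ y. (\<Sum>i. indicator (- {0}) (lindley_step w y) * (T_off ^^ n) (\<phi> i) (lindley_step w y)) \<partial>\<mu>)"
    by (simp add: eq T_off_def[of "\<lambda>v. \<Sum>i. (T_off ^^ n) (\<phi> i) v"] T_def)
  also have "\<dots> = (\<Sum>i. (T_off ^^ Suc n) (\<phi> i) w)"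
    by (subst nn_integral_suminf) (simp_all add: T_off_integrand_measurable T_off_def[of "(_ ^^ n) _"] T_def)
  finally show ?case .
qed simp

lemma sets_excursion_measure [measurable_cong, simp]: "sets excursion_measure = sets borel"
  unfolding excursion_measure_def
  using sets.sets_measure_of_eq[of "borel :: (real^2) measure"] by simp

lemma measurable_excursion_measure [simp]:
  "borel_measurable excursion_measure = borel_measurable borel"
  by (rule measurable_cong_sets) simp_all

lemma emeasure_excursion_measure:
  assumes "B \<in> sets borel"
  shows "emeasure excursion_measure B = (\<Sum>n. (T_off ^^ n) (indicator B) 0)"
  unfolding excursion_measure_def
proof (rule emeasure_measure_of_sigma)
  show "sigma_algebra UNIV (sets (borel :: (real^2) measure))"
    using sets.sigma_algebra_axioms[of "borel :: (real^2) measure"] by simp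
  have "(T_off ^^ n) (\<lambda>_. 0) = (\<lambda>_. 0)" for n
    by (induction n) (auto simp: T_off_def)
  then have "(T_off ^^ n) (indicator {}) 0 = 0" for n
    by (simp add: indicator_def[abs_def])
  then show "positive (sets borel) (\<lambda>B. \<Sum>n. (T_off ^^ n) (indicator B) 0)"
    by (simp add: positive_def)
  show "countably_additive (sets borel) (\<lambda>B. \<Sum>n. (T_off ^^ n) (indicator B) 0)"
    unfolding countably_additive_def
  proof (intro allI impI)
    fix A :: "nat \<Rightarrow> (real^2) set"
    assume A: "range A \<subseteq> sets borel" "disjoint_family A"
    have "indicator (\<Union>i. A i) = (\<lambda>v. \<Sum>i. indicator (A i) v :: ennreal)"
      by (rule ext) (rule suminf_indicator[OF A(2), symmetric])
    then have "(T_off ^^ n) (indicator (\<Union>i. A i)) 0 = (\<Sum>i. (T_off ^^ n) (indicator (A i)) 0)" for n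
      using A(1) by (simp only:) (rule T_off_iter_suminf, auto)
    then show "(\<Sum>i. \<Sum>n. (T_off ^^ n) (indicator (A i)) 0) = (\<Sum>n. (T_off ^^ n) (indicator (\<Union>i. A i)) 0)"
      by (subst suminf_swap_ennreal) simp
  qed
qed fact

lemma nn_integral_excursion_measure:
  assumes "\<phi> \<in> borel_measurable borel"
  shows "(\<integral>\<^sup>+ w. \<phi> w \<partial>excursion_measure) = (\<Sum>n. (T_off ^^ n) \<phi> 0)"
  using assms
proof (induction \<phi> rule: borel_measurable_induct)
  case (cong f g)
  then have "f = g" by auto
  with cong show ?case by simp
next
  case (set A)
  then show ?case by (simp add: emeasure_excursion_measure)
next
  case (mult u c)
  then have "(\<integral>\<^sup>+ w. c * u w \<partial>excursion_measure) = c * (\<Sum>n. (T_off ^^ n) u 0)"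
    by (subst nn_integral_cmult) auto
  with mult show ?case by (simp add: T_off_iter_cmult)
next
  case (add u v)
  then have "(\<integral>\<^sup>+ w. v w + u w \<partial>excursion_measure) = (\<Sum>n. (T_off ^^ n) v 0) + (\<Sum>n. (T_off ^^ n) u 0)"
    by (subst nn_integral_add) auto
  with add show ?case by (simp add: T_off_iter_add suminf_add)
next
  case (seq U)
  have "(\<integral>\<^sup>+ w. (SUP i. U i w) \<partial>excursion_measure) = (SUP i. \<Sum>n. (T_off ^^ n) (U i) 0)"
    using seq by (subst nn_integral_monotone_convergence_SUP) auto
  also have "\<dots> = (\<Sum>n. SUP i. (T_off ^^ n) (U i) 0)"
    using T_off_iter_SUP[OF seq(1,3)]
    by (intro ennreal_suminf_SUP_eq[symmetric]) (auto simp: incseq_def le_fun_def)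
  also have "\<dots> = (\<Sum>n. (T_off ^^ n) (\<lambda>v. SUP i. U i v) 0)"
    using T_off_iter_SUP[OF seq(1,3)] by simp
  finally show ?case
    by (simp add: SUP_apply image_comp seq)
qed

lemma excursion_measure_zero: "emeasure excursion_measure {0} = 1"
proof -
  have "(T_off ^^ n) (indicator {0}) 0 = (if n = 0 then 1 else 0)" for n
  proof (cases n)
    case (Suc m)
    have "T_off (indicator {0}) = (\<lambda>_. 0)"
      unfolding T_off_def T_def by (simp add: fun_eq_iff indicator_inter_arith[symmetric])
    moreover have "(T_off ^^ m) (\<lambda>_. 0) = (\<lambda>_. 0)"
      by (induction m) (auto simp: T_off_def)
    ultimately show ?thesis
      by (simp add: Suc funpow_swap1 del: funpow.simps) (simp add: funpow_Suc_right Suc del: funpow.simps)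
  qed simp
  then show ?thesis
    using sums_unique[OF sums_single[of 0 "\<lambda>_. 1 :: ennreal"]]
    by (simp add: emeasure_excursion_measure)
qed

text \<open>
  Applying one more step shifts the occupation of the excursion by one time unit: the starting point
  is lost and the endpoint is gained. Both are the origin, and the endpoint has full mass since the
  excursion ends almost surely.
\<close>

lemma excursion_measure_invariant:
  assumes rec: "\<And>v. v \<in> quadrant \<Longrightarrow> avoid_forever {0} v = 0"
    and [measurable]: "B \<in> sets borel"
  shows "emeasure excursion_measure B = (\<integral>\<^sup>+ w. T (indicator B) w \<partial>excursion_measure)"
proof -
  \<comment> \<open>decompose a step according to whether it ends at the origin\<close>
  have split: "T \<phi> = (\<lambda>v. T_off \<phi> v + \<phi> 0 * T (indicator {0}) v)"
    if [measurable]: "\<phi> \<in> borel_measurable borel" for \<phi>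
  proof -
    have "\<phi> = (\<lambda>v. indicator (- {0}) v * \<phi> v + \<phi> 0 * indicator {0} v)"
      by (auto simp: indicator_def)
    then have "T \<phi> = T (\<lambda>v. indicator (- {0}) v * \<phi> v + \<phi> 0 * indicator {0} v)"
      by simp
    also have "\<dots> = (\<lambda>v. T_off \<phi> v + \<phi> 0 * T (indicator {0}) v)"
      by (simp add: T_add T_cmult T_off_def)
    finally show ?thesis .
  qed
  define h where "h n = (T_off ^^ n) (T (indicator {0})) 0" for n
  have step: "(T_off ^^ n) (T \<phi>) 0 = (T_off ^^ Suc n) \<phi> 0 + \<phi> 0 * h n"
    if [measurable]: "\<phi> \<in> borel_measurable borel" for \<phi> n
    by (subst split) (simp_all add: T_off_iter_add T_off_iter_cmult h_def funpow_Suc_right del: funpow.simps)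
  have comm: "(T_off ^^ n) (T \<phi>) = T ((avoid {0} ^^ n) \<phi>)" for n \<phi>
    by (induction n arbitrary: \<phi>)
       (simp_all add: funpow_Suc_right T_off_def[of "T _"] avoid_def[abs_def] del: funpow.simps(2))
  \<comment> \<open>\<open>h k\<close> is the probability that the first return takes place at time \<open>k + 1\<close>\<close>
  have one: "(\<Sum>k<n. h k) + (T_off ^^ n) (\<lambda>_. 1) 0 = 1" for n
  proof (induction n)
    case (Suc n)
    have "(T_off ^^ n) (\<lambda>_. 1) 0 = (T_off ^^ Suc n) (\<lambda>_. 1) 0 + h n"
      using step[of "\<lambda>_. 1" n] by simp
    with Suc show ?case by (simp add: add_ac)
  qed simp
  have "(\<lambda>n. (T_off ^^ n) (\<lambda>_. 1) 0) \<longlonglongrightarrow> 0"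
  proof -
    have "(\<lambda>n. T ((avoid {0} ^^ n) (\<lambda>_. 1)) 0) \<longlonglongrightarrow> T (avoid_forever {0}) 0"
      by (rule T_avoid_forever_tendsto) simp
    moreover have "T (avoid_forever {0}) 0 \<le> T (\<lambda>_. 0) 0"
      by (intro T_mono) (simp add: rec)
    moreover have "T ((avoid {0} ^^ n) (\<lambda>_. 1)) 0 = (T_off ^^ n) (\<lambda>_. 1) 0" for n
      using comm[of n "\<lambda>_. 1"] by simp
    ultimately show ?thesis by simp
  qed
  moreover have "(\<lambda>n. \<Sum>k<n. h k) \<longlonglongrightarrow> (\<Sum>k. h k)"
    using summableI summable_LIMSEQ by blast
  ultimately have "(\<lambda>n. (\<Sum>k<n. h k) + (T_off ^^ n) (\<lambda>_. 1) 0) \<longlonglongrightarrow> (\<Sum>k. h k) + 0"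
    by (rule tendsto_add[rotated])
  then have h1: "(\<Sum>k. h k) = 1"
    unfolding one by (simp add: LIMSEQ_const_iff)
  have "(\<integral>\<^sup>+ w. T (indicator B) w \<partial>excursion_measure)
      = (\<Sum>n. (T_off ^^ Suc n) (indicator B) 0 + indicator B 0 * h n)"
    by (subst nn_integral_excursion_measure) (simp_all add: step)
  also have "\<dots> = (\<Sum>n. (T_off ^^ Suc n) (indicator B) 0) + indicator B 0 * (\<Sum>n. h n)"
    by (simp add: suminf_add[symmetric] ennreal_suminf_cmult)
  also have "\<dots> = (\<Sum>n. (T_off ^^ n) (indicator B) 0)"
    using suminf_offset[OF summableI, of "\<lambda>n. (T_off ^^ n) (indicator B) 0" 1]
    by (simp add: h1 add.commute)
  finally show ?thesis by (simp add: emeasure_excursion_measure)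
qed

text \<open>
  Every unreachable point has an open neighbourhood which is never visited, and countably many of these
  neighbourhoods cover the unreachable points.
\<close>

lemma excursion_measure_reachable: "emeasure excursion_measure (- reachable) = 0"
proof -
  let ?F = "{U. open U \<and> (\<forall>n. (T ^^ n) (indicator U) 0 = 0)}"
  have eq: "- reachable = \<Union>?F"
    unfolding reachable_def by blast
  obtain F' where F': "F' \<subseteq> ?F" "countable F'" "\<Union>F' = \<Union>?F"
    using Lindelof[of ?F] by blast
  have le: "(T_off ^^ n) \<phi> w \<le> (T ^^ n) \<phi> w" for n \<phi> w
  proof (induction n arbitrary: w)
    case (Suc n)
    show ?case
      by (simp add: T_off_def[of "(_ ^^ n) _"])
         (intro T_mono order.trans[OF _ Suc], auto simp: indicator_def)
  qed simp
  have "U \<in> null_sets excursion_measure" if "U \<in> F'" for U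
  proof -
    have U: "open U" "\<And>n. (T ^^ n) (indicator U) 0 = 0"
      using that F'(1) by auto
    then have "(T_off ^^ n) (indicator U) 0 = 0" for n
      using le[of n "indicator U" 0] by simp
    with U(1) show ?thesis
      by (simp add: null_sets_def emeasure_excursion_measure)
  qed
  then have "(\<Union>U\<in>F'. U) \<in> null_sets excursion_measure"
    by (intro null_sets_UN' F'(2))
  then show ?thesis
    by (simp add: eq F'(3)[symmetric] null_sets_def)
qed

end

section \<open>Two criteria for return probabilities\<close>

context lindley_chain
begin

text \<open>
  A one-dimensional Lindley process with centred increments has second moment at most \<open>n * s\<close> at time
  \<open>n\<close>, since the cut-off at \<open>0\<close> only decreases the square. So its mean is of order \<open>sqrt n\<close>. On the
  other hand the cut-off adds at least \<open>m\<close> to the mean in every step from the origin. If the return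
  probabilities were bounded below by \<open>e\<close>, the mean would be at least \<open>n * m * e\<close>.
\<close>

lemma return_probability_small:
  assumes int: "integrable \<mu> (\<lambda>y. y $ i)" "integrable \<mu> (\<lambda>y. (y $ i)\<^sup>2)"
    and mean: "(\<integral>y. y $ i \<partial>\<mu>) = 0"
    and m: "m > 0" "ennreal m \<le> (\<integral>\<^sup>+ y. ennreal (max 0 (- y $ i)) \<partial>\<mu>)"
    and e: "e > 0"
  shows "\<exists>n. (T ^^ n) (indicator {0}) 0 \<le> ennreal e"
proof (rule ccontr)
  assume "\<not> ?thesis"
  then have large: "ennreal e \<le> (T ^^ n) (indicator {0}) 0" for n
    by (meson linorder_not_le less_imp_le)
  define s where "s = (\<integral>y. (y $ i)\<^sup>2 \<partial>\<mu>)"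
  have s: "s \<ge> 0" unfolding s_def by simp
  let ?a = "\<lambda>w :: real^2. ennreal (w $ i)" and ?b = "\<lambda>w :: real^2. ennreal ((w $ i)\<^sup>2)"
  have a: "?a w + ennreal m * indicator {0} w \<le> T ?a w" if "w \<in> quadrant" for w
  proof (cases "w = 0")
    case True
    then show ?thesis using m by (simp add: T_def)
  next
    case False
    have "ennreal (w $ i) = ennreal (\<integral>y. w $ i - y $ i \<partial>\<mu>)"
      using int mean by (simp add: M.prob_space[simplified])
    also have "\<dots> \<le> ennreal (\<integral>y. max 0 (w $ i - y $ i) \<partial>\<mu>)"
      using int by (intro ennreal_leI integral_mono) auto
    also have "\<dots> = T ?a w"
      unfolding T_def lindley_step_nth using int by (intro nn_integral_eq_integral[symmetric]) auto
    finally show ?thesis using False by simp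
  qed
  have b: "T ?b w \<le> ?b w + ennreal s" for w
  proof -
    have "T ?b w \<le> (\<integral>\<^sup>+ y. ennreal ((w $ i - y $ i)\<^sup>2) \<partial>\<mu>)"
      unfolding T_def lindley_step_nth by (intro nn_integral_mono ennreal_leI) (auto simp: max_def)
    also have "\<dots> = ennreal (\<integral>y. (w $ i - y $ i)\<^sup>2 \<partial>\<mu>)"
    proof (rule nn_integral_eq_integral)
      show "integrable \<mu> (\<lambda>y. (w $ i - y $ i)\<^sup>2)"
        using int by (simp add: power2_diff)
    qed simp
    also have "(\<integral>y. (w $ i - y $ i)\<^sup>2 \<partial>\<mu>) = (w $ i)\<^sup>2 + s"
      using int mean by (simp add: power2_diff s_def M.prob_space[simplified])
    also have "ennreal \<dots> = ?b w + ennreal s"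
      using s by (simp add: ennreal_plus)
    finally show ?thesis .
  qed
  have lower: "ennreal (real n * (m * e)) \<le> (T ^^ n) ?a 0" for n
  proof (induction n)
    case (Suc n)
    have "ennreal (real (Suc n) * (m * e)) = ennreal (real n * (m * e)) + ennreal m * ennreal e"
      using m e by (simp add: ennreal_mult[symmetric] ennreal_plus[symmetric] algebra_simps del: ennreal_plus)
    also have "\<dots> \<le> (T ^^ n) ?a 0 + ennreal m * (T ^^ n) (indicator {0}) 0"
      by (intro add_mono mult_left_mono Suc large) auto
    also have "\<dots> = (T ^^ n) (\<lambda>w. ?a w + ennreal m * indicator {0} w) 0"
      by (simp add: T_iter_add T_iter_cmult)
    also have "\<dots> \<le> (T ^^ n) (T ?a) 0"
      by (intro T_iter_mono a) auto
    finally show ?case by (simp add: funpow_swap1)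
  qed simp
  have upper: "(T ^^ n) ?b 0 \<le> ennreal (real n * s)" for n
  proof (induction n)
    case (Suc n)
    have "(T ^^ Suc n) ?b 0 \<le> (T ^^ n) (\<lambda>w. ?b w + ennreal s) 0"
      by (simp add: funpow_Suc_right del: funpow.simps) (intro T_iter_mono b, simp)
    also have "\<dots> = (T ^^ n) ?b 0 + ennreal s"
      by (simp add: T_iter_add)
    also have "\<dots> \<le> ennreal (real n * s) + ennreal s"
      by (intro add_right_mono Suc)
    also have "\<dots> = ennreal (real (Suc n) * s)"
      using s by (simp add: ennreal_plus[symmetric] algebra_simps del: ennreal_plus)
    finally show ?case .
  qed simp
  \<comment> \<open>balances the two terms of the bound \<open>x \<le> x\<^sup>2 / k + k\<close> for the mean\<close>
  define k where "k = 2 * s / (m * e) + 1"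
  have me: "m * e > 0" using m e by simp
  have "0 \<le> 2 * s / (m * e)" using s me by simp
  then have k0: "k > 0" by (simp add: k_def)
  have "2 * s / (m * e) \<le> k" by (simp add: k_def)
  then have "2 * s \<le> k * (m * e)" using me by (simp add: pos_divide_le_eq)
  with k0 have k: "k > 0" "s / k \<le> m * e / 2"
    by (simp_all add: pos_divide_le_eq mult.commute)
  have "real n * (m * e) \<le> real n * s / k + k" for n
  proof -
    have "ennreal (real n * (m * e)) \<le> (T ^^ n) ?a 0" by (rule lower)
    also have "\<dots> \<le> (T ^^ n) (\<lambda>w. ennreal (1 / k) * ?b w + ennreal k) 0"
    proof (rule T_iter_mono)
      fix v :: "real^2" assume "v \<in> quadrant"
      have "0 \<le> (v $ i / 2 - k)\<^sup>2 + 3 / 4 * (v $ i)\<^sup>2" by simp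
      then have "v $ i * k \<le> (v $ i)\<^sup>2 + k\<^sup>2"
        by (simp add: power2_eq_square algebra_simps)
      then have "v $ i \<le> 1 / k * (v $ i)\<^sup>2 + k"
        using k(1) by (simp add: field_simps power2_eq_square)
      then have "?a v \<le> ennreal (1 / k * (v $ i)\<^sup>2 + k)"
        by (rule ennreal_leI)
      then show "?a v \<le> ennreal (1 / k) * ?b v + ennreal k"
        using k(1) by (simp add: ennreal_mult[symmetric])
    qed simp
    also have "\<dots> = ennreal (1 / k) * (T ^^ n) ?b 0 + ennreal k"
      by (simp add: T_iter_add T_iter_cmult)
    also have "\<dots> \<le> ennreal (1 / k) * ennreal (real n * s) + ennreal k"
      by (intro add_right_mono mult_left_mono upper) auto
    also have "\<dots> = ennreal (real n * s / k + k)"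
      using k s by (simp add: ennreal_mult[symmetric] ennreal_plus[symmetric] del: ennreal_plus)
    finally show ?thesis
      using k s by (simp add: ennreal_le_iff del: ennreal_plus)
  qed
  moreover have "real n * s / k \<le> real n * (m * e / 2)" for n
    using mult_left_mono[OF k(2), of "real n"] by simp
  ultimately have *: "real n * (m * e) \<le> real n * (m * e / 2) + k" for n
    by (meson add_right_mono order.trans)
  obtain n :: nat where "2 * k / (m * e) < real n"
    using reals_Archimedean2 by blast
  then have "2 * k < real n * (m * e)"
    using m e by (simp add: field_simps)
  with *[of n] show False by simp
qed

text \<open>
  Let \<open>G N w\<close> be the expected number of visits to \<open>0\<close> before time \<open>N\<close>. The function \<open>f / b\<close> dominates
  the probability of ever entering \<open>B\<close>, and no starting point beats the origin, so
  \<open>G N w \<le> f w / b * G N 0\<close>. From the set where \<open>f \<le> b / 2\<close>, which is reached with positive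
  probability \<open>p\<close> at time \<open>m\<close>, at most half of the visits remain. Hence \<open>G N 0\<close> is at most
  \<open>2 * m / p\<close>.
\<close>

lemma summable_returns_Foster:
  fixes f :: "real^2 \<Rightarrow> real"
  assumes [measurable]: "f \<in> borel_measurable borel" "B \<in> sets borel" and f0: "\<And>v. 0 \<le> f v"
    and b: "b > 0" "\<And>v. v \<in> B \<Longrightarrow> b \<le> f v" and zero: "0 \<in> B"
    and f: "\<And>v. v \<in> quadrant \<Longrightarrow> v \<notin> B \<Longrightarrow> T (\<lambda>v. ennreal (f v)) v \<le> ennreal (f v)"
    and far: "(T ^^ m) (indicator {v. f v \<le> b / 2}) 0 \<noteq> 0"
  shows "(\<Sum>n. (T ^^ n) (indicator {0}) 0) < \<infinity>"
proof -
  define G where "G N w = (\<Sum>n<N. (T ^^ n) (indicator {0}) w)" for N w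
  have G_meas [measurable]: "G N \<in> borel_measurable borel" for N
    unfolding G_def[abs_def] by measurable
  have G_Suc: "G (Suc N) w = indicator {0} w + T (G N) w" for N w
  proof -
    have "T (G N) w = (\<Sum>n<N. (T ^^ Suc n) (indicator {0}) w)" for N
      unfolding G_def[abs_def]
    proof (induction N)
      case (Suc N)
      have "T (\<lambda>w. (\<Sum>n<N. (T ^^ n) (indicator {0}) w) + (T ^^ N) (indicator {0}) w)
          = (\<lambda>w. T (\<lambda>w. \<Sum>n<N. (T ^^ n) (indicator {0}) w) w + T ((T ^^ N) (indicator {0})) w)"
        by (rule T_add) measurable
      with Suc show ?case by simp
    qed (simp add: T_def)
    then show ?thesis
      unfolding G_def by (subst sum.lessThan_Suc_shift) simp
  qed
  have G0: "G N w \<le> G N 0" if "w \<in> quadrant" for N w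
    unfolding G_def by (intro sum_mono return_probability_le_origin that)
  have G_mono: "G N w \<le> G (Suc N) w" for N w
    unfolding G_def by simp
  have fin: "G N w \<le> of_nat N" for N w
  proof -
    have "G N w \<le> (\<Sum>n<N. 1)"
      unfolding G_def using path_law[of "{0}" w, symmetric] P.emeasure_le_1 by (intro sum_mono) simp
    then show ?thesis by simp
  qed
  have escape: "G N w \<le> ennreal (f w / b) * G N 0" if "w \<in> quadrant" for N w
    using that
  proof (induction N arbitrary: w)
    case (Suc N)
    show ?case
    proof (cases "w \<in> B")
      case True
      then have "1 \<le> ennreal (f w / b)"
        using b(1) b(2)[OF True] by (simp flip: ennreal_1)
      then have "1 * G (Suc N) 0 \<le> ennreal (f w / b) * G (Suc N) 0"
        by (rule mult_right_mono) simp
      with G0[OF Suc.prems, of "Suc N"] show ?thesis by simp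
    next
      case False
      then have "w \<noteq> 0" using zero by auto
      then have "G (Suc N) w = T (G N) w"
        by (simp add: G_Suc)
      also have "\<dots> \<le> T (\<lambda>v. (ennreal (1 / b) * G N 0) * ennreal (f v)) w"
      proof (rule T_mono)
        fix v :: "real^2" assume "v \<in> quadrant"
        then have "G N v \<le> ennreal (f v / b) * G N 0" by (rule Suc.IH)
        also have "ennreal (f v / b) = ennreal (1 / b) * ennreal (f v)"
          using b f0[of v] by (simp add: ennreal_mult[symmetric])
        finally show "G N v \<le> (ennreal (1 / b) * G N 0) * ennreal (f v)"
          by (simp add: mult_ac)
      qed
      also have "\<dots> = (ennreal (1 / b) * G N 0) * T (\<lambda>v. ennreal (f v)) w"
        by (subst T_cmult) auto
      also have "\<dots> \<le> (ennreal (1 / b) * G N 0) * ennreal (f w)"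
        using f[OF Suc.prems False] by (rule mult_left_mono) simp
      also have "\<dots> = (ennreal (1 / b) * ennreal (f w)) * G N 0"
        by (simp only: mult_ac)
      also have "ennreal (1 / b) * ennreal (f w) = ennreal (f w / b)"
        using b f0[of w] by (simp add: ennreal_mult[symmetric])
      also have "ennreal (f w / b) * G N 0 \<le> ennreal (f w / b) * G (Suc N) 0"
        by (intro mult_left_mono G_mono) simp
      finally show ?thesis .
    qed
  qed (simp add: G_def)
  let ?F = "indicator {v. f v \<le> b / 2} :: real^2 \<Rightarrow> ennreal"
  define p where "p = (T ^^ m) ?F 0"
  have bound: "ennreal (1 / 2) * p * G N 0 \<le> of_nat m" for N
  proof -
    have "G N v + (ennreal (1 / 2) * G N 0) * ?F v \<le> G N 0" if v: "v \<in> quadrant" for v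
    proof (cases "f v \<le> b / 2")
      case True
      have "ennreal (f v / b) \<le> ennreal (1 / 2)"
        using True b by (intro ennreal_leI) (simp add: field_simps)
      then have "G N v \<le> ennreal (1 / 2) * G N 0"
        using escape[OF v, of N] by (meson mult_right_mono order.trans zero_le)
      then have "G N v + ennreal (1 / 2) * G N 0 \<le> ennreal (1 / 2) * G N 0 + ennreal (1 / 2) * G N 0"
        by (rule add_right_mono)
      also have "\<dots> = (ennreal (1 / 2) + ennreal (1 / 2)) * G N 0"
        by (simp only: distrib_right)
      also have "ennreal (1 / 2) + ennreal (1 / 2) = 1"
        by (subst ennreal_plus[symmetric]) auto
      finally show ?thesis using True by simp
    next
      case False
      then show ?thesis using G0[OF v, of N] by simp
    qed
    then have "(T ^^ m) (\<lambda>v. G N v + (ennreal (1 / 2) * G N 0) * ?F v) 0 \<le> (T ^^ m) (\<lambda>_. G N 0) 0"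
      by (intro T_iter_mono) auto
    then have 1: "(T ^^ m) (G N) 0 + (ennreal (1 / 2) * G N 0) * p \<le> G N 0"
      by (simp add: T_iter_add T_iter_cmult p_def)
    have 2: "G N 0 \<le> of_nat m + (T ^^ m) (G N) 0"
    proof (induction m)
      case (Suc m)
      have le: "G N v \<le> indicator {0} v + T (G N) v" for v
        using G_mono[of N v] by (simp add: G_Suc)
      have "(T ^^ m) (G N) 0 \<le> (T ^^ m) (\<lambda>v. 1 + T (G N) v) 0"
        by (intro T_iter_mono order.trans[OF le] add_right_mono) (auto simp: indicator_def)
      also have "\<dots> = 1 + (T ^^ Suc m) (G N) 0"
        by (subst T_iter_add) (simp_all add: funpow_Suc_right del: funpow.simps)
      finally have "of_nat m + (T ^^ m) (G N) 0 \<le> of_nat m + (1 + (T ^^ Suc m) (G N) 0)"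
        by (rule add_left_mono)
      from order.trans[OF Suc this] show ?case by (simp add: add_ac)
    qed simp
    have "G N 0 + (ennreal (1 / 2) * G N 0) * p \<le> of_nat m + (T ^^ m) (G N) 0 + (ennreal (1 / 2) * G N 0) * p"
      by (intro add_right_mono 2)
    also have "\<dots> \<le> of_nat m + G N 0"
      using 1 by (simp add: add.assoc add_left_mono)
    finally have "G N 0 + (ennreal (1 / 2) * G N 0) * p \<le> G N 0 + of_nat m"
      by (simp add: add.commute)
    moreover have "G N 0 \<noteq> \<top>"
      using fin[of N 0] by (auto simp: top_unique)
    ultimately show ?thesis
      by (simp add: ennreal_add_left_cancel_le ac_simps)
  qed
  have "ennreal (1 / 2) * p * (SUP N. G N 0) \<le> of_nat m"
    by (subst SUP_mult_left_ennreal) (intro SUP_least bound)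
  moreover have "ennreal (1 / 2) * p \<noteq> 0"
    using far by (simp add: p_def)
  ultimately have "(SUP N. G N 0) \<noteq> \<top>"
    by (metis ennreal_mult_top ennreal_of_nat_neq_top top_unique)
  moreover have "(\<Sum>n. (T ^^ n) (indicator {0}) 0) = (SUP N. G N 0)"
    by (simp only: G_def suminf_eq_SUP)
  ultimately show ?thesis
    by (simp only: infinity_ennreal_def less_top)
qed

lemma reach_far:
  assumes "emeasure \<mu> {y. y $ i < 0} \<noteq> 0"
  shows "\<exists>m. (T ^^ m) (indicator {v. R \<le> v $ i}) 0 \<noteq> 0"
proof -
  have m: "(\<lambda>y :: real^2. - y $ i) \<in> borel_measurable borel"
    by measurable
  obtain \<epsilon> c where \<epsilon>: "\<epsilon> > 0" and c: "c > 0" "ennreal c \<le> emeasure \<mu> {y. \<epsilon> \<le> - y $ i}"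
    using positive_threshold[OF m] assms by (auto simp: neg_0_less_iff_less)
  have reach: "ennreal (c ^ m) \<le> (T ^^ m) (indicator {v. R \<le> v $ i}) v"
    if "v \<in> quadrant" "R \<le> v $ i + real m * \<epsilon>" for m v
    using that
  proof (induction m arbitrary: v)
    case (Suc m)
    have "ennreal (c ^ m) * ennreal c \<le> T ((T ^^ m) (indicator {v. R \<le> v $ i})) v"
    proof (rule T_indicator_lower_bound[OF _ c(2)])
      fix y :: "real^2" assume y: "y \<in> {y. \<epsilon> \<le> - y $ i}"
      show "ennreal (c ^ m) \<le> (T ^^ m) (indicator {v. R \<le> v $ i}) (lindley_step v y)"
        using y Suc.prems(2) by (intro Suc.IH) (auto simp: algebra_simps max_def)
    qed simp
    then show ?case
      using c(1) by (simp add: ennreal_mult[symmetric] mult.commute)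
  qed auto
  obtain m where m: "R / \<epsilon> \<le> real m"
    using real_arch_simple by blast
  have "ennreal (c ^ m) \<le> (T ^^ m) (indicator {v. R \<le> v $ i}) 0"
    using m \<epsilon> by (intro reach) (auto simp: field_simps)
  moreover have "ennreal (c ^ m) \<noteq> 0" using c(1) by simp
  ultimately show ?thesis by (intro exI[of _ m]) (auto simp del: ennreal_eq_0_iff)
qed

end

section \<open>From the chain to the process\<close>

locale lindley_process = prob_space M for M :: "'a measure" +
  fixes X :: "'a \<Rightarrow> real^2" and Xs :: "nat \<Rightarrow> 'a \<Rightarrow> real^2"
  assumes X_measurable [measurable]: "X \<in> borel_measurable M"
    and iid: "iid_copies M X Xs"
    and up: "prob {\<omega> \<in> space M. \<forall>i. X \<omega> $ i > 0} > 0"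
begin

abbreviation law :: "(real^2) measure" where
  "law \<equiv> distr M borel X"

sublocale chain: lindley_chain law
proof -
  have "emeasure law {y. \<forall>i. 0 < y $ i} = ennreal (prob {\<omega> \<in> space M. \<forall>i. X \<omega> $ i > 0})"
    by (subst emeasure_distr) (auto simp: emeasure_eq_measure vimage_def Int_def conj_commute)
  then have pos: "emeasure law {y. \<forall>i. 0 < y $ i} > 0"
    using up by simp
  interpret L: prob_space law by (rule prob_space_distr) simp
  interpret product_prob_space "\<lambda>_. law" "UNIV :: nat set"
    by unfold_locales
  show "lindley_chain law"
    using pos by unfold_locales auto
qed

lemma distr_sequence: "distr M (\<Pi>\<^sub>M i\<in>UNIV. borel) (\<lambda>\<omega> n. Xs (Suc n) \<omega>) = chain.S"
proof -
  have iv: "indep_vars (\<lambda>_. borel) Xs {1..}" and d: "\<And>n. n \<ge> 1 \<Longrightarrow> distr M borel (Xs n) = law"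
    using iid by (auto simp: iid_copies_def)
  let ?R = "\<lambda>\<omega>. \<lambda>i\<in>{1..}. Xs i \<omega>" and ?shift = "\<lambda>\<omega>. \<lambda>n\<in>UNIV. \<omega> (Suc n) :: real^2"
  have rv: "random_variable borel (Xs i)" if "i \<in> {1..}" for i
    using iv that by (auto simp: indep_vars_def)
  have sets: "sets (\<Pi>\<^sub>M i\<in>I. law) = sets (\<Pi>\<^sub>M i\<in>I. (borel :: (real^2) measure))" for I :: "nat set"
    by (rule sets_PiM_cong) auto
  have R: "?R \<in> measurable M (\<Pi>\<^sub>M i\<in>{1..}. borel)"
    using rv by (intro measurable_restrict) auto
  have shift: "?shift \<in> measurable (\<Pi>\<^sub>M i\<in>{1..}. borel) (\<Pi>\<^sub>M i\<in>UNIV. borel)"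
    by (intro measurable_restrict measurable_component_singleton) auto
  have "distr M (\<Pi>\<^sub>M i\<in>{1..}. borel) ?R = (\<Pi>\<^sub>M i\<in>{1..}. distr M borel (Xs i))"
    using iv by (subst (asm) indep_vars_iff_distr_eq_PiM') (auto intro: rv)
  also have "\<dots> = (\<Pi>\<^sub>M i\<in>{1..}. law)"
    by (rule PiM_cong) (auto simp: d)
  finally have 1: "distr M (\<Pi>\<^sub>M i\<in>{1..}. borel) ?R = (\<Pi>\<^sub>M i\<in>{1..}. law)" .
  have "distr M (\<Pi>\<^sub>M i\<in>UNIV. borel) (\<lambda>\<omega> n. Xs (Suc n) \<omega>)
      = distr M (\<Pi>\<^sub>M i\<in>UNIV. borel) (?shift \<circ> ?R)"
    by (intro distr_cong) auto
  also have "\<dots> = distr (distr M (\<Pi>\<^sub>M i\<in>{1..}. borel) ?R) (\<Pi>\<^sub>M i\<in>UNIV. borel) ?shift"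
    by (rule distr_distr[OF shift R, symmetric])
  also have "\<dots> = distr (\<Pi>\<^sub>M i\<in>{1..}. law) (\<Pi>\<^sub>M i\<in>UNIV. law) ?shift"
    unfolding 1 by (rule distr_cong) (simp_all add: sets)
  also have "\<dots> = chain.S"
    by (rule distr_PiM_reindex) (auto intro: prob_space_distr)
  finally show ?thesis .
qed

lemma Xs_measurable [measurable]: "(\<lambda>\<omega> n. Xs (Suc n) \<omega>) \<in> measurable M (\<Pi>\<^sub>M i\<in>UNIV. borel)"
proof (rule measurable_PiM_single')
  show "Xs (Suc n) \<in> borel_measurable M" for n
    using iid by (auto simp: iid_copies_def indep_vars_def)
qed (auto simp: space_PiM)

lemma lindley_eq_path: "lindley Xs x n \<omega> = chain.path x (\<lambda>n. Xs (Suc n) \<omega>) n"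
  by (induction n) (simp_all add: chain.path_Suc)

lemma AE_sequence:
  assumes "AE \<omega> in chain.S. Q \<omega>"
  shows "AE \<omega> in M. Q (\<lambda>n. Xs (Suc n) \<omega>)"
proof (rule AE_distrD[OF Xs_measurable])
  show "AE \<omega> in distr M (\<Pi>\<^sub>M i\<in>UNIV. borel) (\<lambda>\<omega> n. Xs (Suc n) \<omega>). Q \<omega>"
    unfolding distr_sequence by (rule assms)
qed

lemma step_probability:
  assumes [measurable]: "B \<in> sets borel"
  shows "emeasure M {\<omega> \<in> space M. lindley_step w (X \<omega>) \<in> B} = chain.T (indicator B) w"
proof -
  have "chain.T (indicator B) w = (\<integral>\<^sup>+ \<omega>. indicator B (lindley_step w (X \<omega>)) \<partial>M)"
    unfolding chain.T_def by (subst nn_integral_distr) auto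
  also have "\<dots> = (\<integral>\<^sup>+ \<omega>. indicator {\<omega> \<in> space M. lindley_step w (X \<omega>) \<in> B} \<omega> \<partial>M)"
    by (intro nn_integral_cong) (auto simp: indicator_def)
  finally show ?thesis by simp
qed

text \<open>
  A visit to a ball is followed, with probability bounded below, by a visit to the origin a fixed number
  of steps later. So the expected number of visits to any ball is finite, and the Borel--Cantelli lemma
  applies.
\<close>

lemma transient_of_summable_returns:
  assumes sum: "(\<Sum>n. (chain.T ^^ n) (indicator {0}) 0) < \<infinity>"
  shows "transient M Xs"
  unfolding transient_def
proof
  fix x :: "real^2" assume x: "x \<in> quadrant"
  have "(\<Sum>n. (chain.T ^^ n) (indicator (cball 0 R)) x) < \<infinity>" for R
  proof -
    obtain N c where c: "c > 0"
        "\<And>v. v \<in> quadrant \<Longrightarrow> norm v \<le> R \<Longrightarrow> ennreal c \<le> (chain.T ^^ N) (indicator {0}) v"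
      using chain.reach_zero[of R] by blast
    have le: "ennreal c * (chain.T ^^ n) (indicator (cball 0 R)) x \<le> (chain.T ^^ (n + N)) (indicator {0}) 0" for n
    proof -
      have "ennreal c * (chain.T ^^ n) (indicator (cball 0 R)) x
          = (chain.T ^^ n) (\<lambda>v. ennreal c * indicator (cball 0 R) v) x"
        by (subst chain.T_iter_cmult) (intro borel_measurable_indicator borel_closed closed_cball, rule refl)
      also have "\<dots> \<le> (chain.T ^^ n) ((chain.T ^^ N) (indicator {0})) x"
        by (rule chain.T_iter_mono[OF _ x]) (auto simp: indicator_def c)
      also have "\<dots> \<le> (chain.T ^^ (n + N)) (indicator {0}) 0"
        using chain.return_probability_le_origin[OF x, of "n + N"] by (simp add: funpow_add)
      finally show ?thesis .
    qed
    have "ennreal c * (\<Sum>n. (chain.T ^^ n) (indicator (cball 0 R)) x)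
        \<le> (\<Sum>n. (chain.T ^^ (n + N)) (indicator {0}) 0)"
      unfolding ennreal_suminf_cmult[symmetric] by (intro suminf_le le) auto
    also have "\<dots> \<le> (\<Sum>n. (chain.T ^^ n) (indicator {0}) 0)"
      using suminf_offset[OF summableI, of "\<lambda>n. (chain.T ^^ n) (indicator {0}) 0" N] by simp
    also have "\<dots> < \<infinity>" by (rule sum)
    finally show ?thesis
      using c(1) by (auto simp: ennreal_mult_less_top less_top)
  qed
  from AE_sequence[OF chain.AE_path_norm_at_top[OF this]]
  show "AE \<omega> in M. filterlim (\<lambda>n. norm (lindley Xs x n \<omega>)) at_top sequentially"
    by (simp add: lindley_eq_path)
qed

lemma
  assumes rec: "\<And>v. v \<in> quadrant \<Longrightarrow> chain.avoid_forever {0} v = 0"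
  shows recurrent_on_reachable: "recurrent_on M Xs chain.reachable"
    and recurrent_of_return: "recurrent M Xs"
    and excursion_measure_on_limit_set: "invariant_on_limit_set M X Xs chain.excursion_measure"
proof -
  let ?\<nu> = "chain.excursion_measure"
  show on: "recurrent_on M Xs chain.reachable"
    unfolding recurrent_on_def
  proof (intro conjI allI impI ballI)
    fix U :: "(real^2) set" and x :: "real^2"
    assume "open U" "U \<inter> chain.reachable \<noteq> {}" and x: "x \<in> quadrant"
    then have "AE \<omega> in chain.S. \<exists>\<^sub>\<infinity>n. chain.path x \<omega> n \<in> U"
      by (intro chain.AE_path_infinitely_often chain.avoid_forever_reachable[OF rec]) auto
    from AE_sequence[OF this] show "AE \<omega> in M. \<exists>\<^sub>\<infinity>n. lindley Xs x n \<omega> \<in> U"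
      by (simp add: lindley_eq_path)
  qed (use chain.closed_reachable chain.zero_reachable chain.reachable_subset_quadrant in auto)
  then show recurrent: "recurrent M Xs"
    by (auto simp: recurrent_def)
  have sub: "chain.reachable \<subseteq> limit_set M Xs"
    using on by (auto simp: limit_set_def)
  have limit: "closed (limit_set M Xs)" "limit_set M Xs \<subseteq> quadrant"
    using recurrent_on_limit_set[OF recurrent] by (auto simp: recurrent_on_def)
  have null: "emeasure ?\<nu> (- L) = 0" if "closed L" "chain.reachable \<subseteq> L" for L
  proof -
    have "emeasure ?\<nu> (- L) \<le> emeasure ?\<nu> (- chain.reachable)"
      using that chain.closed_reachable by (intro emeasure_mono) auto
    then show ?thesis by (simp add: chain.excursion_measure_reachable)
  qed
  have inv: "emeasure ?\<nu> B = (\<integral>\<^sup>+ w. chain.T (indicator B) w \<partial>?\<nu>)" if "B \<in> sets borel" for B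
    by (rule chain.excursion_measure_invariant[OF rec that])
  have quad: "emeasure ?\<nu> (- quadrant) = 0"
    by (rule null[OF closed_quadrant chain.reachable_subset_quadrant])
  have "emeasure ?\<nu> {0} \<le> emeasure ?\<nu> UNIV"
    by (rule emeasure_mono) auto
  then have "emeasure ?\<nu> UNIV \<noteq> 0"
    by (auto simp: chain.excursion_measure_zero)
  moreover have "emeasure ?\<nu> K < \<infinity>" if "compact K" for K
    by (rule chain.invariant_finite_on_compact[OF _ inv quad _ that])
       (auto simp: chain.excursion_measure_zero)
  ultimately show "invariant_on_limit_set M X Xs ?\<nu>"
    unfolding invariant_on_limit_set_def invariant_radon_measure_def
    using null[OF limit(1) sub] quad inv by (auto simp: step_probability)
qed

text \<open>
  The excursion measure provides existence; every invariant measure has infinite mass by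
  \<open>invariant_infinite\<close>.
\<close>

lemma null_recurrent_of_return:
  assumes rec: "\<And>v. v \<in> quadrant \<Longrightarrow> chain.avoid_forever {0} v = 0"
    and small: "\<And>e. e > 0 \<Longrightarrow> \<exists>n. (chain.T ^^ n) (indicator {0}) 0 \<le> ennreal e"
  shows "null_recurrent M X Xs"
  unfolding null_recurrent_def
proof (intro conjI allI impI)
  fix \<nu> assume "invariant_on_limit_set M X Xs \<nu>"
  then show "emeasure \<nu> UNIV = \<infinity>"
    unfolding invariant_on_limit_set_def invariant_radon_measure_def
    by (intro chain.invariant_infinite small) (auto simp: step_probability)
qed (use recurrent_of_return[OF rec] excursion_measure_on_limit_set[OF rec] in blast)+

text \<open>
  A uniform lower bound for the chance of being at the origin at some time already forces the origin to
  be hit almost surely.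
\<close>

lemma positive_recurrent_of_return:
  assumes p: "p > 0"
    and return: "\<And>w. w \<in> quadrant \<Longrightarrow> eventually (\<lambda>n. ennreal p \<le> (chain.T ^^ n) (indicator {0}) w) sequentially"
  shows "positive_recurrent M X Xs"
  unfolding positive_recurrent_def
proof (intro conjI allI impI)
  have rec: "chain.avoid_forever {0} v = 0" if "v \<in> quadrant" for v
  proof (rule chain.avoid_forever_eq_0_of_bound[OF _ _ _ that])
    show "ennreal (1 - p) < 1"
      using p by (simp add: ennreal_less_one_iff)
    fix v :: "real^2" assume "v \<in> quadrant"
    then obtain n where "ennreal p \<le> (chain.T ^^ n) (indicator {0}) v"
      using eventually_happens'[OF _ return] by auto
    then show "chain.avoid_forever {0} v \<le> ennreal (1 - p)"
      using p by (intro chain.avoid_forever_le_of_reach) auto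
  qed simp
  show "recurrent M Xs" "\<exists>\<nu>. invariant_on_limit_set M X Xs \<nu>"
    using recurrent_of_return[OF rec] excursion_measure_on_limit_set[OF rec] by blast+
  fix \<nu> assume "invariant_on_limit_set M X Xs \<nu>"
  then have \<nu>: "sets \<nu> = sets borel" "emeasure \<nu> (- quadrant) = 0" "emeasure \<nu> {0} < \<infinity>"
      "\<And>B. B \<in> sets borel \<Longrightarrow> emeasure \<nu> B = (\<integral>\<^sup>+ w. chain.T (indicator B) w \<partial>\<nu>)"
    unfolding invariant_on_limit_set_def invariant_radon_measure_def
    by (blast, blast, blast intro: compact_sing, simp add: step_probability)
  show "emeasure \<nu> UNIV < \<infinity>"
    by (rule chain.invariant_finite[OF \<nu>(1,4,2,3) p return])
qed

end

section \<open>Taylor bounds for large increments\<close>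

lemma ln_one_plus_upper:
  assumes "v > - 1"
  shows "ln (1 + v) \<le> v - v\<^sup>2 / 2 + v ^ 3 / (3 :: real)"
proof -
  let ?h = "\<lambda>v :: real. v - v\<^sup>2 / 2 + v ^ 3 / 3 - ln (1 + v)"
  have d: "(?h has_real_derivative x ^ 3 / (1 + x)) (at x)" if "x > - 1" for x
  proof -
    have "1 - x + x\<^sup>2 - 1 / (1 + x) = x ^ 3 / (1 + x)"
      using that by (simp add: field_simps power2_eq_square power3_eq_cube)
    then show ?thesis
      using that by (auto intro!: derivative_eq_intros simp: divide_simps) (simp add: algebra_simps power2_eq_square power3_eq_cube)
  qed
  have "?h 0 \<le> ?h v"
  proof (cases "v \<ge> 0")
    case True
    show ?thesis
    proof (rule DERIV_nonneg_imp_nondecreasing[OF True])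
      fix x :: real assume "0 \<le> x" "x \<le> v"
      then show "\<exists>y. (?h has_real_derivative y) (at x) \<and> 0 \<le> y"
        by (intro exI[of _ "x ^ 3 / (1 + x)"] conjI d) auto
    qed
  next
    case False
    then have "v \<le> 0" by simp
    then show ?thesis
    proof (rule DERIV_nonpos_imp_nonincreasing)
      fix x :: real assume "v \<le> x" "x \<le> 0"
      then show "\<exists>y. (?h has_real_derivative y) (at x) \<and> y \<le> 0"
        using assms by (intro exI[of _ "x ^ 3 / (1 + x)"] conjI d) (auto intro!: divide_nonpos_nonneg simp: power_le_zero_eq)
    qed
  qed
  then show ?thesis by simp
qed

text \<open>
  Taylor's formula of order three around \<open>1\<close>. The constant comes from
  \<open>\<eta> * (\<eta> + 1) * (\<eta> + 2) / 6 \<le> 1\<close> and \<open>t powr (- \<eta> - 3) \<le> 16\<close> for \<open>1 / 2 \<le> t\<close>.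
\<close>

lemma powr_neg_Taylor:
  fixes v \<eta> :: real
  assumes v: "\<bar>v\<bar> \<le> 1 / 2" and \<eta>: "0 < \<eta>" "\<eta> \<le> 1"
  shows "\<bar>(1 + v) powr (- \<eta>) - (1 - \<eta> * v + \<eta> * (\<eta> + 1) / 2 * v\<^sup>2)\<bar> \<le> 16 * \<bar>v\<bar> ^ 3"
proof (cases "v = 0")
  case False
  define diff where "diff m s = (if m = 0 then s powr (- \<eta>) else if m = 1 then - \<eta> * s powr (- \<eta> - 1)
     else if m = 2 then \<eta> * (\<eta> + 1) * s powr (- \<eta> - 2) else - \<eta> * (\<eta> + 1) * (\<eta> + 2) * s powr (- \<eta> - 3))"
    for m :: nat and s :: real
  have "\<exists>t. (if 1 + v < 1 then 1 + v < t \<and> t < 1 else 1 < t \<and> t < 1 + v) \<and>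
      (1 + v) powr (- \<eta>) = (\<Sum>m<3. diff m 1 / fact m * (1 + v - 1) ^ m) + diff 3 t / fact 3 * (1 + v - 1) ^ 3"
  proof (rule Taylor[of 3 diff "\<lambda>s. s powr (- \<eta>)" "1 / 2" "3 / 2" 1 "1 + v"])
    show "\<forall>m t. m < 3 \<and> 1 / 2 \<le> t \<and> t \<le> 3 / 2 \<longrightarrow> DERIV (diff m) t :> diff (Suc m) t"
    proof (intro allI impI)
      fix m :: nat and t :: real assume "m < 3 \<and> 1 / 2 \<le> t \<and> t \<le> 3 / 2"
      then have t: "t > 0" and "m = 0 \<or> m = 1 \<or> m = 2" by auto
      then consider "m = 0" | "m = 1" | "m = 2" by blast
      then show "DERIV (diff m) t :> diff (Suc m) t"
      proof cases
        case 1
        then show ?thesis using t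
          by (auto simp: diff_def[abs_def] intro!: derivative_eq_intros)
      next
        case 2
        have "((\<lambda>s. - \<eta> * s powr (- \<eta> - 1)) has_real_derivative - \<eta> * ((- \<eta> - 1) * t powr (- \<eta> - 1 - 1))) (at t)"
          using t by (intro DERIV_cmult DERIV_powr) (auto intro!: derivative_eq_intros)
        with 2 show ?thesis by (simp add: diff_def[abs_def] algebra_simps)
      next
        case 3
        have "((\<lambda>s. \<eta> * (\<eta> + 1) * s powr (- \<eta> - 2)) has_real_derivative \<eta> * (\<eta> + 1) * ((- \<eta> - 2) * t powr (- \<eta> - 2 - 1))) (at t)"
          using t by (intro DERIV_cmult DERIV_powr) (auto intro!: derivative_eq_intros)
        with 3 show ?thesis by (simp add: diff_def[abs_def] algebra_simps)
      qed
    qed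
  qed (use v False in \<open>auto simp: diff_def abs_le_iff\<close>)
  then obtain t where t: "if 1 + v < 1 then 1 + v < t \<and> t < 1 else 1 < t \<and> t < 1 + v"
    and eq: "(1 + v) powr (- \<eta>) = (\<Sum>m<3. diff m 1 / fact m * v ^ m) + diff 3 t / fact 3 * v ^ 3"
    by auto
  have t2: "1 / 2 \<le> t" using t v by (auto simp: abs_le_iff split: if_splits)
  have "t powr (- \<eta> - 3) \<le> (1 / 2) powr (- \<eta> - 3)"
    using t2 \<eta> by (intro powr_mono2') auto
  also have "\<dots> = 2 powr (\<eta> + 3)"
    by (simp add: powr_divide powr_minus_divide[symmetric] minus_diff_eq add.commute)
  also have "\<dots> \<le> 2 powr 4" using \<eta> by (intro powr_mono) auto
  finally have t16: "t powr (- \<eta> - 3) \<le> 16" by simp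
  have k: "\<eta> * (\<eta> + 1) * (\<eta> + 2) \<le> 1 * 2 * 3"
    using \<eta> by (intro mult_mono) auto
  have "\<bar>diff 3 t / fact 3 * v ^ 3\<bar> = (\<eta> * (\<eta> + 1) * (\<eta> + 2) / 6) * (t powr (- \<eta> - 3) * \<bar>v\<bar> ^ 3)"
    using \<eta> by (simp add: diff_def abs_mult fact_numeral power_abs)
  also have "\<dots> \<le> 1 * (16 * \<bar>v\<bar> ^ 3)"
    using k t16 \<eta> by (intro mult_mono) auto
  finally have "\<bar>diff 3 t / fact 3 * v ^ 3\<bar> \<le> 16 * \<bar>v\<bar> ^ 3" by simp
  moreover have "(\<Sum>m<3. diff m 1 / fact m * v ^ m) = 1 - \<eta> * v + \<eta> * (\<eta> + 1) / 2 * v\<^sup>2"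
    by (simp add: numeral_3_eq_3 diff_def power2_eq_square)
  ultimately show ?thesis by (simp add: eq)
qed simp

text \<open>
  Here \<open>t\<close> and \<open>u\<close> stand for \<open>Q y / S\<close> and for the polar form of \<open>w\<close> and \<open>y\<close> divided by \<open>S\<close>, where
  \<open>S = 1 + Q w\<close>, so that \<open>1 + (t - 2 * u)\<close> is the ratio of \<open>1 + Q (w - y)\<close> to \<open>S\<close>. The condition
  \<open>u\<^sup>2 \<le> t\<close> is the Cauchy--Schwarz inequality. All functions are expanded to second order in the
  increment \<open>y\<close>, that is, up to \<open>t\<close>, \<open>u\<close> and \<open>u\<^sup>2\<close>. The error is measured by \<open>t powr p\<close>, which is
  integrable if \<open>y\<close> has a moment of order \<open>2 * p\<close>: for small \<open>t\<close> it dominates the third order terms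
  since \<open>p \<le> 3 / 2\<close>, for large \<open>t\<close> the linear and quadratic terms since \<open>1 < p\<close>.
\<close>

context
  fixes t u p :: real
  assumes u: "u\<^sup>2 \<le> t" and p: "1 < p" "p \<le> 3 / 2"
begin

lemma t_nonneg: "0 \<le> t"
  using u by (meson order.trans zero_le_power2)

lemma u_le_sqrt: "\<bar>u\<bar> \<le> sqrt t"
  using u by (metis real_sqrt_abs real_sqrt_le_iff)

lemma three_halves: "t * sqrt t = t powr (3 / 2)"
proof (cases "t = 0")
  case False
  then have "t powr (1 + 1 / 2) = t powr 1 * t powr (1 / 2)" by (rule_tac powr_add)
  then show ?thesis using t_nonneg by (simp add: powr_half_sqrt)
qed simp

lemma three_halves_le: "t \<le> 1 \<Longrightarrow> t * sqrt t \<le> t powr p"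
  unfolding three_halves using t_nonneg p by (intro powr_mono') auto

lemma v_expansion:
  assumes "t \<le> 1"
  shows "\<bar>t - 2 * u\<bar> ^ 3 \<le> 27 * (t * sqrt t)"
    and "\<bar>(t - 2 * u)\<^sup>2 - 4 * u\<^sup>2\<bar> \<le> 5 * (t * sqrt t)"
proof -
  have st: "t \<le> sqrt t"
    using assms t_nonneg by (simp add: real_le_rsqrt power_le_one_iff power2_eq_square mult_left_le)
  have "\<bar>t - 2 * u\<bar> \<le> 3 * sqrt t"
    using st u_le_sqrt t_nonneg by linarith
  then have "\<bar>t - 2 * u\<bar> ^ 3 \<le> (3 * sqrt t) ^ 3"
    by (intro power_mono) auto
  also have "\<dots> = 27 * (t * sqrt t)"
    using t_nonneg by (simp add: power3_eq_cube)
  finally show "\<bar>t - 2 * u\<bar> ^ 3 \<le> 27 * (t * sqrt t)" .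
  have "\<bar>(t - 2 * u)\<^sup>2 - 4 * u\<^sup>2\<bar> = t * \<bar>t - 4 * u\<bar>"
  proof -
    have "(t - 2 * u)\<^sup>2 - 4 * u\<^sup>2 = t * (t - 4 * u)"
      by (simp add: power2_eq_square algebra_simps)
    then show ?thesis using t_nonneg by (simp add: abs_mult)
  qed
  also have "\<bar>t - 4 * u\<bar> \<le> 5 * sqrt t"
    using st u_le_sqrt t_nonneg by linarith
  finally show "\<bar>(t - 2 * u)\<^sup>2 - 4 * u\<^sup>2\<bar> \<le> 5 * (t * sqrt t)"
    using t_nonneg by (simp add: mult_left_mono mult.left_commute)
qed

lemma ln_quadratic_bound:
  assumes v: "t - 2 * u > - 1"
  shows "ln (1 + (t - 2 * u)) \<le> (t - 2 * u) - 2 * u\<^sup>2 + 11 * t powr p"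
proof (cases "t \<le> 1")
  case True
  have "ln (1 + (t - 2 * u)) \<le> (t - 2 * u) - (t - 2 * u)\<^sup>2 / 2 + (t - 2 * u) ^ 3 / 3"
    by (rule ln_one_plus_upper[OF v])
  moreover have "(t - 2 * u) ^ 3 \<le> \<bar>t - 2 * u\<bar> ^ 3"
    by (metis abs_ge_self power_abs)
  moreover have "4 * u\<^sup>2 - (t - 2 * u)\<^sup>2 \<le> 4 * (t * sqrt t)"
  proof -
    have "4 * u\<^sup>2 - (t - 2 * u)\<^sup>2 \<le> 4 * (t * u)"
      by (simp add: power2_eq_square algebra_simps)
    also have "\<dots> \<le> 4 * (t * sqrt t)"
      using u_le_sqrt t_nonneg by (intro mult_left_mono) auto
    finally show ?thesis .
  qed
  ultimately show ?thesis
    using v_expansion(1)[OF True] three_halves_le[OF True] by linarith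
next
  case False
  have "ln (1 + (t - 2 * u)) \<le> t - 2 * u"
    using v by (intro ln_add_one_self_le_self2) auto
  moreover have "t powr 1 \<le> t powr p"
    using False p by (intro powr_mono) auto
  moreover have "0 \<le> t powr p" by simp
  ultimately show ?thesis using u False by simp
qed

lemma powr_neg_quadratic_bounds:
  assumes \<eta>: "0 < \<eta>" "\<eta> \<le> 1" and t: "t \<le> 1 / 36"
  shows "\<bar>(1 + (t - 2 * u)) powr (- \<eta>) - (1 - \<eta> * (t - 2 * u) + 2 * \<eta> * (\<eta> + 1) * u\<^sup>2)\<bar> \<le> 1000 * t powr p"
proof -
  let ?v = "t - 2 * u"
  have s: "sqrt t \<le> 1 / 6"
    using t by (intro real_le_lsqrt) (auto simp: power2_eq_square)
  then have "\<bar>?v\<bar> \<le> 1 / 2"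
    using u_le_sqrt t t_nonneg by linarith
  from powr_neg_Taylor[OF this \<eta>]
  have 1: "\<bar>(1 + ?v) powr (- \<eta>) - (1 - \<eta> * ?v + \<eta> * (\<eta> + 1) / 2 * ?v\<^sup>2)\<bar> \<le> 16 * \<bar>?v\<bar> ^ 3" .
  have t1: "t \<le> 1" using t by simp
  have "\<eta> * (\<eta> + 1) / 2 \<le> 1 * 2 / 2"
    using \<eta> by (intro divide_right_mono mult_mono) auto
  then have "\<bar>\<eta> * (\<eta> + 1) / 2 * (?v\<^sup>2 - 4 * u\<^sup>2)\<bar> \<le> 1 * (5 * (t * sqrt t))"
    unfolding abs_mult using \<eta> v_expansion(2)[OF t1] by (intro mult_mono) auto
  moreover have "\<eta> * (\<eta> + 1) / 2 * (?v\<^sup>2 - 4 * u\<^sup>2) = \<eta> * (\<eta> + 1) / 2 * ?v\<^sup>2 - 2 * \<eta> * (\<eta> + 1) * u\<^sup>2"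
    by (simp add: field_simps)
  ultimately show ?thesis
    using 1 v_expansion(1)[OF t1] three_halves_le[OF t1] t_nonneg real_sqrt_ge_zero[OF t_nonneg]
    unfolding abs_le_iff by linarith
qed

text \<open>
  For large increments every term of the expansion is absorbed by the error term.
\<close>

lemma one_le_bad: "1 / 36 \<le> t \<Longrightarrow> 1 + 2 * sqrt t + 4 * t \<le> 1000 * t powr p"
proof -
  assume t: "1 / 36 \<le> t"
  let ?s = "36 * t"
  have s1: "1 \<le> ?s" using t by simp
  have "1 powr p \<le> ?s powr p" using s1 p by (intro powr_mono2) auto
  moreover have "?s powr 1 \<le> ?s powr p" using s1 p by (intro powr_mono) auto
  moreover have "?s powr p \<le> 216 * t powr p"
  proof -
    have "?s powr p = 36 powr p * t powr p" using t by (simp add: powr_mult)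
    moreover have "36 powr p \<le> 36 powr (3 / 2)" using p by (intro powr_mono) auto
    moreover have "36 powr (3 / 2) = (216 :: real)"
    proof -
      have "36 powr (3 / 2) = (36 :: real) powr (1 + 1 / 2)" by simp
      also have "\<dots> = 36 powr 1 * 36 powr (1 / 2)" by (rule powr_add)
      also have "\<dots> = 216" by (simp add: powr_half_sqrt)
      finally show ?thesis .
    qed
    ultimately show ?thesis by (simp add: mult_right_mono)
  qed
  moreover have "sqrt t \<le> 6 * t"
    using t by (intro real_le_lsqrt) (auto simp: power2_eq_square)
  ultimately show ?thesis using t t_nonneg by simp
qed

lemma neg_powr_neg_upper:
  assumes \<eta>: "0 < \<eta>" "\<eta> \<le> 1"
  shows "- ((1 + (t - 2 * u)) powr (- \<eta>)) \<le> - 1 + \<eta> * (t - 2 * u) - 2 * \<eta> * (\<eta> + 1) * u\<^sup>2 + 1000 * t powr p"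
proof (cases "t \<le> 1 / 36")
  case True
  then show ?thesis
    using powr_neg_quadratic_bounds[OF \<eta> True] by (simp add: abs_le_iff)
next
  case False
  have "\<eta> * (2 * u) \<le> \<eta> * (2 * \<bar>u\<bar>)"
    using \<eta> by (intro mult_left_mono) auto
  moreover have "\<eta> * (2 * \<bar>u\<bar>) \<le> 1 * (2 * sqrt t)"
    using \<eta> u_le_sqrt t_nonneg by (intro mult_mono) auto
  moreover have "2 * \<eta> * (\<eta> + 1) * u\<^sup>2 \<le> 2 * 1 * 2 * t"
    using \<eta> u t_nonneg by (intro mult_mono) auto
  moreover have "0 \<le> \<eta> * t" using \<eta> t_nonneg by simp
  moreover have "0 \<le> (1 + (t - 2 * u)) powr (- \<eta>)" by simp
  moreover have "\<eta> * (t - 2 * u) = \<eta> * t - \<eta> * (2 * u)"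
    by (simp add: right_diff_distrib)
  moreover have "1 + 2 * sqrt t + 4 * t \<le> 1000 * t powr p"
    using one_le_bad False by simp
  ultimately show ?thesis by linarith
qed

end

context
  fixes s q b p :: real
  assumes s: "1 \<le> s" and q: "0 \<le> q" and b: "b\<^sup>2 \<le> s * q" and pos: "0 < s + q - 2 * b"
    and p: "1 < p" "p \<le> 3 / 2"
begin

lemma scaled_u: "(b / s)\<^sup>2 \<le> q / s"
proof -
  have "b\<^sup>2 / s\<^sup>2 \<le> s * q / s\<^sup>2" using b by (intro divide_right_mono) auto
  then show ?thesis using s by (simp add: power_divide power2_eq_square)
qed

lemma scaled_eq: "s + q - 2 * b = s * (1 + (q / s - 2 * (b / s)))"
  using s by (simp add: field_simps)

lemma scaled_pos: "- 1 < q / s - 2 * (b / s)"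
  using pos s unfolding scaled_eq by (simp add: zero_less_mult_iff)

lemma scaled_powr: "(q / s) powr p = s powr (- p) * q powr p"
  using s q by (simp add: powr_divide powr_minus_divide)

lemma ln_shift_bound:
  "ln (s + q - 2 * b) \<le> ln s + 1 / s * (q - 2 * b) + (- 2 / s\<^sup>2) * b\<^sup>2 + 11 * s powr (- p) * q powr p"
proof -
  have "ln (s + q - 2 * b) = ln s + ln (1 + (q / s - 2 * (b / s)))"
    unfolding scaled_eq using s scaled_pos by (intro ln_mult_pos) auto
  also have "\<dots> \<le> ln s + ((q / s - 2 * (b / s)) - 2 * (b / s)\<^sup>2 + 11 * (q / s) powr p)"
    by (intro add_left_mono ln_quadratic_bound scaled_u p scaled_pos)
  also have "\<dots> = ln s + 1 / s * (q - 2 * b) + (- 2 / s\<^sup>2) * b\<^sup>2 + 11 * s powr (- p) * q powr p"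
    using s unfolding scaled_powr by (simp add: power_divide diff_divide_distrib)
  finally show ?thesis .
qed

context
  fixes \<eta> :: real
  assumes \<eta>: "0 < \<eta>" "\<eta> \<le> 1"
begin

lemma powr_shift: "(s + q - 2 * b) powr (- \<eta>) = s powr (- \<eta>) * (1 + (q / s - 2 * (b / s))) powr (- \<eta>)"
  unfolding scaled_eq using s scaled_pos by (intro powr_mult)

lemma main_terms:
  "s powr (- \<eta>) * (1 - \<eta> * (q / s - 2 * (b / s)) + 2 * \<eta> * (\<eta> + 1) * (b / s)\<^sup>2)
   = s powr (- \<eta>) - \<eta> * s powr (- \<eta> - 1) * (q - 2 * b) + 2 * \<eta> * (\<eta> + 1) * s powr (- \<eta> - 2) * b\<^sup>2"
proof -
  have 1: "s powr (- \<eta> - 1) = s powr (- \<eta>) / s" "s powr (- \<eta> - 2) = s powr (- \<eta>) / s\<^sup>2"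
    using s by (simp_all add: powr_diff)
  show ?thesis
    unfolding 1 using s by (simp add: field_simps power2_eq_square)
qed

lemma error_term: "s powr (- \<eta>) * (1000 * (q / s) powr p) \<le> 1000 * s powr (- p) * q powr p"
proof -
  have "s powr (- \<eta>) \<le> s powr 0"
    using s \<eta> by (intro powr_mono) auto
  then have "s powr (- \<eta>) * (1000 * (q / s) powr p) \<le> 1 * (1000 * (q / s) powr p)"
    using s by (intro mult_right_mono) auto
  then show ?thesis unfolding scaled_powr by simp
qed

lemma neg_powr_shift_bound:
  "- ((s + q - 2 * b) powr (- \<eta>)) \<le> - (s powr (- \<eta>)) + \<eta> * s powr (- \<eta> - 1) * (q - 2 * b)
     + (- 2 * \<eta> * (\<eta> + 1) * s powr (- \<eta> - 2)) * b\<^sup>2 + 1000 * s powr (- p) * q powr p"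
proof -
  let ?t = "q / s" and ?u = "b / s"
  have "- ((s + q - 2 * b) powr (- \<eta>)) = s powr (- \<eta>) * (- ((1 + (?t - 2 * ?u)) powr (- \<eta>)))"
    by (simp add: powr_shift)
  also have "\<dots> \<le> s powr (- \<eta>) * (- 1 + \<eta> * (?t - 2 * ?u) - 2 * \<eta> * (\<eta> + 1) * ?u\<^sup>2 + 1000 * ?t powr p)"
    by (intro mult_left_mono neg_powr_neg_upper scaled_u p \<eta>) auto
  also have "\<dots> = - (s powr (- \<eta>) * (1 - \<eta> * (?t - 2 * ?u) + 2 * \<eta> * (\<eta> + 1) * ?u\<^sup>2))
      + s powr (- \<eta>) * (1000 * ?t powr p)"
    by (simp add: algebra_simps)
  finally show ?thesis
    using error_term unfolding main_terms by simp
qed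

lemma powr_shift_bound:
  assumes small: "q \<le> s / 36"
  shows "(s + q - 2 * b) powr (- \<eta>) \<le> s powr (- \<eta>) + (- \<eta> * s powr (- \<eta> - 1)) * (q - 2 * b)
     + 2 * \<eta> * (\<eta> + 1) * s powr (- \<eta> - 2) * b\<^sup>2 + 1000 * s powr (- p) * q powr p"
proof -
  let ?t = "q / s" and ?u = "b / s"
  have t: "?t \<le> 1 / 36" using small s by (simp add: field_simps)
  have "(1 + (?t - 2 * ?u)) powr (- \<eta>) \<le> 1 - \<eta> * (?t - 2 * ?u) + 2 * \<eta> * (\<eta> + 1) * ?u\<^sup>2 + 1000 * ?t powr p"
    using powr_neg_quadratic_bounds[OF scaled_u p \<eta> t] by (simp add: abs_le_iff)
  then have "s powr (- \<eta>) * (1 + (?t - 2 * ?u)) powr (- \<eta>)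
      \<le> s powr (- \<eta>) * (1 - \<eta> * (?t - 2 * ?u) + 2 * \<eta> * (\<eta> + 1) * ?u\<^sup>2 + 1000 * ?t powr p)"
    by (rule mult_left_mono) simp
  also have "\<dots> = s powr (- \<eta>) * (1 - \<eta> * (?t - 2 * ?u) + 2 * \<eta> * (\<eta> + 1) * ?u\<^sup>2)
      + s powr (- \<eta>) * (1000 * ?t powr p)"
    by (simp add: algebra_simps)
  finally show ?thesis
    using error_term unfolding main_terms powr_shift by simp
qed

text \<open>
  The trivial bound of a negative power by \<open>1\<close>, which is used for increments comparable to the distance
  from the origin, written in the same form as the expansion for small increments.
\<close>

lemma one_le_far:
  assumes t0: "0 < t0" "t0 \<le> 1" and far: "t0 * s \<le> q"
  shows "1 \<le> s powr (- \<eta>) + (- \<eta> * s powr (- \<eta> - 1)) * (q - 2 * b)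
     + 2 * \<eta> * (\<eta> + 1) * s powr (- \<eta> - 2) * b\<^sup>2 + 2 * t0 powr (- p) * s powr (- p) * q powr p"
proof -
  let ?t = "q / s" and ?u = "b / s"
  let ?A = "1 - \<eta> * (?t - 2 * ?u) + 2 * \<eta> * (\<eta> + 1) * ?u\<^sup>2"
  have t: "t0 \<le> ?t" using far s by (simp add: field_simps)
  have t1: "0 \<le> ?t" using q s by simp
  have "0 \<le> \<eta> * (?u + 1)\<^sup>2 + \<eta> * ?u\<^sup>2 + 2 * \<eta>\<^sup>2 * ?u\<^sup>2" using \<eta> by simp
  also have "\<dots> = 2 * \<eta> * ?u + 2 * \<eta> * (\<eta> + 1) * ?u\<^sup>2 + \<eta>"
    by (simp add: power2_eq_square algebra_simps)
  finally have "- \<eta> * ?t \<le> ?A"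
    using \<eta> by (simp add: algebra_simps)
  moreover have "\<eta> * ?t \<le> 1 * ?t" using \<eta> t1 by (intro mult_right_mono) auto
  ultimately have A: "- ?t \<le> ?A" by linarith
  have s1: "0 \<le> s powr (- \<eta>)" "s powr (- \<eta>) \<le> 1"
    using s \<eta> powr_mono[of "- \<eta>" 0 s] by auto
  have "- ?t \<le> s powr (- \<eta>) * (- ?t)"
    using mult_right_mono[OF s1(2) t1] by simp
  also have "\<dots> \<le> s powr (- \<eta>) * ?A"
    using A s1 by (intro mult_left_mono) auto
  finally have 1: "- ?t \<le> s powr (- \<eta>) * ?A" .
  have r: "1 \<le> ?t / t0" using t t0 by (simp only: le_divide_eq_1_pos)
  have "(1 :: real) \<le> (?t / t0) powr p" using r p by (intro ge_one_powr_ge_zero) auto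
  moreover have "?t / t0 \<le> (?t / t0) powr p"
  proof -
    have "z \<le> z powr p" if "1 \<le> z" for z :: real
      using powr_mono[of 1 p z] that p by simp
    from this[OF r] show ?thesis .
  qed
  moreover have "?t \<le> ?t / t0" using mult_left_le[OF t0(2) t1] t0 by (simp only: pos_le_divide_eq)
  moreover have "(?t / t0) powr p = t0 powr (- p) * (s powr (- p) * q powr p)"
  proof -
    have "(?t / t0) powr p = ?t powr p / t0 powr p"
      by (rule powr_divide)
    then show ?thesis unfolding scaled_powr by (simp add: powr_minus_divide[of t0])
  qed
  ultimately have "1 + ?t \<le> 2 * (t0 powr (- p) * (s powr (- p) * q powr p))"
    by linarith
  with 1 show ?thesis unfolding main_terms by simp
qed

end

end

section \<open>Quadratic forms and moments\<close>

context lindley_chain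
begin

lemma borel_measurable_law: "borel_measurable \<mu> = borel_measurable borel"
  by (rule measurable_cong_sets) simp_all

text \<open>
  The chain is driven back to the bounded set \<open>B\<close>, and from there to the atom at the origin.
\<close>

lemma recurrence_Foster:
  fixes f :: "real^2 \<Rightarrow> real"
  assumes [measurable]: "f \<in> borel_measurable borel" "B \<in> sets borel"
    and B: "0 \<in> B" "bounded B"
    and f: "\<And>v. v \<in> quadrant \<Longrightarrow> v \<notin> B \<Longrightarrow> T (\<lambda>v. ennreal (f v)) v \<le> ennreal (f v)"
    and sub: "\<And>l. bounded {v \<in> quadrant. f v \<le> l}"
    and w: "w \<in> quadrant"
  shows "avoid_forever {0} w = 0"
proof -
  have reach: "\<exists>N. \<exists>c>0. \<forall>v\<in>quadrant. v \<in> A \<longrightarrow> ennreal c \<le> (T ^^ N) (indicator {0}) v"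
    if A: "bounded A" for A
  proof -
    obtain R where "\<And>v. v \<in> A \<Longrightarrow> norm v \<le> R"
      using A by (auto simp: bounded_iff)
    then show ?thesis using reach_zero[of R] by meson
  qed
  have B0: "avoid_forever B v = 0" if "v \<in> quadrant" for v
  proof (rule avoid_forever_Foster[OF _ _ f _ that])
    fix l
    obtain N c where c: "c > 0"
        "\<And>v. v \<in> quadrant \<Longrightarrow> v \<in> {v \<in> quadrant. f v \<le> l} \<Longrightarrow> ennreal c \<le> (T ^^ N) (indicator {0}) v"
      using reach[OF sub[of l]] by blast
    have "ennreal c \<le> (T ^^ N) (indicator B) v" if "v \<in> quadrant" "f v \<le> l" for v
    proof -
      have "ennreal c \<le> (T ^^ N) (indicator {0}) v" using c(2) that by simp
      also have "\<dots> \<le> (T ^^ N) (indicator B) v"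
        by (intro T_iter_mono) (use B that in \<open>auto simp: indicator_def\<close>)
      finally show ?thesis .
    qed
    with c(1) show "\<exists>N. \<exists>c>0. \<forall>v\<in>quadrant. f v \<le> l \<longrightarrow> ennreal c \<le> (T ^^ N) (indicator B) v"
      by blast
  qed auto
  obtain N c where c: "c > 0" "\<And>v. v \<in> quadrant \<Longrightarrow> v \<in> B \<Longrightarrow> ennreal c \<le> (T ^^ N) (indicator {0}) v"
    using reach[OF B(2)] by blast
  show ?thesis
  proof (rule avoid_forever_relay[OF _ _ B0 _ _ w])
    show "ennreal (1 - c) < 1" using c(1) by (simp add: ennreal_less_one_iff)
    show "avoid_forever {0} v \<le> ennreal (1 - c)" if "v \<in> quadrant \<inter> B" for v
      using c that by (intro avoid_forever_le_of_reach) auto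
  qed auto
qed

end

locale coordinate_pair =
  fixes i j :: 2
  assumes ij: "i \<noteq> j"
begin

lemma UNIV_ij: "(UNIV :: 2 set) = {i, j}"
proof -
  have "card {i, j} = card (UNIV :: 2 set)" using ij by simp
  then show ?thesis by (metis card_subset_eq finite subset_UNIV)
qed

lemma norm_sq: "(norm (w :: real^2))\<^sup>2 = (w $ i)\<^sup>2 + (w $ j)\<^sup>2"
proof -
  have "(norm w)\<^sup>2 = (\<Sum>k\<in>UNIV. (w $ k)\<^sup>2)"
    unfolding power2_norm_eq_inner inner_vec_def by (simp add: power2_eq_square)
  then show ?thesis unfolding UNIV_ij using ij by simp
qed

end

locale quadratic_form = coordinate_pair +
  fixes \<alpha> \<beta> \<gamma> :: real
  assumes form_pos: "0 < \<alpha>" "0 < \<beta>" "\<gamma>\<^sup>2 < \<alpha> * \<beta>"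
begin

definition Q :: "real^2 \<Rightarrow> real" where
  "Q w = \<alpha> * (w $ i)\<^sup>2 + \<beta> * (w $ j)\<^sup>2 + 2 * \<gamma> * (w $ i * w $ j)"

text \<open>
  The symmetric bilinear form with \<open>polar w w = Q w\<close>, sorted by the coordinates of \<open>y\<close>.
\<close>

definition polar :: "real^2 \<Rightarrow> real^2 \<Rightarrow> real" where
  "polar w y = (\<alpha> * w $ i + \<gamma> * w $ j) * y $ i + (\<beta> * w $ j + \<gamma> * w $ i) * y $ j"

lemma Q_diff: "Q (w - y) = Q w + Q y - 2 * polar w y"
  by (simp add: Q_def polar_def power2_eq_square algebra_simps)

text \<open>
  The smallest eigenvalue of a positive definite two-by-two matrix is at least determinant over trace.
\<close>

lemma Q_lower: "(\<alpha> * \<beta> - \<gamma>\<^sup>2) / (\<alpha> + \<beta>) * (norm w)\<^sup>2 \<le> Q w"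
proof -
  have "(\<alpha> + \<beta>) * Q w - (\<alpha> * \<beta> - \<gamma>\<^sup>2) * (norm w)\<^sup>2
      = (\<alpha> * w $ i + \<gamma> * w $ j)\<^sup>2 + (\<gamma> * w $ i + \<beta> * w $ j)\<^sup>2"
    unfolding norm_sq by (simp add: Q_def power2_eq_square algebra_simps)
  then have "(\<alpha> * \<beta> - \<gamma>\<^sup>2) * (norm w)\<^sup>2 \<le> (\<alpha> + \<beta>) * Q w"
    by (smt (verit) zero_le_power2)
  then show ?thesis
    using form_pos by (simp add: pos_divide_le_eq mult.commute)
qed

lemma Q_lower_pos: "0 < (\<alpha> * \<beta> - \<gamma>\<^sup>2) / (\<alpha> + \<beta>)"
  using form_pos by simp

lemma Q_nonneg [simp]: "0 \<le> Q w"
  using Q_lower[of w] Q_lower_pos by (smt (verit) mult_nonneg_nonneg zero_le_power2)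

lemma one_plus_Q_pos [simp]: "0 < 1 + Q w"
  using Q_nonneg[of w] by linarith

lemma Q_upper: "Q w \<le> (\<alpha> + \<beta>) * (norm w)\<^sup>2"
proof -
  have "\<gamma>\<^sup>2 \<le> \<alpha> * \<beta>" using form_pos by simp
  have "(\<alpha> + \<beta>) * ((\<alpha> + \<beta>) * (norm w)\<^sup>2 - Q w)
      = (\<beta> * w $ i - \<gamma> * w $ j)\<^sup>2 + (\<alpha> * w $ j - \<gamma> * w $ i)\<^sup>2 + (\<alpha> * \<beta> - \<gamma>\<^sup>2) * (norm w)\<^sup>2"
    unfolding norm_sq by (simp add: Q_def power2_eq_square algebra_simps)
  moreover have "0 \<le> (\<alpha> * \<beta> - \<gamma>\<^sup>2) * (norm w)\<^sup>2"
    using form_pos by (intro mult_nonneg_nonneg) auto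
  ultimately have "0 \<le> (\<alpha> + \<beta>) * ((\<alpha> + \<beta>) * (norm w)\<^sup>2 - Q w)"
    by (smt (verit) zero_le_power2)
  then show ?thesis
    using form_pos by (simp add: zero_le_mult_iff)
qed

lemma polar_Cauchy: "(polar w y)\<^sup>2 \<le> Q w * Q y"
proof -
  have "Q w * Q y - (polar w y)\<^sup>2 = (\<alpha> * \<beta> - \<gamma>\<^sup>2) * (w $ i * y $ j - w $ j * y $ i)\<^sup>2"
    by (simp add: Q_def polar_def power2_eq_square algebra_simps)
  moreover have "0 \<le> (\<alpha> * \<beta> - \<gamma>\<^sup>2) * (w $ i * y $ j - w $ j * y $ i)\<^sup>2"
    using form_pos by (intro mult_nonneg_nonneg) auto
  ultimately show ?thesis by simp
qed

lemma Q_measurable [measurable]: "Q \<in> borel_measurable borel"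
  unfolding Q_def by measurable

lemma Q_powr_measurable: "(\<lambda>w. Q w powr r) \<in> borel_measurable borel"
  by measurable

lemma one_plus_Q_measurable:
  "(\<lambda>w. (1 + Q w) powr r) \<in> borel_measurable borel" "(\<lambda>w. ln (1 + Q w)) \<in> borel_measurable borel"
  by measurable

lemma Q_zero [simp]: "Q 0 = 0"
  by (simp add: Q_def)

lemma bounded_Q_le: "bounded {w. Q w \<le> l}"
proof -
  let ?k = "(\<alpha> * \<beta> - \<gamma>\<^sup>2) / (\<alpha> + \<beta>)"
  have "norm w \<le> sqrt (l / ?k)" if "Q w \<le> l" for w
  proof (rule real_le_rsqrt)
    have "?k * (norm w)\<^sup>2 \<le> l" using Q_lower[of w] that by linarith
    then show "(norm w)\<^sup>2 \<le> l / ?k"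
      using Q_lower_pos by (simp only: pos_le_divide_eq mult.commute)
  qed
  then show ?thesis by (auto simp: bounded_iff)
qed

lemma shift_hyps:
  "1 \<le> 1 + Q w" "0 \<le> Q y" "(polar w y)\<^sup>2 \<le> (1 + Q w) * Q y" "0 < (1 + Q w) + Q y - 2 * polar w y"
proof -
  show "(polar w y)\<^sup>2 \<le> (1 + Q w) * Q y"
    using polar_Cauchy[of w y] by (simp add: distrib_right add_increasing)
  show "0 < (1 + Q w) + Q y - 2 * polar w y"
    using Q_diff[of w y] Q_nonneg[of "w - y"] by linarith
qed simp_all

text \<open>
  If one coordinate is negative and the other one is not, then with \<open>\<gamma> \<le> 0\<close> the mixed term is
  nonnegative, so all terms that are lost by the cut-off are nonnegative.
\<close>

lemma Q_step_le:
  assumes "\<gamma> \<le> 0"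
  shows "Q (lindley_step w y) \<le> Q (w - y)"
proof -
  let ?a = "w $ i - y $ i" and ?b = "w $ j - y $ j"
  have *: "0 \<le> 2 * \<gamma> * (a * b)" if "a * b \<le> 0" for a b
    using assms that by (simp add: mult_nonpos_nonpos)
  have sq: "0 \<le> \<alpha> * ?a\<^sup>2" "0 \<le> \<beta> * ?b\<^sup>2" using form_pos by auto
  consider "?a \<ge> 0" "?b \<ge> 0" | "?a < 0" "?b \<ge> 0" | "?a \<ge> 0" "?b < 0" | "?a < 0" "?b < 0"
    by linarith
  then show ?thesis
  proof cases
    case 4
    then show ?thesis
      using Q_nonneg[of "w - y"] by (simp add: Q_def)
  next
    case 2
    then show ?thesis
      using *[of ?a ?b] sq by (simp add: Q_def mult_nonpos_nonneg)
  next
    case 3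
    then show ?thesis
      using *[of ?a ?b] sq by (simp add: Q_def mult_nonneg_nonpos)
  qed (simp add: Q_def)
qed

end

locale moment_chain = lindley_chain \<mu> + coordinate_pair i j for \<mu> i j +
  fixes p :: real
  assumes p: "1 < p" "p \<le> 3 / 2"
    and moment: "\<And>k. integrable \<mu> (\<lambda>y. \<bar>y $ k\<bar> powr (2 * p))"
begin

lemma integrable_square: "integrable \<mu> (\<lambda>y. (y $ k)\<^sup>2)"
proof (rule Bochner_Integration.integrable_bound)
  show "integrable \<mu> (\<lambda>y. 1 + \<bar>y $ k\<bar> powr (2 * p))"
    using moment[of k] by simp
  show "AE y in \<mu>. norm ((y $ k)\<^sup>2) \<le> norm (1 + \<bar>y $ k\<bar> powr (2 * p))"
  proof (rule AE_I2)
    fix y :: "real^2"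
    have "\<bar>y $ k\<bar> powr 2 \<le> 1 + \<bar>y $ k\<bar> powr (2 * p)"
    proof (cases "\<bar>y $ k\<bar> \<le> 1")
      case True
      then have "\<bar>y $ k\<bar> powr 2 \<le> 1"
        by (intro powr_le1) auto
      then show ?thesis by (simp add: add_increasing2)
    next
      case False
      then have "\<bar>y $ k\<bar> powr 2 \<le> \<bar>y $ k\<bar> powr (2 * p)"
        using p by (intro powr_mono) auto
      then show ?thesis by simp
    qed
    then show "norm ((y $ k)\<^sup>2) \<le> norm (1 + \<bar>y $ k\<bar> powr (2 * p))"
      by (simp add: powr_numeral)
  qed
qed simp

lemma integrable_component: "integrable \<mu> (\<lambda>y. y $ k)"
proof (rule Bochner_Integration.integrable_bound)
  show "integrable \<mu> (\<lambda>y. 1 + (y $ k)\<^sup>2)" using integrable_square by simp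
  show "AE y in \<mu>. norm (y $ k) \<le> norm (1 + (y $ k)\<^sup>2)"
  proof (rule AE_I2)
    fix y :: "real^2"
    have "0 \<le> (\<bar>y $ k\<bar> - 1)\<^sup>2 + \<bar>y $ k\<bar>" by simp
    then have "\<bar>y $ k\<bar> \<le> 1 + (y $ k)\<^sup>2" by (simp add: power2_eq_square algebra_simps)
    then show "norm (y $ k) \<le> norm (1 + (y $ k)\<^sup>2)" by simp
  qed
qed simp

lemma integrable_product: "integrable \<mu> (\<lambda>y. y $ k * y $ l)"
proof (rule Bochner_Integration.integrable_bound)
  show "integrable \<mu> (\<lambda>y. (y $ k)\<^sup>2 + (y $ l)\<^sup>2)" using integrable_square by simp
  show "AE y in \<mu>. norm (y $ k * y $ l) \<le> norm ((y $ k)\<^sup>2 + (y $ l)\<^sup>2)"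
  proof (rule AE_I2)
    fix y :: "real^2"
    have "0 \<le> (\<bar>y $ k\<bar> - \<bar>y $ l\<bar>)\<^sup>2 + (y $ k)\<^sup>2 + (y $ l)\<^sup>2" by simp
    then show "norm (y $ k * y $ l) \<le> norm ((y $ k)\<^sup>2 + (y $ l)\<^sup>2)"
      by (simp add: power2_eq_square algebra_simps abs_mult)
  qed
qed simp

definition "mean k = (\<integral>y. y $ k \<partial>\<mu>)"
definition "mom k l = (\<integral>y. y $ k * y $ l \<partial>\<mu>)"

lemma mom_nonneg: "0 \<le> mom k k"
  unfolding mom_def by simp

lemma quadratic_moment:
  "integrable \<mu> (\<lambda>y. (a * y $ i + b * y $ j)\<^sup>2)"
  "(\<integral>y. (a * y $ i + b * y $ j)\<^sup>2 \<partial>\<mu>) = a\<^sup>2 * mom i i + b\<^sup>2 * mom j j + 2 * a * b * mom i j"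
proof -
  have eq: "(a * y $ i + b * y $ j)\<^sup>2 = a\<^sup>2 * (y $ i * y $ i) + b\<^sup>2 * (y $ j * y $ j) + 2 * a * b * (y $ i * y $ j)"
    for y :: "real^2"
    by (simp add: power2_eq_square algebra_simps)
  show "integrable \<mu> (\<lambda>y. (a * y $ i + b * y $ j)\<^sup>2)"
    unfolding eq using integrable_product by simp
  show "(\<integral>y. (a * y $ i + b * y $ j)\<^sup>2 \<partial>\<mu>) = a\<^sup>2 * mom i i + b\<^sup>2 * mom j j + 2 * a * b * mom i j"
    unfolding eq mom_def using integrable_product by simp
qed

end

locale quadratic_chain = moment_chain \<mu> i j p + quadratic_form i j \<alpha> \<beta> \<gamma>
  for \<mu> i j p \<alpha> \<beta> \<gamma>
begin

definition "mean_Q = \<alpha> * mom i i + \<beta> * mom j j + 2 * \<gamma> * mom i j"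
definition "mean_polar_sq w = (\<integral>y. (polar w y)\<^sup>2 \<partial>\<mu>)"
definition "mean_Q_powr = (\<integral>y. Q y powr p \<partial>\<mu>)"

lemma Q_integrable: "integrable \<mu> Q"
  and Q_integral: "(\<integral>y. Q y \<partial>\<mu>) = mean_Q"
proof -
  have eq: "Q y = \<alpha> * (y $ i * y $ i) + \<beta> * (y $ j * y $ j) + 2 * \<gamma> * (y $ i * y $ j)" for y
    by (simp add: Q_def power2_eq_square)
  show "integrable \<mu> Q" "(\<integral>y. Q y \<partial>\<mu>) = mean_Q"
    unfolding eq[abs_def] mean_Q_def mom_def using integrable_product by simp_all
qed

lemma polar_integrable: "integrable \<mu> (polar w)"
  and polar_integral: "(\<integral>y. polar w y \<partial>\<mu>) = (\<alpha> * w $ i + \<gamma> * w $ j) * mean i + (\<beta> * w $ j + \<gamma> * w $ i) * mean j"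
  unfolding polar_def[abs_def] mean_def using integrable_component by simp_all

lemma polar_square_integrable: "integrable \<mu> (\<lambda>y. (polar w y)\<^sup>2)"
  and mean_polar_sq_eq: "mean_polar_sq w = (\<alpha> * w $ i + \<gamma> * w $ j)\<^sup>2 * mom i i + (\<beta> * w $ j + \<gamma> * w $ i)\<^sup>2 * mom j j
     + 2 * (\<alpha> * w $ i + \<gamma> * w $ j) * (\<beta> * w $ j + \<gamma> * w $ i) * mom i j"
  unfolding polar_def[abs_def] mean_polar_sq_def by (rule quadratic_moment)+

lemma Q_powr_integrable: "integrable \<mu> (\<lambda>y. Q y powr p)"
proof (rule Bochner_Integration.integrable_bound)
  let ?C = "(2 * (\<alpha> + \<beta>)) powr p"
  show "integrable \<mu> (\<lambda>y. ?C * (\<bar>y $ i\<bar> powr (2 * p) + \<bar>y $ j\<bar> powr (2 * p)))"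
    using moment by simp
  show "AE y in \<mu>. norm (Q y powr p) \<le> norm (?C * (\<bar>y $ i\<bar> powr (2 * p) + \<bar>y $ j\<bar> powr (2 * p)))"
  proof (rule AE_I2)
    fix y :: "real^2"
    let ?m = "max \<bar>y $ i\<bar> \<bar>y $ j\<bar>"
    have "(y $ i)\<^sup>2 \<le> ?m\<^sup>2" "(y $ j)\<^sup>2 \<le> ?m\<^sup>2"
      by (auto intro!: power2_le_iff_abs_le[THEN iffD2] simp: le_max_iff_disj)
    then have "(norm y)\<^sup>2 \<le> 2 * ?m\<^sup>2" by (simp add: norm_sq)
    then have "(\<alpha> + \<beta>) * (norm y)\<^sup>2 \<le> (\<alpha> + \<beta>) * (2 * ?m\<^sup>2)"
      using form_pos by (intro mult_left_mono) auto
    with Q_upper[of y] have "Q y \<le> (2 * (\<alpha> + \<beta>)) * ?m\<^sup>2" by (simp only: mult.assoc mult.left_commute)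
    then have "Q y powr p \<le> ((2 * (\<alpha> + \<beta>)) * ?m\<^sup>2) powr p"
      using p by (intro powr_mono2) auto
    also have "\<dots> = ?C * (?m\<^sup>2) powr p"
      by (rule powr_mult)
    also have "(?m\<^sup>2) powr p = ?m powr (2 * p)"
    proof -
      have m2: "?m powr 2 = ?m\<^sup>2" by (simp add: le_max_iff_disj)
      have "(?m powr 2) powr p = ?m powr (2 * p)" by (rule powr_powr)
      then show ?thesis unfolding m2 .
    qed
    also have "?C * ?m powr (2 * p) \<le> ?C * (\<bar>y $ i\<bar> powr (2 * p) + \<bar>y $ j\<bar> powr (2 * p))"
      by (intro mult_left_mono) (auto simp: max_def)
    finally show "norm (Q y powr p) \<le> norm (?C * (\<bar>y $ i\<bar> powr (2 * p) + \<bar>y $ j\<bar> powr (2 * p)))"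
      by simp
  qed
qed (simp add: borel_measurable_law Q_powr_measurable)

text \<open>
  A pointwise expansion of \<open>f\<close> along a step, integrated against the law of the increment.
\<close>

lemma T_quadratic_bound:
  assumes f0: "\<And>v. 0 \<le> f v"
    and pw: "\<And>y. f (lindley_step w y) \<le> ca + cb * (Q y - 2 * polar w y) + cc * (polar w y)\<^sup>2 + cd * Q y powr p"
    and total: "ca + cb * (mean_Q - 2 * (\<integral>y. polar w y \<partial>\<mu>)) + cc * mean_polar_sq w + cd * mean_Q_powr \<le> f w"
  shows "T (\<lambda>v. ennreal (f v)) w \<le> ennreal (f w)"
proof -
  let ?g = "\<lambda>y. ca + cb * (Q y - 2 * polar w y) + cc * (polar w y)\<^sup>2 + cd * Q y powr p"
  have int: "integrable \<mu> ?g"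
    using Q_integrable polar_integrable polar_square_integrable Q_powr_integrable by simp
  have "T (\<lambda>v. ennreal (f v)) w \<le> (\<integral>\<^sup>+ y. ennreal (?g y) \<partial>\<mu>)"
    unfolding T_def by (intro nn_integral_mono ennreal_leI pw)
  also have "\<dots> = ennreal (\<integral>y. ?g y \<partial>\<mu>)"
    using int by (intro nn_integral_eq_integral AE_I2) (auto intro: order.trans[OF f0 pw])
  also have "(\<integral>y. ?g y \<partial>\<mu>) = ca + cb * (mean_Q - 2 * (\<integral>y. polar w y \<partial>\<mu>)) + cc * mean_polar_sq w + cd * mean_Q_powr"
    using Q_integrable polar_integrable polar_square_integrable Q_powr_integrable
    by (simp add: Q_integral mean_polar_sq_def mean_Q_powr_def M.prob_space[simplified])
  also have "ennreal \<dots> \<le> ennreal (f w)"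
    by (rule ennreal_leI[OF total])
  finally show ?thesis .
qed

end

section \<open>Lyapunov functions\<close>

lemma eventually_at_top_obtain:
  assumes "eventually P (at_top :: real filter)"
  obtains S0 where "1 \<le> S0" "\<And>S. S0 \<le> S \<Longrightarrow> P S"
proof -
  obtain N where "\<And>S. N \<le> S \<Longrightarrow> P S"
    using assms by (auto simp: eventually_at_top_linorder)
  then show ?thesis by (intro that[of "max 1 N"]) auto
qed

lemma powr_tendsto_0: "a < 0 \<Longrightarrow> ((\<lambda>S :: real. S powr a) \<longlongrightarrow> 0) at_top"
  by (rule tendsto_neg_powr[OF _ filterlim_ident])

lemma divide_tendsto_0: "((\<lambda>S :: real. c / S) \<longlongrightarrow> 0) at_top"
  by (rule tendsto_divide_0[OF tendsto_const filterlim_at_top_imp_at_infinity[OF filterlim_ident]])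

lemma powr_one_step:
  assumes "1 \<le> (S :: real)"
  shows "S powr (a - 1) = S powr (a - 2) * S"
proof -
  have "a - 1 = (a - 2) + 1" by simp
  then have "S powr (a - 1) = S powr (a - 2) * S powr 1" by (simp only: powr_add)
  then show ?thesis using assms by simp
qed

context moment_chain
begin

lemma integral_negative_part:
  assumes "mean k = 0" "mom k k > 0"
  obtains m where "m > 0" "ennreal m \<le> (\<integral>\<^sup>+ y. ennreal (max 0 (- y $ k)) \<partial>\<mu>)"
    and "emeasure \<mu> {y. y $ k < 0} \<noteq> 0"
proof -
  define m where "m = (\<integral>y. max 0 (- y $ k) \<partial>\<mu>)"
  have int: "integrable \<mu> (\<lambda>y. max 0 (- y $ k))" "integrable \<mu> (\<lambda>y. \<bar>y $ k\<bar>)"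
    using integrable_component[of k] by auto
  have "2 * m - (\<integral>y. \<bar>y $ k\<bar> \<partial>\<mu>) = (\<integral>y. 2 * max 0 (- y $ k) - \<bar>y $ k\<bar> \<partial>\<mu>)"
    unfolding m_def using int by simp
  also have "\<dots> = (\<integral>y. - y $ k \<partial>\<mu>)"
    by (intro Bochner_Integration.integral_cong) (auto simp: max_def)
  finally have eq: "2 * m = (\<integral>y. \<bar>y $ k\<bar> \<partial>\<mu>)"
    using assms(1) by (simp add: mean_def)
  have m0: "0 \<le> m" unfolding m_def by simp
  have "m \<noteq> 0"
  proof
    assume "m = 0"
    then have "AE y in \<mu>. \<bar>y $ k\<bar> = 0"
      using eq integral_nonneg_eq_0_iff_AE[OF int(2)] by simp
    then have "AE y in \<mu>. y $ k * y $ k = 0" by eventually_elim simp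
    then have "mom k k = 0"
      unfolding mom_def by (subst integral_cong_AE[where g = "\<lambda>_. 0"]) auto
    then show False using assms by simp
  qed
  then have m: "m > 0" using m0 by simp
  have eq2: "ennreal m = (\<integral>\<^sup>+ y. ennreal (max 0 (- y $ k)) \<partial>\<mu>)"
    unfolding m_def using int by (intro nn_integral_eq_integral[symmetric]) auto
  have "emeasure \<mu> {y. y $ k < 0} \<noteq> 0"
  proof
    assume 0: "emeasure \<mu> {y. y $ k < 0} = 0"
    have "AE y in \<mu>. ennreal (max 0 (- y $ k)) = 0"
      by (rule AE_I[OF _ 0]) (auto simp: ennreal_eq_0_iff)
    then have "(\<integral>\<^sup>+ y. ennreal (max 0 (- y $ k)) \<partial>\<mu>) = 0"
      by (subst nn_integral_0_iff_AE) auto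
    with eq2 m show False by simp
  qed
  then show ?thesis using that[OF m] eq2 by simp
qed

lemma return_probability_small_of_mean_zero:
  assumes "mean k = 0" "mom k k > 0" "e > 0"
  shows "\<exists>n. (T ^^ n) (indicator {0}) 0 \<le> ennreal e"
proof -
  obtain m where "m > 0" "ennreal m \<le> (\<integral>\<^sup>+ y. ennreal (max 0 (- y $ k)) \<partial>\<mu>)"
    using integral_negative_part[OF assms(1,2)] by blast
  then show ?thesis
    using assms by (intro return_probability_small[OF integrable_component integrable_square]) (auto simp: mean_def)
qed

text \<open>
  The form \<open>Q\<close> is the determinant \<open>D\<close> of the covariance matrix times its inverse, which makes
  \<open>E (polar w X)\<^sup>2 = D * Q w\<close> and \<open>E Q X = 2 * D\<close>. With \<open>S = 1 + Q w\<close> the second order terms of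
  \<open>ln S\<close> cancel up to \<open>2 * D / S\<^sup>2\<close>, and \<open>- S powr (- \<eta>)\<close> contributes
  \<open>- 2 * D * \<eta>\<^sup>2 * S powr (- \<eta> - 1)\<close> to leading order. The latter wins, also against the error
  \<open>S powr (- p)\<close>, because \<open>p = 1 + 2 * \<eta>\<close>.
\<close>

lemma return_of_nonneg_correlation:
  assumes mean: "mean i = 0" "mean j = 0"
    and cov: "0 \<le> mom i j" "(mom i j)\<^sup>2 < mom i i * mom j j"
    and w: "w \<in> quadrant"
  shows "avoid_forever {0} w = 0"
proof -
  define D where "D = mom i i * mom j j - (mom i j)\<^sup>2"
  have D: "D > 0" using cov by (simp add: D_def)
  have "mom i i * mom j j > 0" using cov by (meson le_less_trans zero_le_power2)
  then have pos: "mom i i > 0" "mom j j > 0"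
    using mom_nonneg[of i] mom_nonneg[of j] by (auto simp: zero_less_mult_iff)
  interpret quadratic_chain \<mu> i j p "mom j j" "mom i i" "- mom i j"
    using pos cov by unfold_locales (auto simp: mult.commute)
  define \<eta> where "\<eta> = (p - 1) / 2"
  have \<eta>: "0 < \<eta>" "\<eta> \<le> 1" "p = 1 + 2 * \<eta>" using p by (auto simp: \<eta>_def field_simps)
  define f where "f w = ln (1 + Q w) - (1 + Q w) powr (- \<eta>) + 1" for w
  have mean_Q: "mean_Q = 2 * D"
    by (simp add: mean_Q_def D_def power2_eq_square algebra_simps)
  have mean_polar_sq: "mean_polar_sq w = D * Q w" for w
    unfolding mean_polar_sq_eq Q_def D_def by (simp add: power2_eq_square algebra_simps)
  \<comment> \<open>the total drift is \<open>S powr (- \<eta> - 1) * (h S - 2 * D * \<eta>\<^sup>2)\<close>\<close>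
  define h where "h S = 2 * D * (S powr (\<eta> - 1) + \<eta> * (\<eta> + 1) / S) + 1011 * mean_Q_powr * S powr (- \<eta>)" for S
  have lim: "((\<lambda>S. S powr (\<eta> - 1)) \<longlongrightarrow> 0) at_top" "((\<lambda>S. S powr (- \<eta>)) \<longlongrightarrow> 0) at_top"
    by (rule powr_tendsto_0, use \<eta> p in linarith)+
  have "((\<lambda>S. 2 * D * (S powr (\<eta> - 1) + \<eta> * (\<eta> + 1) / S) + 1011 * mean_Q_powr * S powr (- \<eta>))
      \<longlongrightarrow> 2 * D * (0 + 0) + 1011 * mean_Q_powr * 0) at_top"
    by (rule tendsto_add[OF tendsto_mult[OF tendsto_const tendsto_add[OF lim(1) divide_tendsto_0]]
        tendsto_mult[OF tendsto_const lim(2)]])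
  then have "(h \<longlongrightarrow> 0) at_top" by (simp add: h_def[abs_def])
  then have "eventually (\<lambda>S. h S < 2 * D * \<eta>\<^sup>2) at_top"
    using D \<eta> by (intro order_tendstoD) auto
  then obtain S0 where S0: "1 \<le> S0" "\<And>S. S0 \<le> S \<Longrightarrow> h S < 2 * D * \<eta>\<^sup>2"
    using eventually_at_top_obtain by blast
  have f_mono: "f v \<le> f v'" if "Q v \<le> Q v'" for v v'
  proof -
    have "(1 + Q v') powr (- \<eta>) \<le> (1 + Q v) powr (- \<eta>)"
      using that \<eta> Q_nonneg[of v] by (intro powr_mono2') auto
    moreover have "ln (1 + Q v) \<le> ln (1 + Q v')"
      using that Q_nonneg[of v] by simp
    ultimately show ?thesis unfolding f_def by linarith
  qed
  have f0: "0 \<le> f v" for v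
    using f_mono[of 0 v] by (simp add: f_def)
  show ?thesis
  proof (rule recurrence_Foster[of f "{w. Q w \<le> S0}"])
    show "f \<in> borel_measurable borel"
      unfolding f_def[abs_def] by (intro borel_measurable_add borel_measurable_diff one_plus_Q_measurable) simp
    show "bounded {v \<in> quadrant. f v \<le> l}" for l
    proof (rule bounded_subset[OF bounded_Q_le[of "exp l"]], safe)
      fix v assume "f v \<le> l"
      moreover have "(1 + Q v) powr (- \<eta>) \<le> 1 powr (- \<eta>)"
        using \<eta> by (intro powr_mono2') auto
      ultimately have "ln (1 + Q v) \<le> l" by (simp add: f_def)
      then have "1 + Q v \<le> exp l"
        using Q_nonneg[of v] by (metis add_pos_nonneg exp_le_cancel_iff exp_ln zero_less_one)
      then show "Q v \<le> exp l" by simp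
    qed
    fix w :: "real^2" assume "w \<notin> {w. Q w \<le> S0}"
    define S where "S = 1 + Q w"
    have S: "S0 \<le> S" "1 \<le> S" using \<open>w \<notin> _\<close> S0(1) by (auto simp: S_def)
    note hyps = shift_hyps(1)[of w, folded S_def] Q_nonneg shift_hyps(3,4)[of w, folded S_def]
    show "T (\<lambda>v. ennreal (f v)) w \<le> ennreal (f w)"
    proof (rule T_quadratic_bound[OF f0,
        where ca = "f w" and cb = "1 / S + \<eta> * S powr (- \<eta> - 1)"
          and cc = "- 2 / S\<^sup>2 + (- 2 * \<eta> * (\<eta> + 1) * S powr (- \<eta> - 2))"
          and cd = "1011 * S powr (- p)"])
      fix y
      have "f (lindley_step w y) \<le> f (w - y)"
        by (intro f_mono Q_step_le) (use cov in simp)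
      also have "f (w - y) = ln (S + Q y - 2 * polar w y) + - ((S + Q y - 2 * polar w y) powr (- \<eta>)) + 1"
        by (simp add: f_def Q_diff S_def add.assoc diff_add_eq add_diff_eq)
      also have "\<dots> \<le> (ln S + 1 / S * (Q y - 2 * polar w y) + (- 2 / S\<^sup>2) * (polar w y)\<^sup>2 + 11 * S powr (- p) * Q y powr p)
          + (- (S powr (- \<eta>)) + \<eta> * S powr (- \<eta> - 1) * (Q y - 2 * polar w y)
            + (- 2 * \<eta> * (\<eta> + 1) * S powr (- \<eta> - 2)) * (polar w y)\<^sup>2 + 1000 * S powr (- p) * Q y powr p) + 1"
        by (intro add_mono ln_shift_bound neg_powr_shift_bound hyps p \<eta> order.refl)
      also have "\<dots> = f w + (1 / S + \<eta> * S powr (- \<eta> - 1)) * (Q y - 2 * polar w y)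
          + (- 2 / S\<^sup>2 + (- 2 * \<eta> * (\<eta> + 1) * S powr (- \<eta> - 2))) * (polar w y)\<^sup>2 + 1011 * S powr (- p) * Q y powr p"
        unfolding f_def S_def by algebra
      finally show "f (lindley_step w y) \<le> \<dots>" .
    next
      \<comment> \<open>in terms of these powers the remaining inequality is a polynomial identity up to the sign of \<open>h S - 2 * D * \<eta>\<^sup>2\<close>\<close>
      define X where "X = S powr (- \<eta> - 1)"
      have X: "X > 0" using S by (simp add: X_def)
      define Z where "Z = S powr (- 2)"
      define R where "R = S powr (- \<eta> - 2)"
      have e: "X = R * S" "S powr (- p) = X * S powr (- \<eta>)" "1 / S\<^sup>2 = Z" "1 / S = S * Z" "Z = X * S powr (\<eta> - 1)"
      proof -
        show "X = R * S"
          unfolding X_def R_def by (rule powr_one_step) fact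
        show "S powr (- p) = X * S powr (- \<eta>)"
        proof -
          have "- p = (- \<eta> - 1) + (- \<eta>)" unfolding \<eta>(3) by simp
          then show ?thesis unfolding X_def by (simp only: powr_add)
        qed
        show "Z = X * S powr (\<eta> - 1)"
          unfolding X_def Z_def by (simp flip: powr_add)
        show *: "1 / S\<^sup>2 = Z"
          using S by (simp add: Z_def powr_minus_divide powr_numeral)
        show "1 / S = S * Z"
          using S unfolding *[symmetric] by (simp add: power2_eq_square)
      qed
      have Z2: "- 2 / S\<^sup>2 = - 2 * Z" and Qw: "Q w = S - 1"
        unfolding e(3)[symmetric] S_def by simp_all
      have "(\<integral>y. polar w y \<partial>\<mu>) = 0"
        by (simp add: polar_integral mean)
      then have "(f w + (1 / S + \<eta> * X) * (mean_Q - 2 * (\<integral>y. polar w y \<partial>\<mu>))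
          + (- 2 / S\<^sup>2 + (- 2 * \<eta> * (\<eta> + 1) * R)) * mean_polar_sq w + 1011 * S powr (- p) * mean_Q_powr) - f w
        = (S * Z + \<eta> * (R * S)) * (2 * D) - 2 * (Z + \<eta> * (\<eta> + 1) * R) * (D * (S - 1)) + 1011 * S powr (- p) * mean_Q_powr"
        unfolding mean_Q mean_polar_sq e(4) e(1) Z2 Qw by (simp add: algebra_simps)
      also have "\<dots> = 2 * D * (Z + \<eta> * (\<eta> + 1) * R - \<eta>\<^sup>2 * (R * S)) + 1011 * S powr (- p) * mean_Q_powr"
        by (simp add: power2_eq_square algebra_simps)
      also have "\<dots> = X * (h S - 2 * D * \<eta>\<^sup>2)"
      proof -
        have R: "R = X * (1 / S)" using S by (simp add: e(1))
        show ?thesis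
          unfolding e(1)[symmetric] unfolding R e(2) e(5) h_def by (simp add: algebra_simps add_divide_distrib)
      qed
      also have "\<dots> \<le> 0"
        using X S0(2)[OF S(1)] by (simp add: mult_nonneg_nonpos)
      finally show "f w + (1 / S + \<eta> * S powr (- \<eta> - 1)) * (mean_Q - 2 * (\<integral>y. polar w y \<partial>\<mu>))
          + (- 2 / S\<^sup>2 + (- 2 * \<eta> * (\<eta> + 1) * S powr (- \<eta> - 2))) * mean_polar_sq w + 1011 * S powr (- p) * mean_Q_powr \<le> f w"
        unfolding X_def R_def by simp
    qed
  qed (use S0 w bounded_Q_le in auto)
qed


text \<open>
  With \<open>S = 1 + Q w\<close>, the drift of \<open>ln S\<close> is
  \<open>(mean_Q - 2 * \<kappa> * w $ j * mean j - 2 * mean_polar_sq w / S) / S\<close> up to the error. The weight \<open>\<kappa>\<close>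
  is such that \<open>mean_Q = 3 / 2 * mom i i\<close>. If \<open>w $ j\<close> exceeds the constant \<open>K\<close>, the middle term makes
  the bracket at most \<open>- 1\<close>. Otherwise \<open>(w $ i)\<^sup>2\<close> is close to \<open>S\<close>, the last term is close to
  \<open>- 2 * mom i i\<close>, and the bracket is close to at most \<open>- mom i i / 2\<close>.
\<close>

lemma return_of_mean_zero_and_mean_pos:
  assumes mean: "mean i = 0" "mean j > 0" and var: "mom i i > 0" "mom j j > 0"
    and w: "w \<in> quadrant"
  shows "avoid_forever {0} w = 0"
proof -
  define \<kappa> where "\<kappa> = mom i i / (2 * mom j j)"
  have \<kappa>: "\<kappa> > 0" using var by (simp add: \<kappa>_def)
  interpret quadratic_chain \<mu> i j p 1 \<kappa> 0
    using \<kappa> by unfold_locales auto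
  have mean_Q: "mean_Q = 3 / 2 * mom i i"
    unfolding mean_Q_def using var by (simp add: \<kappa>_def)
  have mean_polar_sq: "mean_polar_sq w = (w $ i)\<^sup>2 * mom i i + (\<kappa> * w $ j)\<^sup>2 * mom j j + 2 * \<kappa> * w $ i * w $ j * mom i j" for w
    by (simp add: mean_polar_sq_eq algebra_simps)
  have mbil: "(\<integral>y. polar w y \<partial>\<mu>) = \<kappa> * w $ j * mean j" for w
    by (simp add: polar_integral mean)
  have mB0: "0 \<le> mean_polar_sq w" for w
    unfolding mean_polar_sq_def by simp
  \<comment> \<open>the threshold for \<open>w $ j\<close> beyond which the drift alone suffices\<close>
  define K where "K = (mean_Q + 1) / (2 * \<kappa> * mean j)"
  have K: "2 * \<kappa> * mean j * K = mean_Q + 1" and K0: "K \<ge> 0"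
    using \<kappa> mean var by (auto simp: K_def mean_Q)
  define c where "c = \<bar>mom i j\<bar>"
  define h where "h S = 2 * mom i i * (1 + \<kappa> * K\<^sup>2) / S + 4 * \<kappa> * K * c * S powr (- (1 / 2)) + 11 * mean_Q_powr * S powr (1 - p)" for S
  have lim: "((\<lambda>S :: real. S powr (- (1 / 2))) \<longlongrightarrow> 0) at_top" "((\<lambda>S. S powr (1 - p)) \<longlongrightarrow> 0) at_top"
    by (rule powr_tendsto_0, use p in linarith)+
  have "(h \<longlongrightarrow> 0 + 4 * \<kappa> * K * c * 0 + 11 * mean_Q_powr * 0) at_top"
    unfolding h_def
    by (rule tendsto_add[OF tendsto_add[OF divide_tendsto_0 tendsto_mult[OF tendsto_const lim(1)]]
        tendsto_mult[OF tendsto_const lim(2)]])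
  then have "(h \<longlongrightarrow> 0) at_top" by simp
  then have "eventually (\<lambda>S. h S < min 1 (mom i i / 2)) at_top"
    using var by (intro order_tendstoD) auto
  then obtain S0 where S0: "1 \<le> S0" "\<And>S. S0 \<le> S \<Longrightarrow> h S < min 1 (mom i i / 2)"
    using eventually_at_top_obtain by blast
  define f where "f w = ln (1 + Q w)" for w
  have f_mono: "f v \<le> f v'" if "Q v \<le> Q v'" for v v'
    using that by (simp add: f_def)
  have f0: "0 \<le> f v" for v
    by (simp add: f_def)
  show ?thesis
  proof (rule recurrence_Foster[of f "{w. Q w \<le> S0}"])
    show "f \<in> borel_measurable borel"
      unfolding f_def[abs_def] by (rule one_plus_Q_measurable)
    show "bounded {v \<in> quadrant. f v \<le> l}" for l
    proof (rule bounded_subset[OF bounded_Q_le[of "exp l"]], safe)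
      fix v assume "f v \<le> l"
      then have "1 + Q v \<le> exp l"
        unfolding f_def by (metis one_plus_Q_pos exp_le_cancel_iff exp_ln)
      then show "Q v \<le> exp l" by simp
    qed
    fix w :: "real^2" assume w: "w \<in> quadrant" and "w \<notin> {w. Q w \<le> S0}"
    define S where "S = 1 + Q w"
    have S: "S0 \<le> S" "1 \<le> S" using \<open>w \<notin> _\<close> S0(1) by (auto simp: S_def)
    have w0: "0 \<le> w $ i" "0 \<le> w $ j" using w by (auto simp: quadrant_def)
    note hyps = shift_hyps(1)[of w, folded S_def] Q_nonneg shift_hyps(3,4)[of w, folded S_def]
    show "T (\<lambda>v. ennreal (f v)) w \<le> ennreal (f w)"
    proof (rule T_quadratic_bound[OF f0,
        where ca = "f w" and cb = "1 / S" and cc = "- 2 / S\<^sup>2" and cd = "11 * S powr (- p)"])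
      fix y
      have "f (lindley_step w y) \<le> f (w - y)"
        by (intro f_mono Q_step_le) simp
      also have "f (w - y) = ln (S + Q y - 2 * polar w y)"
        by (simp add: f_def Q_diff S_def add.assoc diff_add_eq add_diff_eq)
      also have "\<dots> \<le> ln S + 1 / S * (Q y - 2 * polar w y) + (- 2 / S\<^sup>2) * (polar w y)\<^sup>2 + 11 * S powr (- p) * Q y powr p"
        by (intro ln_shift_bound hyps p)
      finally show "f (lindley_step w y) \<le> f w + 1 / S * (Q y - 2 * polar w y) + (- 2 / S\<^sup>2) * (polar w y)\<^sup>2
          + 11 * S powr (- p) * Q y powr p"
        by (simp only: f_def S_def)
    next
      have pS: "S powr (- p) = 1 / S * S powr (1 - p)"
        using S powr_diff[of S "1 - p" 1] by simp
      have h1: "11 * mean_Q_powr * S powr (1 - p) \<le> h S" "2 * mom i i * (1 + \<kappa> * K\<^sup>2) / S + 4 * \<kappa> * K * c * S powr (- (1 / 2)) + 11 * mean_Q_powr * S powr (1 - p) \<le> h S"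
      proof -
        have "0 \<le> 2 * mom i i * (1 + \<kappa> * K\<^sup>2) / S" "0 \<le> 4 * \<kappa> * K * c * S powr (- (1 / 2))"
          using var \<kappa> K0 S by (auto simp: c_def)
        then show "11 * mean_Q_powr * S powr (1 - p) \<le> h S"
          unfolding h_def by linarith
      qed (simp add: h_def)
      have "mean_Q - 2 * (\<kappa> * w $ j * mean j) - 2 * mean_polar_sq w / S + 11 * mean_Q_powr * S powr (1 - p) \<le> 0"
      proof (cases "K \<le> w $ j")
        case True
        have "2 * \<kappa> * mean j * K \<le> 2 * \<kappa> * mean j * w $ j"
          using True \<kappa> mean by (intro mult_left_mono) auto
        then have "mean_Q - 2 * (\<kappa> * w $ j * mean j) \<le> - 1" using K by (simp add: algebra_simps)
        moreover have "0 \<le> 2 * mean_polar_sq w / S" using mB0[of w] S by simp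
        ultimately show ?thesis using S0(2)[OF S(1)] h1(1) by simp
      next
        case False
        have Sw: "(w $ i)\<^sup>2 = S - 1 - \<kappa> * (w $ j)\<^sup>2"
          by (simp add: S_def Q_def)
        have "(w $ j)\<^sup>2 \<le> K\<^sup>2" using False w0 by (intro power_mono) auto
        then have "\<kappa> * (w $ j)\<^sup>2 \<le> \<kappa> * K\<^sup>2" using \<kappa> by (intro mult_left_mono) auto
        then have "S - (1 + \<kappa> * K\<^sup>2) \<le> (w $ i)\<^sup>2" unfolding Sw by simp
        then have 1: "(S - (1 + \<kappa> * K\<^sup>2)) * mom i i \<le> (w $ i)\<^sup>2 * mom i i"
          using var by (intro mult_right_mono) auto
        have "w $ i \<le> sqrt S"
        proof (rule real_le_rsqrt)
          have "0 \<le> \<kappa> * (w $ j)\<^sup>2" using \<kappa> by simp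
          then show "(w $ i)\<^sup>2 \<le> S" unfolding Sw by linarith
        qed
        then have "w $ i * w $ j * c \<le> sqrt S * K * c"
          using False w0 S by (intro mult_right_mono mult_mono) (auto simp: c_def)
        moreover have "\<bar>w $ i * w $ j * mom i j\<bar> = w $ i * w $ j * c"
          using w0 by (simp add: abs_mult c_def)
        ultimately have "- (sqrt S * K * c) \<le> w $ i * w $ j * mom i j" by linarith
        then have "2 * \<kappa> * (- (sqrt S * K * c)) \<le> 2 * \<kappa> * (w $ i * w $ j * mom i j)"
          using \<kappa> by (intro mult_left_mono) auto
        then have "- (2 * \<kappa> * (sqrt S * K * c)) \<le> 2 * \<kappa> * (w $ i * w $ j * mom i j)"
          by (simp only: mult_minus_right)
        moreover have "0 \<le> (\<kappa> * w $ j)\<^sup>2 * mom j j" using var by simp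
        moreover have mBw: "mean_polar_sq w = (w $ i)\<^sup>2 * mom i i + (\<kappa> * w $ j)\<^sup>2 * mom j j + 2 * \<kappa> * (w $ i * w $ j * mom i j)"
          by (simp add: mean_polar_sq mult.assoc)
        ultimately have "(S - (1 + \<kappa> * K\<^sup>2)) * mom i i - 2 * \<kappa> * (sqrt S * K * c) \<le> mean_polar_sq w"
          using 1 unfolding mBw by linarith
        then have "2 * ((S - (1 + \<kappa> * K\<^sup>2)) * mom i i - 2 * \<kappa> * (sqrt S * K * c)) / S \<le> 2 * mean_polar_sq w / S"
          using S by (intro divide_right_mono) auto
        moreover have "2 * ((S - (1 + \<kappa> * K\<^sup>2)) * mom i i - 2 * \<kappa> * (sqrt S * K * c)) / S
            = 2 * mom i i - 2 * mom i i * (1 + \<kappa> * K\<^sup>2) / S - 4 * \<kappa> * K * c * S powr (- (1 / 2))"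
        proof -
          have "sqrt S / S = S powr (- (1 / 2))"
            using S by (simp add: powr_minus_divide powr_half_sqrt real_div_sqrt divide_eq_eq)
          then have "4 * \<kappa> * K * c * S powr (- (1 / 2)) = 4 * \<kappa> * K * c * (sqrt S / S)" by simp
          then show ?thesis using S by (simp add: diff_divide_distrib add_divide_distrib algebra_simps)
        qed
        moreover have "0 \<le> 2 * (\<kappa> * w $ j * mean j)" using \<kappa> w0 mean by simp
        moreover have "h S < mom i i / 2" using S0(2)[OF S(1)] by simp
        moreover have "3 / 2 * m - N - B + E \<le> 0"
          if "V \<le> B" "V = 2 * m - A1 - A2" "0 \<le> N" "H < m / 2" "A1 + A2 + E \<le> H" for m N B E V A1 A2 H :: real
          using that by linarith
        ultimately show ?thesis
          unfolding mean_Q using h1(2) by blast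
      qed
      then have "1 / S * (mean_Q - 2 * (\<kappa> * w $ j * mean j) - 2 * mean_polar_sq w / S + 11 * mean_Q_powr * S powr (1 - p)) \<le> 0"
        using S by (simp add: mult_le_0_iff divide_nonpos_nonneg)
      then show "f w + 1 / S * (mean_Q - 2 * (\<integral>y. polar w y \<partial>\<mu>)) + (- 2 / S\<^sup>2) * mean_polar_sq w + 11 * S powr (- p) * mean_Q_powr \<le> f w"
        unfolding mbil pS by (simp add: algebra_simps power2_eq_square)
    qed
  qed (use S0 w bounded_Q_le in auto)
qed

text \<open>
  With \<open>S = 1 + Q w\<close>, the drift of \<open>S powr (- \<eta>)\<close> is, up to the error,
  \<open>- \<eta> * S powr (- \<eta> - 2) * (mean_Q * S - 2 * (\<eta> + 1) * mean_polar_sq w)\<close>. For the mixed coefficient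
  \<open>g = - mom i j / 2\<close> the bracket with \<open>\<eta> = 0\<close> is at least \<open>2 * g\<^sup>2 * Q w\<close> on the quadrant, where the
  product of the coordinates is nonnegative. Half of this remains for small \<open>\<eta>\<close>.
\<close>

lemma summable_returns_of_neg_correlation:
  assumes mean: "mean i = 0" "mean j = 0"
    and cov: "mom i j < 0" "(mom i j)\<^sup>2 < mom i i * mom j j"
  shows "(\<Sum>n. (T ^^ n) (indicator {0}) 0) < \<infinity>"
proof -
  define g where "g = - mom i j / 2"
  have g: "g > 0" "mom i j = - 2 * g" using cov by (auto simp: g_def)
  have pp: "mom i i * mom j j > 0" using cov by (meson le_less_trans zero_le_power2)
  then have pos: "mom i i > 0" "mom j j > 0"
    using mom_nonneg[of i] mom_nonneg[of j] by (auto simp: zero_less_mult_iff)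
  have g2: "4 * g\<^sup>2 < mom i i * mom j j"
    using cov(2) unfolding g(2) by (simp add: power_mult_distrib)
  interpret quadratic_chain \<mu> i j p "mom j j" "mom i i" g
    using pos g2 g(1) by unfold_locales (auto simp: mult.commute intro: order.strict_trans1[rotated])
  let ?a = "mom j j" and ?b = "mom i i"
  have mean_Q: "mean_Q = 2 * (mom i i * mom j j - 2 * g\<^sup>2)"
    by (simp add: mean_Q_def g(2) power2_eq_square algebra_simps)
  have g2': "g\<^sup>2 \<le> mom i i * mom j j" "2 * g\<^sup>2 < mom i i * mom j j"
    using g2 zero_le_power2[of g] by linarith+
  have mQ0: "mean_Q > 0" unfolding mean_Q using g2'(2) by simp
  have mbil: "(\<integral>y. polar w y \<partial>\<mu>) = 0" for w
    by (simp add: polar_integral mean)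
  have mean_polar_sq: "mean_polar_sq w \<le> mean_Q * Q w" for w
  proof -
    have "mean_polar_sq w \<le> (\<integral>y. Q w * Q y \<partial>\<mu>)"
      unfolding mean_polar_sq_def using polar_square_integrable Q_integrable polar_Cauchy by (intro integral_mono) auto
    then show ?thesis by (simp add: Q_integral mult.commute)
  qed
  have drift: "2 * g\<^sup>2 * Q w \<le> mean_Q * Q w - 2 * mean_polar_sq w" if w: "w \<in> quadrant" for w
  proof -
    have "mean_Q * Q w - 2 * mean_polar_sq w - 2 * g\<^sup>2 * Q w = 4 * g * (w $ i * w $ j) * (mom i i * mom j j - g\<^sup>2)"
      unfolding mean_Q mean_polar_sq_eq Q_def g(2) by (simp add: power2_eq_square algebra_simps)
    moreover have "0 \<le> 4 * g * (w $ i * w $ j) * (mom i i * mom j j - g\<^sup>2)"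
      using g w g2' by (intro mult_nonneg_nonneg) (auto simp: quadrant_def)
    ultimately show ?thesis by simp
  qed
  \<comment> \<open>reflection can only increase the form, unless the jump is comparable to the distance from the origin\<close>
  \<comment> \<open>if \<open>w $ j\<close> is at least \<open>H * norm y\<close>, the mixed term gained by the cut-off in coordinate \<open>i\<close> outweighs the square that is lost\<close>
  define H where "H = 1 + (?a + ?b) / (2 * g)"
  have H: "2 * g * (H - 1) = ?a + ?b" "H \<ge> 1" using g pos by (auto simp: H_def)
  have reflect: "Q (w - y) \<le> Q (lindley_step w y)"
    if w: "w \<in> quadrant" and big: "(1 + H\<^sup>2) * (norm y)\<^sup>2 \<le> (norm w)\<^sup>2" for w y
  proof -
    have w0: "0 \<le> w $ i" "0 \<le> w $ j" using w by (auto simp: quadrant_def)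
    have comp: "\<bar>y $ k\<bar> \<le> norm y" for k by (rule component_le_norm_cart)
    have key: "(H - 1) * norm y \<le> v'" if "v < x" "x \<le> norm y" "0 \<le> v" "v\<^sup>2 + u\<^sup>2 = (norm w)\<^sup>2" "0 \<le> u" "v' = u - z" "\<bar>z\<bar> \<le> norm y"
      for v x u z v'
    proof -
      have "v\<^sup>2 \<le> (norm y)\<^sup>2" using that by (intro power_mono) auto
      moreover have "(norm y)\<^sup>2 + (H * norm y)\<^sup>2 \<le> (norm w)\<^sup>2"
        using big by (simp add: power_mult_distrib distrib_right)
      ultimately have "(H * norm y)\<^sup>2 \<le> u\<^sup>2" using that by linarith
      then have "H * norm y \<le> u" using that by (rule_tac power2_le_imp_le)
      then show ?thesis using that by (simp add: algebra_simps)
    qed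
    have neg: "A * e\<^sup>2 + 2 * g * (- e * v') \<le> 0" if "0 \<le> e" "e \<le> norm y" "(H - 1) * norm y \<le> v'" "A \<le> ?a + ?b" "0 \<le> A" for A e v'
    proof -
      have "A * e \<le> (?a + ?b) * norm y" using that pos by (intro mult_mono) auto
      also have "\<dots> = 2 * g * ((H - 1) * norm y)" unfolding H(1)[symmetric] by simp
      also have "\<dots> \<le> 2 * g * v'" using g that by (intro mult_left_mono) auto
      finally have "e * (A * e) \<le> e * (2 * g * v')" using that by (intro mult_left_mono) auto
      then show ?thesis by (simp add: power2_eq_square algebra_simps)
    qed
    let ?u = "w $ i - y $ i" and ?v = "w $ j - y $ j"
    have nsq: "(w $ i)\<^sup>2 + (w $ j)\<^sup>2 = (norm w)\<^sup>2" "(w $ j)\<^sup>2 + (w $ i)\<^sup>2 = (norm w)\<^sup>2"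
      by (simp_all add: norm_sq)
    have yk: "y $ k \<le> norm y" for k using comp[of k] by linarith
    consider "?u \<ge> 0" "?v \<ge> 0" | "?u < 0" | "?v < 0" by linarith
    then show ?thesis
    proof cases
      case 2
      have v: "(H - 1) * norm y \<le> ?v"
        by (rule key[of "w $ i" "y $ i" "w $ j" _ "y $ j"]) (use 2 w0 nsq comp yk in auto)
      then have "0 \<le> ?v" using H(2) by (meson diff_ge_0_iff_ge mult_nonneg_nonneg norm_ge_zero order.trans)
      moreover have "?a * ?u\<^sup>2 + 2 * g * (?u * ?v) \<le> 0"
      proof (rule neg[of "- ?u" ?v ?a, unfolded power2_minus minus_minus])
        show "- ?u \<le> norm y" using w0 yk[of i] by linarith
      qed (use 2 v pos in auto)
      ultimately show ?thesis using 2 by (simp add: Q_def)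
    next
      case 3
      have v: "(H - 1) * norm y \<le> ?u"
        by (rule key[of "w $ j" "y $ j" "w $ i" _ "y $ i"]) (use 3 w0 nsq comp yk in auto)
      then have "0 \<le> ?u" using H(2) by (meson diff_ge_0_iff_ge mult_nonneg_nonneg norm_ge_zero order.trans)
      moreover have "?b * ?v\<^sup>2 + 2 * g * (?v * ?u) \<le> 0"
      proof (rule neg[of "- ?v" ?u ?b, unfolded power2_minus minus_minus])
        show "- ?v \<le> norm y" using w0 yk[of j] by linarith
      qed (use 3 v pos in auto)
      ultimately show ?thesis using 3 by (simp add: Q_def mult.commute[of ?u])
    qed (simp add: Q_def)
  qed
  define k where "k = (?a * ?b - g\<^sup>2) / (?a + ?b)"
  have k: "k > 0" "\<And>w. k * (norm w)\<^sup>2 \<le> Q w"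
    using Q_lower_pos Q_lower by (auto simp: k_def)
  \<comment> \<open>increments with \<open>Q y \<le> t0 * S\<close> are small in the sense of both \<open>reflect\<close> and the Taylor bound\<close>
  define t0 where "t0 = min (1 / 36) (k / (2 * (?a + ?b) * (1 + H\<^sup>2)))"
  have H2: "1 + H\<^sup>2 > 0" by (simp add: add_pos_nonneg)
  have t0: "0 < t0" "t0 \<le> 1" "t0 \<le> 1 / 36"
  proof -
    show *: "t0 \<le> 1 / 36" unfolding t0_def by (rule min.cobounded1)
    then show "t0 \<le> 1" by simp
    have "0 < k / (2 * (?a + ?b) * (1 + H\<^sup>2))"
      using k(1) pos H2 by (intro divide_pos_pos mult_pos_pos) auto
    then show "0 < t0" by (simp add: t0_def)
  qed
  have t0': "t0 * (2 * (?a + ?b) * (1 + H\<^sup>2)) \<le> k"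
  proof -
    have "t0 \<le> k / (2 * (?a + ?b) * (1 + H\<^sup>2))" by (simp add: t0_def)
    then show ?thesis using pos H2 by (simp add: pos_le_divide_eq)
  qed
  define \<eta> where "\<eta> = min ((p - 1) / 2) (g\<^sup>2 / (2 * mean_Q))"
  have \<eta>: "0 < \<eta>" "\<eta> \<le> 1" "1 + \<eta> - p < 0" "2 * \<eta> * mean_Q \<le> g\<^sup>2"
  proof -
    show "0 < \<eta>" using p g mQ0 by (simp add: \<eta>_def)
    have "\<eta> \<le> (p - 1) / 2" unfolding \<eta>_def by (rule min.cobounded1)
    then show "\<eta> \<le> 1" "1 + \<eta> - p < 0" using p by simp_all
    have "\<eta> \<le> g\<^sup>2 / (2 * mean_Q)" unfolding \<eta>_def by (rule min.cobounded2)
    then show "2 * \<eta> * mean_Q \<le> g\<^sup>2" using mQ0 by (simp add: pos_le_divide_eq mult.commute mult.left_commute)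
  qed
  define C where "C = 1000 + 2 * t0 powr (- p)"
  have C: "1000 \<le> C" "2 * t0 powr (- p) \<le> C" by (auto simp: C_def)
  have "((\<lambda>S. C * mean_Q_powr * S powr (1 + \<eta> - p)) \<longlongrightarrow> C * mean_Q_powr * 0) at_top"
    by (rule tendsto_mult[OF tendsto_const powr_tendsto_0[OF \<eta>(3)]])
  then have "((\<lambda>S. C * mean_Q_powr * S powr (1 + \<eta> - p)) \<longlongrightarrow> 0) at_top" by simp
  then have "eventually (\<lambda>S. C * mean_Q_powr * S powr (1 + \<eta> - p) < \<eta> * g\<^sup>2 / 2) at_top"
    using g \<eta> by (intro order_tendstoD) auto
  then obtain S0 where S0: "1 \<le> S0" "\<And>S. S0 \<le> S \<Longrightarrow> C * mean_Q_powr * S powr (1 + \<eta> - p) < \<eta> * g\<^sup>2 / 2"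
    using eventually_at_top_obtain by blast
  define f where "f w = (1 + Q w) powr (- \<eta>)" for w
  have f_mono: "f v' \<le> f v" if "Q v \<le> Q v'" for v v'
    unfolding f_def using that \<eta> by (intro powr_mono2') auto
  have f1: "f v \<le> 1" for v
    using f_mono[of 0 v] by (simp add: f_def)
  define b where "b = (1 + S0) powr (- \<eta>)"
  have b: "b > 0" using S0(1) by (simp add: b_def)
  have f_meas: "f \<in> borel_measurable borel"
    unfolding f_def[abs_def] by (rule one_plus_Q_measurable)
  obtain m where far: "(T ^^ m) (indicator {v. f v \<le> b / 2}) 0 \<noteq> 0"
  proof -
    \<comment> \<open>since \<open>f\<close> vanishes at infinity, a far point in direction \<open>i\<close> suffices\<close>
    have "eventually (\<lambda>S. S powr (- \<eta>) < b / 2) at_top"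
      using b \<eta> by (intro order_tendstoD[OF powr_tendsto_0]) auto
    then obtain S1 where S1: "1 \<le> S1" "\<And>S. S1 \<le> S \<Longrightarrow> S powr (- \<eta>) < b / 2"
      using eventually_at_top_obtain by blast
    define R where "R = sqrt (S1 / k)"
    obtain m where m: "(T ^^ m) (indicator {v. R \<le> v $ i}) 0 \<noteq> 0"
      using reach_far[of i R] integral_negative_part[OF mean(1) pos(1)] by blast
    have "(T ^^ m) (indicator {v. R \<le> v $ i}) 0 \<le> (T ^^ m) (indicator {v. f v \<le> b / 2}) 0"
    proof (rule T_iter_mono)
      fix v :: "real^2"
      have "f v \<le> b / 2" if "R \<le> v $ i"
      proof -
        have "R\<^sup>2 \<le> (v $ i)\<^sup>2"
          using that S1(1) k(1) by (intro power_mono) (auto simp: R_def)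
        moreover have "R\<^sup>2 = S1 / k" using S1(1) k(1) by (simp add: R_def)
        ultimately have "S1 / k \<le> (norm v)\<^sup>2"
          using zero_le_power2[of "v $ j"] unfolding norm_sq by linarith
        then have "S1 \<le> k * (norm v)\<^sup>2" using k(1) by (simp add: pos_divide_le_eq mult.commute)
        then have "S1 \<le> 1 + Q v" using k(2)[of v] by linarith
        from S1(2)[OF this] show ?thesis by (simp add: f_def)
      qed
      then show "indicator {v. R \<le> v $ i} v \<le> (indicator {v. f v \<le> b / 2} v :: ennreal)"
        by (auto simp: indicator_def)
    qed simp
    with m show ?thesis by (intro that[of m]) auto
  qed
  show ?thesis
  proof (rule summable_returns_Foster[OF f_meas _ _ b _ _ _ far, where B = "{w. Q w \<le> S0}"])
    show "0 \<le> f v" for v by (simp add: f_def)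
    show "b \<le> f v" if "v \<in> {w. Q w \<le> S0}" for v
      unfolding f_def b_def using that \<eta> by (intro powr_mono2') auto
    fix w :: "real^2" assume w: "w \<in> quadrant" and "w \<notin> {w. Q w \<le> S0}"
    define S where "S = 1 + Q w"
    have S: "S0 \<le> S" "1 \<le> S" "2 \<le> S" using \<open>w \<notin> _\<close> S0(1) by (auto simp: S_def)
    note hyps = shift_hyps(1)[of w, folded S_def] Q_nonneg shift_hyps(3,4)[of w, folded S_def]
    show "T (\<lambda>v. ennreal (f v)) w \<le> ennreal (f w)"
    proof (rule T_quadratic_bound[where ca = "f w" and cb = "- \<eta> * S powr (- \<eta> - 1)"
          and cc = "2 * \<eta> * (\<eta> + 1) * S powr (- \<eta> - 2)" and cd = "C * S powr (- p)"])
      show "0 \<le> f v" for v by (simp add: f_def)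
      fix y
      let ?E = "S powr (- p) * Q y powr p"
      let ?M = "S powr (- \<eta>) + (- \<eta> * S powr (- \<eta> - 1)) * (Q y - 2 * polar w y)
          + 2 * \<eta> * (\<eta> + 1) * S powr (- \<eta> - 2) * (polar w y)\<^sup>2"
      have E0: "0 \<le> ?E" by simp
      have "f (lindley_step w y) \<le> ?M + C * ?E"
      proof (cases "Q y \<le> t0 * S")
        case True
        have "(1 + H\<^sup>2) * (norm y)\<^sup>2 \<le> (norm w)\<^sup>2"
        proof -
          have "k * (norm y)\<^sup>2 \<le> t0 * S" using k(2)[of y] True by linarith
          also have "t0 * S \<le> t0 * (2 * ((?a + ?b) * (norm w)\<^sup>2))"
            using Q_upper[of w] S t0 by (intro mult_left_mono) (auto simp: S_def)
          finally have "(1 + H\<^sup>2) * (k * (norm y)\<^sup>2) \<le> (1 + H\<^sup>2) * (t0 * (2 * ((?a + ?b) * (norm w)\<^sup>2)))"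
            using H2 by (intro mult_left_mono) auto
          also have "\<dots> = t0 * (2 * (?a + ?b) * (1 + H\<^sup>2)) * (norm w)\<^sup>2" by (simp only: mult_ac)
          also have "\<dots> \<le> k * (norm w)\<^sup>2" using t0' by (intro mult_right_mono) auto
          finally have "k * ((1 + H\<^sup>2) * (norm y)\<^sup>2) \<le> k * (norm w)\<^sup>2" by (simp only: mult_ac)
          then show ?thesis using k(1) by (simp only: mult_le_cancel_left_pos)
        qed
        then have "f (lindley_step w y) \<le> f (w - y)"
          by (intro f_mono reflect w)
        also have "f (w - y) = (S + Q y - 2 * polar w y) powr (- \<eta>)"
          by (simp add: f_def Q_diff S_def add.assoc diff_add_eq add_diff_eq)
        also have "\<dots> \<le> ?M + 1000 * S powr (- p) * Q y powr p"
        proof (rule powr_shift_bound[OF hyps p \<eta>(1,2)])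
          have "t0 * S \<le> 1 / 36 * S" using t0 S by (intro mult_right_mono) auto
          with True show "Q y \<le> S / 36" by simp
        qed
        also have "\<dots> \<le> ?M + C * ?E"
          using mult_right_mono[OF C(1) E0] by (simp add: mult.assoc)
        finally show ?thesis .
      next
        case False
        have "f (lindley_step w y) \<le> 1" by (rule f1)
        also have "\<dots> \<le> ?M + 2 * t0 powr (- p) * S powr (- p) * Q y powr p"
          by (rule one_le_far[OF hyps p \<eta>(1,2) t0(1,2)]) (use False in simp)
        also have "\<dots> \<le> ?M + C * ?E"
          using mult_right_mono[OF C(2) E0] by (simp add: mult.assoc)
        finally show ?thesis .
      qed
      then show "f (lindley_step w y) \<le> f w + (- \<eta> * S powr (- \<eta> - 1)) * (Q y - 2 * polar w y)
          + 2 * \<eta> * (\<eta> + 1) * S powr (- \<eta> - 2) * (polar w y)\<^sup>2 + C * S powr (- p) * Q y powr p"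
        by (simp only: f_def S_def mult.assoc)
    next
      define R where "R = S powr (- \<eta> - 2)"
      have R: "R > 0" "S powr (- \<eta> - 1) = R * S" "S powr (- p) = R * (S * S powr (1 + \<eta> - p))"
      proof -
        show "R > 0" using S by (simp add: R_def)
        show "S powr (- \<eta> - 1) = R * S"
          unfolding R_def by (rule powr_one_step) fact
        have "R * S * S powr (1 + \<eta> - p) = S powr (- \<eta> - 1) * S powr (1 + \<eta> - p)"
          unfolding R_def by (subst powr_one_step[of S "- \<eta>"]) (use S in auto)
        also have "\<dots> = S powr (- p)" by (simp flip: powr_add)
        finally show "S powr (- p) = R * (S * S powr (1 + \<eta> - p))" by (simp add: mult.assoc)
      qed
      have "\<eta> * (2 * g\<^sup>2 * Q w) \<le> \<eta> * (mean_Q * Q w - 2 * mean_polar_sq w)"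
        using \<eta> drift[OF w] by (intro mult_left_mono) auto
      moreover have "\<eta> * (2 * \<eta> * mean_polar_sq w) \<le> \<eta> * (g\<^sup>2 * Q w)"
      proof -
        have "2 * \<eta> * mean_polar_sq w \<le> 2 * \<eta> * (mean_Q * Q w)" using \<eta> mean_polar_sq by (intro mult_left_mono) auto
        also have "\<dots> = (2 * \<eta> * mean_Q) * Q w" by simp
        also have "\<dots> \<le> g\<^sup>2 * Q w" using \<eta> by (intro mult_right_mono) auto
        finally show ?thesis using \<eta> by (intro mult_left_mono) auto
      qed
      moreover have "S * (C * mean_Q_powr * S powr (1 + \<eta> - p)) \<le> S * (\<eta> * g\<^sup>2 / 2)"
        using S0(2)[OF S(1)] S by (intro mult_left_mono) auto
      moreover have "S * (\<eta> * g\<^sup>2 / 2) \<le> \<eta> * (g\<^sup>2 * Q w)"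
      proof -
        have "(\<eta> * g\<^sup>2) * (S / 2) \<le> (\<eta> * g\<^sup>2) * Q w"
          using \<eta> S by (intro mult_left_mono) (auto simp: S_def)
        then show ?thesis by (simp add: mult_ac)
      qed
      moreover have "0 \<le> \<eta> * mean_Q" using \<eta> mQ0 by simp
      ultimately have "- \<eta> * mean_Q * (1 + Q w) + 2 * \<eta> * (\<eta> + 1) * mean_polar_sq w + S * (C * mean_Q_powr * S powr (1 + \<eta> - p)) \<le> 0"
        by (simp add: algebra_simps)
      then have "R * (- \<eta> * mean_Q * (1 + Q w) + 2 * \<eta> * (\<eta> + 1) * mean_polar_sq w + S * (C * mean_Q_powr * S powr (1 + \<eta> - p))) \<le> 0"
        using R(1) by (intro mult_nonneg_nonpos) auto
      then show "f w + (- \<eta> * S powr (- \<eta> - 1)) * (mean_Q - 2 * (\<integral>y. polar w y \<partial>\<mu>))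
          + 2 * \<eta> * (\<eta> + 1) * S powr (- \<eta> - 2) * mean_polar_sq w + C * S powr (- p) * mean_Q_powr \<le> f w"
        unfolding mbil R(2,3) R_def[symmetric] S_def[symmetric] by (simp add: algebra_simps)
    qed
  qed (use S0 in auto)
qed

end

section \<open>Random walks with a drift\<close>

context lindley_chain
begin

definition shift :: "(nat \<Rightarrow> real^2) \<Rightarrow> nat \<Rightarrow> real^2" where
  "shift \<omega> n = \<omega> (Suc n)"

lemma shift_case_nat [simp]: "shift (case_nat y \<omega>) = \<omega>"
  by (simp add: shift_def fun_eq_iff)

lemma measurable_shift [measurable]: "shift \<in> measurable S S"
proof -
  have "(\<lambda>\<omega>. \<lambda>n\<in>UNIV. \<omega> (Suc n)) \<in> measurable S S"
    by (intro measurable_restrict measurable_component_singleton) auto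
  then show ?thesis by (simp add: shift_def[abs_def] restrict_UNIV)
qed

lemma distr_shift: "distr S S shift = S"
proof -
  have "distr S (\<Pi>\<^sub>M i\<in>UNIV. \<mu>) (\<lambda>\<omega>. \<lambda>n\<in>UNIV. \<omega> (Suc n)) = S"
    by (rule distr_PiM_reindex) (auto intro: M.prob_space_axioms)
  then show ?thesis by (simp add: shift_def[abs_def] restrict_UNIV)
qed

lemma integrable_shift:
  fixes f :: "(nat \<Rightarrow> real^2) \<Rightarrow> real"
  assumes "integrable S f"
  shows "integrable S (\<lambda>\<omega>. f (shift \<omega>))"
  using assms integrable_distr_eq[OF measurable_shift, of f] by (simp add: distr_shift)

lemma integral_shift:
  fixes f :: "(nat \<Rightarrow> real^2) \<Rightarrow> real"
  shows "f \<in> borel_measurable S \<Longrightarrow> (\<integral>\<omega>. f (shift \<omega>) \<partial>S) = (\<integral>\<omega>. f \<omega> \<partial>S)"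
  using integral_distr[OF measurable_shift, of f] by (simp add: distr_shift)

text \<open>
  The maximum of \<open>0\<close> and the first \<open>n\<close> partial sums, by decomposition at the first step.
\<close>

primrec running_max :: "(real^2 \<Rightarrow> real) \<Rightarrow> nat \<Rightarrow> (nat \<Rightarrow> real^2) \<Rightarrow> real" where
  "running_max Y 0 \<omega> = 0"
| "running_max Y (Suc n) \<omega> = max 0 (Y (\<omega> 0) + running_max Y n (shift \<omega>))"

lemma running_max_nonneg: "0 \<le> running_max Y n \<omega>"
  by (cases n) auto

lemma running_max_mono: "running_max Y n \<omega> \<le> running_max Y (Suc n) \<omega>"
proof (induction n arbitrary: \<omega>)
  case (Suc n)
  from Suc[of "shift \<omega>"] show ?case
    unfolding running_max.simps(2)[of Y _ \<omega>] by (intro max.mono add_left_mono) auto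
qed simp

lemma partial_sum_le_running_max: "(\<Sum>k<n. Y (\<omega> k)) \<le> running_max Y n \<omega>"
proof (induction n arbitrary: \<omega>)
  case (Suc n)
  have "(\<Sum>k<Suc n. Y (\<omega> k)) = Y (\<omega> 0) + (\<Sum>k<n. Y (shift \<omega> k))"
    unfolding sum.lessThan_Suc_shift shift_def by simp
  with Suc[of "shift \<omega>"] show ?case by simp
qed simp

text \<open>
  Maximal ergodic argument. Let \<open>E\<close> be the event that the running maxima \<open>M n\<close> are unbounded. It is
  invariant under the shift, and so the increase of the expectation of \<open>M n\<close> on \<open>E\<close> reads
  \<open>0 \<le> \<integral>\<^sub>E max (- M n (shift \<omega>)) (Y (\<omega> 0))\<close>. On \<open>E\<close> the integrand tends to \<open>Y (\<omega> 0)\<close>, and \<open>E\<close> is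
  independent of \<open>\<omega> 0\<close>. Thus \<open>0 \<le> P E * E Y\<close>, which forces \<open>P E = 0\<close>.
\<close>

lemma bounded_partial_sums:
  fixes Y :: "real^2 \<Rightarrow> real"
  assumes [measurable]: "Y \<in> borel_measurable borel" and int: "integrable \<mu> Y" and neg: "(\<integral>y. Y y \<partial>\<mu>) < 0"
  shows "AE \<omega> in S. \<exists>c. \<forall>n. (\<Sum>k<n. Y (\<omega> k)) \<le> c"
proof -
  let ?M = "running_max Y"
  define E where "E = {\<omega>. \<forall>c::nat. \<exists>n. real c < ?M n \<omega>}"
  have M_meas [measurable]: "?M n \<in> borel_measurable S" for n
    by (induction n) simp_all
  have E_meas [measurable]: "E \<in> sets S"
  proof -
    have "{\<omega> \<in> space S. \<forall>c::nat. \<exists>n. real c < ?M n \<omega>} \<in> sets S" by measurable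
    then show ?thesis by (simp add: E_def)
  qed
  have inv: "shift \<omega> \<in> E \<longleftrightarrow> \<omega> \<in> E" for \<omega>
  proof
    assume *: "shift \<omega> \<in> E"
    show "\<omega> \<in> E"
      unfolding E_def
    proof safe
      fix c :: nat
      obtain d :: nat where "real c - Y (\<omega> 0) \<le> real d" using real_arch_simple by blast
      moreover obtain n where "real d < ?M n (shift \<omega>)" using * by (auto simp: E_def)
      ultimately have "real c < ?M (Suc n) \<omega>" by simp
      then show "\<exists>n. real c < ?M n \<omega>" ..
    qed
  next
    assume *: "\<omega> \<in> E"
    show "shift \<omega> \<in> E"
      unfolding E_def
    proof safe
      fix c :: nat
      obtain d :: nat where d: "real c + Y (\<omega> 0) \<le> real d" using real_arch_simple by blast
      obtain n where n: "real d < ?M n \<omega>" using * by (auto simp: E_def)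
      then obtain m where "n = Suc m" by (cases n) auto
      with n have "real d < Y (\<omega> 0) + ?M m (shift \<omega>)" by (auto simp: less_max_iff_disj)
      with d have "real c < ?M m (shift \<omega>)" by linarith
      then show "\<exists>n. real c < ?M n (shift \<omega>)" ..
    qed
  qed
  have distr0: "distr S \<mu> (\<lambda>\<omega>. \<omega> 0) = \<mu>"
    by (rule PiM_component) (auto intro: M.prob_space_axioms)
  have int0: "integrable S (\<lambda>\<omega>. Y (\<omega> 0))"
    using integrable_distr_eq[of "\<lambda>\<omega>. \<omega> 0" S \<mu> Y] int by (simp add: distr0 measurable_component_singleton)
  have M_int: "integrable S (?M n)" for n
  proof (induction n)
    case (Suc n)
    then show ?case
      using int0 integrable_shift[OF Suc] by (simp add: integrable_max)
  qed simp
  let ?I = "indicator E :: (nat \<Rightarrow> real^2) \<Rightarrow> real"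
  let ?g = "\<lambda>n \<omega>. ?I \<omega> * max (- ?M n (shift \<omega>)) (Y (\<omega> 0))"
  have I_shift: "?I (shift \<omega>) = ?I \<omega>" for \<omega>
    by (simp add: indicator_def inv)
  have g_nonneg: "0 \<le> (\<integral>\<omega>. ?g n \<omega> \<partial>S)" for n
  proof -
    have i1: "integrable S (\<lambda>\<omega>. ?I \<omega> * ?M n \<omega>)" for n
      using integrable_mult_indicator[OF E_meas M_int[of n]] by simp
    have i2: "integrable S (\<lambda>\<omega>. ?I \<omega> * ?M n (shift \<omega>))"
      using integrable_shift[OF i1[of n]] by (simp add: I_shift)
    have "?g n = (\<lambda>\<omega>. ?I \<omega> * ?M (Suc n) \<omega> - ?I \<omega> * ?M n (shift \<omega>))"
      by (auto simp: fun_eq_iff max_def algebra_simps)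
    then have "(\<integral>\<omega>. ?g n \<omega> \<partial>S) = (\<integral>\<omega>. ?I \<omega> * ?M (Suc n) \<omega> \<partial>S) - (\<integral>\<omega>. ?I \<omega> * ?M n (shift \<omega>) \<partial>S)"
      using i1[of "Suc n"] i2 by (simp only: Bochner_Integration.integral_diff)
    also have "(\<integral>\<omega>. ?I \<omega> * ?M n (shift \<omega>) \<partial>S) = (\<integral>\<omega>. ?I (shift \<omega>) * ?M n (shift \<omega>) \<partial>S)"
      by (simp add: I_shift)
    also have "\<dots> = (\<integral>\<omega>. ?I \<omega> * ?M n \<omega> \<partial>S)"
      by (rule integral_shift) measurable
    finally have eq: "(\<integral>\<omega>. ?g n \<omega> \<partial>S) = (\<integral>\<omega>. ?I \<omega> * ?M (Suc n) \<omega> \<partial>S) - (\<integral>\<omega>. ?I \<omega> * ?M n \<omega> \<partial>S)" .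
    have "(\<integral>\<omega>. ?I \<omega> * ?M n \<omega> \<partial>S) \<le> (\<integral>\<omega>. ?I \<omega> * ?M (Suc n) \<omega> \<partial>S)"
      by (intro integral_mono i1 mult_left_mono running_max_mono) auto
    with eq show ?thesis by simp
  qed
  have lim: "(\<lambda>n. \<integral>\<omega>. ?g n \<omega> \<partial>S) \<longlonglongrightarrow> (\<integral>\<omega>. ?I \<omega> * Y (\<omega> 0) \<partial>S)"
  proof (rule integral_dominated_convergence[where w = "\<lambda>\<omega>. \<bar>Y (\<omega> 0)\<bar>"])
    show "AE \<omega> in S. (\<lambda>n. ?g n \<omega>) \<longlonglongrightarrow> ?I \<omega> * Y (\<omega> 0)"
    proof (rule AE_I2)
      fix \<omega>
      show "(\<lambda>n. ?g n \<omega>) \<longlonglongrightarrow> ?I \<omega> * Y (\<omega> 0)"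
      proof (cases "\<omega> \<in> E")
        case True
        then have "shift \<omega> \<in> E" by (simp add: inv)
        moreover obtain c :: nat where c: "- Y (\<omega> 0) \<le> real c" using real_arch_simple by blast
        ultimately obtain N where N: "real c < ?M N (shift \<omega>)" by (auto simp: E_def)
        have "?M N (shift \<omega>) \<le> ?M n (shift \<omega>)" if "N \<le> n" for n
          using that lift_Suc_mono_le[of "\<lambda>n. ?M n (shift \<omega>)", OF running_max_mono] by blast
        then have "eventually (\<lambda>n. ?g n \<omega> = ?I \<omega> * Y (\<omega> 0)) sequentially"
          using c N by (intro eventually_sequentiallyI[of N]) (force simp: max_def)
        then show ?thesis by (rule tendsto_eventually)
      qed simp
    qed
    show "AE \<omega> in S. norm (?g n \<omega>) \<le> \<bar>Y (\<omega> 0)\<bar>" for n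
    proof (rule AE_I2)
      fix \<omega>
      have "0 \<le> ?M n (shift \<omega>)" by (rule running_max_nonneg)
      then show "norm (?g n \<omega>) \<le> \<bar>Y (\<omega> 0)\<bar>"
        by (auto simp: indicator_def max_def)
    qed
  qed (use int0 in \<open>auto\<close>)
  have "0 \<le> (\<integral>\<omega>. ?I \<omega> * Y (\<omega> 0) \<partial>S)"
    using g_nonneg by (intro LIMSEQ_le_const[OF lim]) auto
  also have "(\<integral>\<omega>. ?I \<omega> * Y (\<omega> 0) \<partial>S) = P.prob E * (\<integral>y. Y y \<partial>\<mu>)"
  proof -
    interpret pair: pair_sigma_finite \<mu> S ..
    note m = measurable_case_nat_S[unfolded split_beta'] and iter = PiM_iter[unfolded split_beta']
    have *: "?I (case_nat y \<omega>) = ?I \<omega>" for y \<omega>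
      using I_shift[of "case_nat y \<omega>"] by simp
    have int': "integrable S (\<lambda>\<omega>. ?I \<omega> * Y (\<omega> 0))"
      using integrable_mult_indicator[OF E_meas int0] by simp
    have int'': "integrable (\<mu> \<Otimes>\<^sub>M S) (\<lambda>p. ?I (snd p) * Y (fst p))"
      using integrable_distr[OF m, of "\<lambda>\<omega>. ?I \<omega> * Y (\<omega> 0)"] int'
      by (simp add: iter *)
    have "(\<integral>\<omega>. ?I \<omega> * Y (\<omega> 0) \<partial>S) = (\<integral>p. ?I (snd p) * Y (fst p) \<partial>(\<mu> \<Otimes>\<^sub>M S))"
      using integral_distr[OF m, of "\<lambda>\<omega>. ?I \<omega> * Y (\<omega> 0)"] int'
      by (simp add: iter *)
    also have "\<dots> = (\<integral>y. (\<integral>\<omega>. ?I \<omega> * Y y \<partial>S) \<partial>\<mu>)"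
      using pair.integral_fst'[OF int''] by simp
    also have "\<dots> = P.prob E * (\<integral>y. Y y \<partial>\<mu>)"
      by simp
    finally show ?thesis .
  qed
  finally have "P.prob E = 0"
    using neg by (metis measure_nonneg mult_pos_neg not_le order_le_less)
  then have "AE \<omega> in S. \<omega> \<notin> E"
    by (subst (asm) P.prob_eq_0) auto
  then show ?thesis
  proof eventually_elim
    case (elim \<omega>)
    then obtain c :: nat where "\<And>n. ?M n \<omega> \<le> real c" by (auto simp: E_def not_less)
    then show ?case using partial_sum_le_running_max[of Y \<omega>] by (meson order.trans)
  qed
qed

text \<open>
  The truncation of \<open>g\<close> at a large level is integrable and still has positive mean \<open>m\<close>. By
  \<open>bounded_partial_sums\<close> for \<open>m / 2\<close> minus the truncation, the partial sums grow at least linearly.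
\<close>

lemma partial_sums_at_top:
  assumes [measurable]: "g \<in> borel_measurable borel"
    and drift: "nn_expectation \<mu> (\<lambda>y. neg_part (g y)) < nn_expectation \<mu> (\<lambda>y. pos_part (g y))"
  shows "AE \<omega> in S. filterlim (\<lambda>n. \<Sum>k<n. g (\<omega> k)) at_top sequentially"
proof -
  have [measurable]: "(\<lambda>y. pos_part (g y)) \<in> borel_measurable borel" "(\<lambda>y. neg_part (g y)) \<in> borel_measurable borel"
    unfolding pos_part_def neg_part_def by measurable
  have "nn_expectation \<mu> (\<lambda>y. pos_part (g y)) = (SUP K::nat. \<integral>\<^sup>+ y. ennreal (min (pos_part (g y)) (real K)) \<partial>\<mu>)"
  proof -
    have "ennreal (pos_part (g y)) = (SUP K::nat. ennreal (min (pos_part (g y)) (real K)))" for y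
    proof (rule antisym)
      obtain K :: nat where "pos_part (g y) \<le> real K" using real_arch_simple by blast
      then show "ennreal (pos_part (g y)) \<le> (SUP K::nat. ennreal (min (pos_part (g y)) (real K)))"
        by (intro SUP_upper2[of K]) auto
    qed (auto intro!: SUP_least ennreal_leI)
    then show ?thesis
      unfolding nn_expectation_def
      by (simp only:) (intro nn_integral_monotone_convergence_SUP,
        auto simp: incseq_def le_fun_def borel_measurable_law intro!: ennreal_leI)
  qed
  with drift obtain K :: nat where K: "nn_expectation \<mu> (\<lambda>y. neg_part (g y)) < (\<integral>\<^sup>+ y. ennreal (min (pos_part (g y)) (real K)) \<partial>\<mu>)"
    by (auto simp: less_SUP_iff)
  let ?Y = "\<lambda>y. min (g y) (real K)"
  have int_neg: "integrable \<mu> (\<lambda>y. neg_part (g y))"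
    using K by (intro integrableI_nonneg) (auto simp: nn_expectation_def neg_part_def borel_measurable_law intro: order.strict_trans2)
  have int_pos: "integrable \<mu> (\<lambda>y. min (pos_part (g y)) (real K))"
    by (rule M.integrable_const_bound[of _ "real K"]) (auto simp: pos_part_def borel_measurable_law)
  have split: "?Y = (\<lambda>y. min (pos_part (g y)) (real K) - neg_part (g y))"
    by (auto simp: fun_eq_iff pos_part_def neg_part_def)
  have int: "integrable \<mu> ?Y"
    unfolding split using int_neg int_pos by simp
  define m where "m = (\<integral>y. ?Y y \<partial>\<mu>)"
  have "ennreal (\<integral>y. neg_part (g y) \<partial>\<mu>) < ennreal (\<integral>y. min (pos_part (g y)) (real K) \<partial>\<mu>)"
    using K unfolding nn_expectation_def
    by (subst (asm) (1 2) nn_integral_eq_integral) (use int_neg int_pos in \<open>auto simp: pos_part_def neg_part_def\<close>)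
  then have "(\<integral>y. neg_part (g y) \<partial>\<mu>) < (\<integral>y. min (pos_part (g y)) (real K) \<partial>\<mu>)"
    by (subst (asm) ennreal_less_iff) (auto simp: neg_part_def)
  then have m: "m > 0"
    unfolding m_def split using int_neg int_pos by simp
  have "AE \<omega> in S. \<exists>c. \<forall>n. (\<Sum>k<n. m / 2 - ?Y (\<omega> k)) \<le> c"
    by (rule bounded_partial_sums) (use int m in \<open>auto simp: m_def[symmetric] M.prob_space[simplified]\<close>)
  then show ?thesis
  proof eventually_elim
    case (elim \<omega>)
    then obtain c where c: "\<And>n. (\<Sum>k<n. m / 2 - ?Y (\<omega> k)) \<le> c" by blast
    have lower: "m / 2 * real n - c \<le> (\<Sum>k<n. g (\<omega> k))" for n
    proof -
      have "(\<Sum>k<n. m / 2 - ?Y (\<omega> k)) = real n * (m / 2) - (\<Sum>k<n. ?Y (\<omega> k))"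
        by (simp add: sum_subtractf)
      moreover have "(\<Sum>k<n. ?Y (\<omega> k)) \<le> (\<Sum>k<n. g (\<omega> k))"
        by (intro sum_mono) simp
      ultimately show ?thesis using c[of n] by (simp add: mult.commute)
    qed
    have "filterlim (\<lambda>n. - c + m / 2 * real n) at_top sequentially"
      using m by (intro filterlim_tendsto_add_at_top[OF tendsto_const]
          filterlim_tendsto_pos_mult_at_top[OF tendsto_const _ filterlim_real_sequentially]) auto
    then show ?case
      by (rule filterlim_at_top_mono) (use lower in \<open>auto simp: algebra_simps\<close>)
  qed
qed

lemma path_lower_bound: "x $ i - (\<Sum>k<n. \<omega> k $ i) \<le> path x \<omega> n $ i"
  by (induction n) (auto simp: path_Suc)

lemma AE_path_escapes:
  assumes "nn_expectation \<mu> (\<lambda>y. pos_part (y $ i)) < nn_expectation \<mu> (\<lambda>y. neg_part (y $ i))"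
  shows "AE \<omega> in S. filterlim (\<lambda>n. norm (path x \<omega> n)) at_top sequentially"
proof -
  have "AE \<omega> in S. filterlim (\<lambda>n. \<Sum>k<n. - \<omega> k $ i) at_top sequentially"
    by (rule partial_sums_at_top) (use assms in \<open>simp_all add: pos_part_def neg_part_def\<close>)
  then show ?thesis
  proof eventually_elim
    case (elim \<omega>)
    have "filterlim (\<lambda>n. x $ i + (\<Sum>k<n. - \<omega> k $ i)) at_top sequentially"
      by (rule filterlim_tendsto_add_at_top[OF tendsto_const elim])
    then show ?case
    proof (rule filterlim_at_top_mono, intro always_eventually allI)
      fix n
      have "x $ i + (\<Sum>k<n. - \<omega> k $ i) \<le> path x \<omega> n $ i"
        using path_lower_bound[of x i \<omega> n] by (simp add: sum_negf)
      also have "\<dots> \<le> norm (path x \<omega> n)"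
        using component_le_norm_cart[of "path x \<omega> n" i] by linarith
      finally show "x $ i + (\<Sum>k<n. - \<omega> k $ i) \<le> norm (path x \<omega> n)" .
    qed
  qed
qed

text \<open>
  The iterate in which the increments are applied in reversed order. For fixed \<open>n\<close> it has the same law
  as \<open>path\<close>, but it is controlled by the partial sums from time \<open>0\<close> on.
\<close>

primrec backward :: "real^2 \<Rightarrow> nat \<Rightarrow> (nat \<Rightarrow> real^2) \<Rightarrow> real^2" where
  "backward x 0 \<omega> = x"
| "backward x (Suc n) \<omega> = lindley_step (backward x n (shift \<omega>)) (\<omega> 0)"

lemma backward_measurable [measurable]: "backward x n \<in> borel_measurable S"
  by (induction n) simp_all

lemma backward_law:
  "\<phi> \<in> borel_measurable borel \<Longrightarrow> (\<integral>\<^sup>+ \<omega>. \<phi> (backward x n \<omega>) \<partial>S) = (T ^^ n) \<phi> x"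
proof (induction n arbitrary: \<phi>)
  case 0
  then show ?case using P.emeasure_space_1 by simp
next
  case (Suc n)
  note [measurable] = Suc.prems
  interpret pair: pair_sigma_finite \<mu> S ..
  have "(\<integral>\<^sup>+ \<omega>. \<phi> (backward x (Suc n) \<omega>) \<partial>S)
      = (\<integral>\<^sup>+ y. (\<integral>\<^sup>+ \<omega>. \<phi> (lindley_step (backward x n \<omega>) y) \<partial>S) \<partial>\<mu>)"
    by (subst nn_integral_S_first_step) simp_all
  also have "\<dots> = (\<integral>\<^sup>+ \<omega>. T \<phi> (backward x n \<omega>) \<partial>S)"
    unfolding T_def
    using pair.Fubini[of "\<lambda>p. \<phi> (lindley_step (backward x n (snd p)) (fst p))"] by simp
  also have "\<dots> = (T ^^ n) (T \<phi>) x"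
    by (rule Suc.IH) simp
  finally show ?case by (simp add: funpow_swap1)
qed

lemma backward_le:
  assumes "0 \<le> a" "\<And>k. k \<le> n \<Longrightarrow> - a \<le> (\<Sum>l<k. \<omega> l $ i)" "x $ i - (\<Sum>l<n. \<omega> l $ i) \<le> a"
  shows "backward x n \<omega> $ i \<le> a"
  using assms
proof (induction n arbitrary: \<omega> a)
  case (Suc n)
  have split: "(\<Sum>l<Suc k. \<omega> l $ i) = \<omega> 0 $ i + (\<Sum>l<k. shift \<omega> l $ i)" for k
    unfolding sum.lessThan_Suc_shift shift_def by simp
  have "backward x n (shift \<omega>) $ i \<le> a + \<omega> 0 $ i"
  proof (rule Suc.IH)
    show "0 \<le> a + \<omega> 0 $ i" using Suc.prems(2)[of 1] by simp
    show "- (a + \<omega> 0 $ i) \<le> (\<Sum>l<k. shift \<omega> l $ i)" if "k \<le> n" for k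
      using Suc.prems(2)[of "Suc k"] that unfolding split by simp
    show "x $ i - (\<Sum>l<n. shift \<omega> l $ i) \<le> a + \<omega> 0 $ i"
      using Suc.prems(3) unfolding split by simp
  qed
  then show ?case using Suc.prems(1) by simp
qed simp

lemma partial_sum_measurable [measurable]: "(\<lambda>\<omega>. \<Sum>l<k. \<omega> l $ i) \<in> borel_measurable S"
proof (rule borel_measurable_sum)
  fix l
  show "(\<lambda>\<omega>. \<omega> l $ i) \<in> borel_measurable S"
    by (rule measurable_compose[OF component_measurable]) measurable
qed

text \<open>
  The backward iterate is at the origin if all partial sums are nonnegative and the last one dominates
  the starting point. The second condition holds eventually. The first one has positive probability:
  the partial sums are bounded below by some random constant, and finitely many initial increments
  which are at least \<open>\<epsilon>\<close> in both coordinates compensate for it.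
\<close>

lemma return_probability_lower_bound:
  assumes drift: "\<And>i. nn_expectation \<mu> (\<lambda>y. neg_part (y $ i)) < nn_expectation \<mu> (\<lambda>y. pos_part (y $ i))"
  obtains p where "p > 0"
    "\<And>x. x \<in> quadrant \<Longrightarrow> eventually (\<lambda>n. ennreal p \<le> (T ^^ n) (indicator {0}) x) sequentially"
proof -
  define G where "G a = {\<omega> :: nat \<Rightarrow> real^2. \<forall>k i. - a \<le> (\<Sum>l<k. \<omega> l $ i)}" for a :: real
  have G_meas [measurable]: "G a \<in> sets S" for a
  proof -
    have "{\<omega> \<in> space S. \<forall>k i. - a \<le> (\<Sum>l<k. \<omega> l $ i)} \<in> sets S"
      by (intro sets.sets_Collect_countable_All borel_measurable_le borel_measurable_const partial_sum_measurable)
    then show ?thesis by (simp add: G_def)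
  qed
  have AE: "AE \<omega> in S. \<forall>i. filterlim (\<lambda>n. \<Sum>k<n. \<omega> k $ i) at_top sequentially"
    unfolding AE_all_countable by (intro allI partial_sums_at_top drift) simp
  obtain \<epsilon> c where \<epsilon>: "\<epsilon> > 0" and c: "c > 0" "ennreal c \<le> emeasure \<mu> {y. \<forall>i. \<epsilon> \<le> y $ i}"
    by (rule uniform_up)
  have step: "ennreal c * emeasure S (G (a + \<epsilon>)) \<le> emeasure S (G a)" if a: "0 \<le> a" for a
  proof -
    have "emeasure S (G a) = (\<integral>\<^sup>+ y. emeasure S {\<omega>. case_nat y \<omega> \<in> G a} \<partial>\<mu>)"
      using emeasure_S_first_step[of "\<lambda>\<omega>. \<omega> \<in> G a"] by simp
    also have "\<dots> \<ge> (\<integral>\<^sup>+ y. emeasure S (G (a + \<epsilon>)) * indicator {y. \<forall>i. \<epsilon> \<le> y $ i} y \<partial>\<mu>)"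
    proof (intro nn_integral_mono)
      fix y :: "real^2"
      show "emeasure S (G (a + \<epsilon>)) * indicator {y. \<forall>i. \<epsilon> \<le> y $ i} y \<le> emeasure S {\<omega>. case_nat y \<omega> \<in> G a}"
      proof (cases "\<forall>i. \<epsilon> \<le> y $ i")
        case True
        have "G (a + \<epsilon>) \<subseteq> {\<omega>. case_nat y \<omega> \<in> G a}"
        proof
          fix \<omega> assume \<omega>: "\<omega> \<in> G (a + \<epsilon>)"
          have "- a \<le> (\<Sum>l<k. case_nat y \<omega> l $ i)" for k i
          proof (cases k)
            case (Suc k')
            have "- (a + \<epsilon>) \<le> (\<Sum>l<k'. \<omega> l $ i)" using \<omega> by (simp add: G_def)
            moreover have "\<epsilon> \<le> y $ i" using True by blast
            moreover have "(\<Sum>l<Suc k'. case_nat y \<omega> l $ i) = y $ i + (\<Sum>l<k'. \<omega> l $ i)"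
              unfolding sum.lessThan_Suc_shift by simp
            ultimately show ?thesis unfolding Suc by linarith
          qed (use a in simp)
          then show "\<omega> \<in> {\<omega>. case_nat y \<omega> \<in> G a}" by (simp add: G_def)
        qed
        moreover have "{\<omega>. case_nat y \<omega> \<in> G a} \<in> sets S"
        proof -
          have "(\<lambda>\<omega>. case_nat y \<omega>) \<in> measurable S S"
            using measurable_compose[OF measurable_Pair1'[of y \<mu> S] measurable_case_nat_S] by simp
          from measurable_sets[OF this G_meas[of a]] show ?thesis by (simp add: vimage_def)
        qed
        ultimately show ?thesis using True by (simp add: emeasure_mono)
      qed simp
    qed
    finally have "(\<integral>\<^sup>+ y. emeasure S (G (a + \<epsilon>)) * indicator {y. \<forall>i. \<epsilon> \<le> y $ i} y \<partial>\<mu>) \<le> emeasure S (G a)" .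
    then have *: "emeasure S (G (a + \<epsilon>)) * emeasure \<mu> {y. \<forall>i. \<epsilon> \<le> y $ i} \<le> emeasure S (G a)"
      by (subst (asm) nn_integral_cmult_indicator) auto
    have "ennreal c * emeasure S (G (a + \<epsilon>)) = emeasure S (G (a + \<epsilon>)) * ennreal c"
      by (rule mult.commute)
    also have "\<dots> \<le> emeasure S (G (a + \<epsilon>)) * emeasure \<mu> {y. \<forall>i. \<epsilon> \<le> y $ i}"
      using c(2) by (rule mult_left_mono) simp
    finally show ?thesis using * by (rule order.trans)
  qed
  have steps: "ennreal (c ^ n) * emeasure S (G (real n * \<epsilon>)) \<le> emeasure S (G 0)" for n
  proof (induction n)
    case (Suc n)
    have "ennreal (c ^ Suc n) * emeasure S (G (real (Suc n) * \<epsilon>))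
        = ennreal (c ^ n) * (ennreal c * emeasure S (G (real n * \<epsilon> + \<epsilon>)))"
      using c(1) by (simp add: ennreal_mult algebra_simps)
    also have "\<dots> \<le> ennreal (c ^ n) * emeasure S (G (real n * \<epsilon>))"
      using \<epsilon> by (intro mult_left_mono step) auto
    finally show ?case using Suc by simp
  qed simp
  have "\<exists>n. emeasure S (G (real n * \<epsilon>)) \<noteq> 0"
  proof (rule ccontr)
    assume "\<not> ?thesis"
    then have 0: "emeasure S (\<Union>n. G (real n * \<epsilon>)) = 0"
      by (intro emeasure_UN_eq_0) auto
    have "AE \<omega> in S. \<omega> \<in> (\<Union>n. G (real n * \<epsilon>))"
      using AE
    proof eventually_elim
      case (elim \<omega>)
      have "\<exists>b. \<forall>k. - b \<le> (\<Sum>l<k. \<omega> l $ i)" for i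
      proof -
        obtain N where N: "\<And>k. N \<le> k \<Longrightarrow> 0 \<le> (\<Sum>l<k. \<omega> l $ i)"
          using elim[THEN spec, of i] unfolding filterlim_at_top eventually_sequentially by meson
        let ?b = "\<Sum>k<N. \<bar>\<Sum>l<k. \<omega> l $ i\<bar>"
        have "- ?b \<le> (\<Sum>l<k. \<omega> l $ i)" for k
        proof (cases "N \<le> k")
          case True
          have "0 \<le> ?b" by (intro sum_nonneg) simp
          with N[OF True] show ?thesis by linarith
        next
          case False
          then have "\<bar>\<Sum>l<k. \<omega> l $ i\<bar> \<le> ?b"
            by (intro member_le_sum[of k "{..<N}" "\<lambda>k. \<bar>\<Sum>l<k. \<omega> l $ i\<bar>"]) auto
          then show ?thesis by linarith
        qed
        then show ?thesis by blast
      qed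
      then obtain b where b: "\<And>i k. - b i \<le> (\<Sum>l<k. \<omega> l $ i)" by metis
      obtain n :: nat where n: "Max (range b) / \<epsilon> \<le> real n" using real_arch_simple by blast
      have "b i \<le> real n * \<epsilon>" for i
      proof -
        have "b i \<le> Max (range b)" by (intro Max_ge) auto
        also have "\<dots> \<le> real n * \<epsilon>" using n \<epsilon> by (simp add: pos_divide_le_eq)
        finally show ?thesis .
      qed
      then have "\<omega> \<in> G (real n * \<epsilon>)"
        using b unfolding G_def by (auto intro: order.trans[OF _ b])
      then show ?case by blast
    qed
    then have "emeasure S (\<Union>n. G (real n * \<epsilon>)) = 1"
      by (intro P.emeasure_eq_1_AE) auto
    with 0 show False by simp
  qed
  then obtain n where n: "emeasure S (G (real n * \<epsilon>)) \<noteq> 0" by blast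
  have "0 < ennreal (c ^ n) * emeasure S (G (real n * \<epsilon>))"
  proof (rule ennreal_zero_less_mult_iff[THEN iffD2], rule conjI)
    show "0 < ennreal (c ^ n)" using c(1) by simp
    show "0 < emeasure S (G (real n * \<epsilon>))" using n not_gr_zero by blast
  qed
  then have G0: "0 < emeasure S (G 0)"
    using steps[of n] by (rule less_le_trans)
  define p where "p = measure S (G 0) / 2"
  have p: "p > 0" "ennreal p < emeasure S (G 0)"
    using G0 by (auto simp: p_def P.emeasure_eq_measure ennreal_less_iff)
  show ?thesis
  proof (rule that[OF p(1)])
    fix x :: "real^2" assume x: "x \<in> quadrant"
    define H where "H n = {\<omega> \<in> G 0. \<forall>m\<ge>n. \<forall>i. x $ i \<le> (\<Sum>l<m. \<omega> l $ i)}" for n :: nat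
    have H_meas [measurable]: "H n \<in> sets S" for n
    proof -
      have "{\<omega> \<in> space S. \<forall>m. m \<ge> n \<longrightarrow> (\<forall>i. x $ i \<le> (\<Sum>l<m. \<omega> l $ i))} \<in> sets S"
        by (intro sets.sets_Collect_countable_All sets.sets_Collect_imp sets.sets_Collect_const
            borel_measurable_le borel_measurable_const partial_sum_measurable)
      then have "G 0 \<inter> {\<omega> \<in> space S. \<forall>m. m \<ge> n \<longrightarrow> (\<forall>i. x $ i \<le> (\<Sum>l<m. \<omega> l $ i))} \<in> sets S"
        by (rule sets.Int[OF G_meas])
      moreover have "H n = G 0 \<inter> {\<omega> \<in> space S. \<forall>m. m \<ge> n \<longrightarrow> (\<forall>i. x $ i \<le> (\<Sum>l<m. \<omega> l $ i))}"
        by (auto simp: H_def)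
      ultimately show ?thesis by simp
    qed
    have "incseq H" by (auto simp: incseq_def H_def)
    then have "(\<lambda>n. emeasure S (H n)) \<longlonglongrightarrow> emeasure S (\<Union>n. H n)"
      by (intro Lim_emeasure_incseq) auto
    also have "emeasure S (\<Union>n. H n) = emeasure S (G 0)"
    proof (rule emeasure_eq_AE)
      show "AE \<omega> in S. \<omega> \<in> (\<Union>n. H n) \<longleftrightarrow> \<omega> \<in> G 0"
        using AE
      proof eventually_elim
        case (elim \<omega>)
        have "\<exists>n. \<forall>m\<ge>n. \<forall>i. x $ i \<le> (\<Sum>l<m. \<omega> l $ i)"
        proof -
          have "eventually (\<lambda>m. \<forall>i. x $ i \<le> (\<Sum>l<m. \<omega> l $ i)) sequentially"
            using elim by (intro eventually_all_finite) (auto simp: filterlim_at_top)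
          then show ?thesis by (simp add: eventually_sequentially)
        qed
        then show ?case by (auto simp: H_def)
      qed
    qed auto
    finally have "eventually (\<lambda>n. ennreal p < emeasure S (H n)) sequentially"
      using p(2) by (rule order_tendstoD)
    then show "eventually (\<lambda>n. ennreal p \<le> (T ^^ n) (indicator {0}) x) sequentially"
    proof eventually_elim
      case (elim n)
      have "emeasure S (H n) = (\<integral>\<^sup>+ \<omega>. indicator (H n) \<omega> \<partial>S)" by simp
      also have "\<dots> \<le> (\<integral>\<^sup>+ \<omega>. indicator {0} (backward x n \<omega>) \<partial>S)"
      proof (rule nn_integral_mono)
        fix \<omega>
        have "backward x n \<omega> = 0" if \<omega>: "\<omega> \<in> H n"
        proof -
          have "backward x n \<omega> $ i \<le> 0" for i
            using \<omega> by (intro backward_le) (auto simp: H_def G_def)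
          moreover have "backward x n \<omega> \<in> quadrant" using x by (cases n) auto
          ultimately show ?thesis by (auto simp: vec_eq_iff quadrant_def intro: antisym)
        qed
        then show "indicator (H n) \<omega> \<le> (indicator {0} (backward x n \<omega>) :: ennreal)"
          by (auto simp: indicator_def)
      qed
      also have "\<dots> = (T ^^ n) (indicator {0}) x"
        by (rule backward_law) simp
      finally show ?case using elim by simp
    qed
  qed
qed

end

section \<open>The classification\<close>

context moment_chain
begin

text \<open>
  The linear combination with coefficients \<open>mom j j\<close> and \<open>- mom i j\<close> has second moment \<open>mom j j\<close> times
  the determinant of the matrix of second moments.
\<close>

lemma covariance_nondegenerate:
  assumes "\<And>a b. a \<noteq> 0 \<or> b \<noteq> 0 \<Longrightarrow> \<not> (AE y in \<mu>. a * y $ i + b * y $ j = 0)"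
  shows "mom i i > 0" "mom j j > 0" "(mom i j)\<^sup>2 < mom i i * mom j j"
proof -
  have pos: "0 < a\<^sup>2 * mom i i + b\<^sup>2 * mom j j + 2 * a * b * mom i j" if ab: "a \<noteq> 0 \<or> b \<noteq> 0" for a b
  proof -
    have "(\<integral>y. (a * y $ i + b * y $ j)\<^sup>2 \<partial>\<mu>) \<noteq> 0"
    proof
      assume "(\<integral>y. (a * y $ i + b * y $ j)\<^sup>2 \<partial>\<mu>) = 0"
      then have "AE y in \<mu>. (a * y $ i + b * y $ j)\<^sup>2 = 0"
        using integral_nonneg_eq_0_iff_AE[OF quadratic_moment(1)] by simp
      then show False using assms[OF ab] by simp
    qed
    moreover have "0 \<le> (\<integral>y. (a * y $ i + b * y $ j)\<^sup>2 \<partial>\<mu>)" by simp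
    ultimately show ?thesis unfolding quadratic_moment(2) by linarith
  qed
  show "mom i i > 0" using pos[of 1 0] by simp
  show j: "mom j j > 0" using pos[of 0 1] by simp
  have "0 < mom j j * (mom i i * mom j j - (mom i j)\<^sup>2)"
    using pos[of "mom j j" "- mom i j"] j by (simp add: power2_eq_square algebra_simps)
  then show "(mom i j)\<^sup>2 < mom i i * mom j j"
    using j by (simp add: zero_less_mult_iff)
qed

end

context lindley_process
begin

lemma law_nn_expectation:
  assumes [measurable]: "g \<in> borel_measurable borel"
  shows "nn_expectation law g = nn_expectation M (\<lambda>\<omega>. g (X \<omega>))"
  unfolding nn_expectation_def by (subst nn_integral_distr) auto

lemma law_integral:
  fixes g :: "real^2 \<Rightarrow> real"
  assumes [measurable]: "g \<in> borel_measurable borel"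
  shows "(\<integral>y. g y \<partial>law) = (\<integral>\<omega>. g (X \<omega>) \<partial>M)"
  by (subst integral_distr) auto

lemma moment_chain_law:
  assumes "i \<noteq> j" and p: "1 < p" "p \<le> 3 / 2"
    and moments: "\<And>k. \<exists>e\<ge>2 * p. nn_expectation M (\<lambda>\<omega>. \<bar>X \<omega> $ k\<bar> powr e) < \<infinity>"
  shows "moment_chain law i j p"
proof -
  have "integrable law (\<lambda>y. \<bar>y $ k\<bar> powr (2 * p))" for k
  proof -
    obtain e where e: "2 * p \<le> e" "nn_expectation M (\<lambda>\<omega>. \<bar>X \<omega> $ k\<bar> powr e) < \<infinity>"
      using moments by blast
    have [measurable]: "(\<lambda>y :: real^2. \<bar>y $ k\<bar> powr e) \<in> borel_measurable borel" for e
      by measurable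
    have "nn_expectation law (\<lambda>y. \<bar>y $ k\<bar> powr e) < \<infinity>"
      using e(2) by (simp add: law_nn_expectation)
    then have int: "integrable law (\<lambda>y. \<bar>y $ k\<bar> powr e)"
      unfolding nn_expectation_def by (intro integrableI_nonneg) auto
    show ?thesis
    proof (rule Bochner_Integration.integrable_bound)
      show "integrable law (\<lambda>y. 1 + \<bar>y $ k\<bar> powr e)" using int by simp
      show "AE y in law. norm (\<bar>y $ k\<bar> powr (2 * p)) \<le> norm (1 + \<bar>y $ k\<bar> powr e)"
      proof (rule AE_I2)
        fix y :: "real^2"
        show "norm (\<bar>y $ k\<bar> powr (2 * p)) \<le> norm (1 + \<bar>y $ k\<bar> powr e)"
        proof (cases "\<bar>y $ k\<bar> \<le> 1")
          case True
          then have "\<bar>y $ k\<bar> powr (2 * p) \<le> 1" using p by (intro powr_le1) auto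
          then show ?thesis by (simp add: add_increasing2)
        next
          case False
          then have "\<bar>y $ k\<bar> powr (2 * p) \<le> \<bar>y $ k\<bar> powr e" using e by (intro powr_mono) auto
          then show ?thesis by simp
        qed
      qed
    qed simp
  qed
  with assms(1) p show ?thesis
    by unfold_locales auto
qed

lemma nondegenerate_law:
  assumes hyperplane: "\<not> (\<exists>a b. a \<noteq> 0 \<and> (AE \<omega> in M. a \<bullet> X \<omega> = b))"
    and ij: "i \<noteq> j" and ab: "a \<noteq> 0 \<or> b \<noteq> 0"
  shows "\<not> (AE y in law. a * y $ i + b * y $ j = 0)"
proof
  assume "AE y in law. a * y $ i + b * y $ j = 0"
  then have AE: "AE \<omega> in M. a * X \<omega> $ i + b * X \<omega> $ j = 0"
    by (subst (asm) AE_distr_iff) auto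
  let ?v = "axis i a + axis j b :: real^2"
  have "?v $ i = a" "?v $ j = b" using ij by (simp_all add: axis_def)
  then have "?v \<noteq> 0" using ab by (metis zero_index)
  moreover have "?v \<bullet> X \<omega> = a * X \<omega> $ i + b * X \<omega> $ j" for \<omega>
    by (simp add: inner_add_left inner_axis' )
  ultimately show False using hyperplane AE by (metis (mono_tags, lifting) AE_mp AE_I2)
qed

lemma transient_of_negative_drift:
  assumes "nn_expectation M (\<lambda>\<omega>. pos_part (X \<omega> $ i)) < nn_expectation M (\<lambda>\<omega>. neg_part (X \<omega> $ i))"
  shows "transient M Xs"
  unfolding transient_def
proof
  fix x :: "real^2"
  have [measurable]: "(\<lambda>y. pos_part (y $ i)) \<in> borel_measurable borel" "(\<lambda>y. neg_part (y $ i)) \<in> borel_measurable borel"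
    unfolding pos_part_def neg_part_def by measurable
  have "AE \<omega> in chain.S. filterlim (\<lambda>n. norm (chain.path x \<omega> n)) at_top sequentially"
    by (rule chain.AE_path_escapes[of i]) (use assms in \<open>simp add: law_nn_expectation\<close>)
  from AE_sequence[OF this]
  show "AE \<omega> in M. filterlim (\<lambda>n. norm (lindley Xs x n \<omega>)) at_top sequentially"
    by (simp add: lindley_eq_path)
qed

lemma positive_recurrent_of_positive_drift:
  assumes "\<And>i. nn_expectation M (\<lambda>\<omega>. neg_part (X \<omega> $ i)) < nn_expectation M (\<lambda>\<omega>. pos_part (X \<omega> $ i))"
  shows "positive_recurrent M X Xs"
proof -
  have [measurable]: "(\<lambda>y. pos_part (y $ i)) \<in> borel_measurable borel" "(\<lambda>y. neg_part (y $ i)) \<in> borel_measurable borel"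
    for i :: 2
    unfolding pos_part_def neg_part_def by measurable
  obtain p where "p > 0"
    "\<And>x. x \<in> quadrant \<Longrightarrow> eventually (\<lambda>n. ennreal p \<le> (chain.T ^^ n) (indicator {0}) x) sequentially"
    using chain.return_probability_lower_bound assms by (auto simp: law_nn_expectation)
  then show ?thesis by (rule positive_recurrent_of_return)
qed

end

theorem theorem1p3:
  fixes M :: "'a measure"
    and X :: "'a \<Rightarrow> real^2"
    and Xs :: "nat \<Rightarrow> 'a \<Rightarrow> real^2"
    and \<rho> :: real
  assumes "prob_space M"
    and "X \<in> borel_measurable M"
    and "iid_copies M X Xs"
    and "\<not> (\<exists>a b. a \<noteq> 0 \<and> (AE \<omega> in M. a \<bullet> X \<omega> = b))"
    and "measure M {\<omega> \<in> space M. \<forall>i. X \<omega> $ i > 0} > 0"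
    and "\<rho> = correlation M (\<lambda>\<omega>. X \<omega> $ 1) (\<lambda>\<omega>. X \<omega> $ 2)"
  shows
    "((\<exists>i. nn_expectation M (\<lambda>\<omega>. pos_part (X \<omega> $ i)) < nn_expectation M (\<lambda>\<omega>. neg_part (X \<omega> $ i)))
        \<longrightarrow> transient M Xs)
     \<and>
     ((\<forall>i. nn_expectation M (\<lambda>\<omega>. neg_part (X \<omega> $ i)) < nn_expectation M (\<lambda>\<omega>. pos_part (X \<omega> $ i)) \<and>
           nn_expectation M (\<lambda>\<omega>. pos_part (X \<omega> $ i)) < \<infinity>)
        \<longrightarrow> positive_recurrent M X Xs)
     \<and>
     (\<forall>\<delta>>0.
        (\<forall>i. integrable M (\<lambda>\<omega>. X \<omega> $ i) \<and> (\<integral>\<omega>. X \<omega> $ i \<partial>M) = 0 \<and>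
           nn_expectation M (\<lambda>\<omega>. \<bar>X \<omega> $ i\<bar> powr max (2 + \<delta>) (pi / arccos (- \<rho>))) < \<infinity>)
        \<longrightarrow> (\<rho> \<ge> 0 \<longrightarrow> null_recurrent M X Xs) \<and> (\<rho> < 0 \<longrightarrow> transient M Xs))
     \<and>
     (\<forall>\<delta>>0. \<forall>i j. i \<noteq> j \<longrightarrow>
        (\<forall>k. nn_expectation M (\<lambda>\<omega>. \<bar>X \<omega> $ k\<bar> powr (2 + \<delta>)) < \<infinity>) \<and>
        integrable M (\<lambda>\<omega>. X \<omega> $ i) \<and> (\<integral>\<omega>. X \<omega> $ i \<partial>M) = 0 \<and>
        integrable M (\<lambda>\<omega>. X \<omega> $ j) \<and> (\<integral>\<omega>. X \<omega> $ j \<partial>M) > 0 \<and>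
        nn_expectation M (\<lambda>\<omega>. neg_part (X \<omega> $ j) powr (3 + \<delta>)) < \<infinity>
        \<longrightarrow> null_recurrent M X Xs)"
proof -
  interpret lindley_process M X Xs
    using assms(1,2,3,5) unfolding lindley_process_def lindley_process_axioms_def by simp
  note nondegenerate = nondegenerate_law[OF assms(4)]
  have chain_of_moments: "moment_chain law i j (1 + min \<delta> 1 / 2)"
    if "i \<noteq> j" "\<delta> > 0"
      and moments: "\<And>k. \<exists>e\<ge>2 + \<delta>. nn_expectation M (\<lambda>\<omega>. \<bar>X \<omega> $ k\<bar> powr e) < \<infinity>" for i j \<delta>
  proof (rule moment_chain_law)
    fix k
    obtain e where "2 + \<delta> \<le> e" "nn_expectation M (\<lambda>\<omega>. \<bar>X \<omega> $ k\<bar> powr e) < \<infinity>"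
      using moments by blast
    moreover have "2 * (1 + min \<delta> 1 / 2) \<le> 2 + \<delta>" by simp
    ultimately show "\<exists>e\<ge>2 * (1 + min \<delta> 1 / 2). nn_expectation M (\<lambda>\<omega>. \<bar>X \<omega> $ k\<bar> powr e) < \<infinity>"
      by (meson order.trans)
  qed (use that in auto)
  show ?thesis
  proof (intro conjI)
    show "(\<exists>i. nn_expectation M (\<lambda>\<omega>. pos_part (X \<omega> $ i)) < nn_expectation M (\<lambda>\<omega>. neg_part (X \<omega> $ i)))
        \<longrightarrow> transient M Xs"
      using transient_of_negative_drift by blast
  next
    show "(\<forall>i. nn_expectation M (\<lambda>\<omega>. neg_part (X \<omega> $ i)) < nn_expectation M (\<lambda>\<omega>. pos_part (X \<omega> $ i)) \<and>
           nn_expectation M (\<lambda>\<omega>. pos_part (X \<omega> $ i)) < \<infinity>)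
        \<longrightarrow> positive_recurrent M X Xs"
      using positive_recurrent_of_positive_drift by blast
  next
    show "\<forall>\<delta>>0.
        (\<forall>i. integrable M (\<lambda>\<omega>. X \<omega> $ i) \<and> (\<integral>\<omega>. X \<omega> $ i \<partial>M) = 0 \<and>
           nn_expectation M (\<lambda>\<omega>. \<bar>X \<omega> $ i\<bar> powr max (2 + \<delta>) (pi / arccos (- \<rho>))) < \<infinity>)
        \<longrightarrow> (\<rho> \<ge> 0 \<longrightarrow> null_recurrent M X Xs) \<and> (\<rho> < 0 \<longrightarrow> transient M Xs)"
    proof (intro allI impI)
      fix \<delta> :: real assume \<delta>: "\<delta> > 0"
      assume A: "\<forall>i. integrable M (\<lambda>\<omega>. X \<omega> $ i) \<and> (\<integral>\<omega>. X \<omega> $ i \<partial>M) = 0 \<and>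
           nn_expectation M (\<lambda>\<omega>. \<bar>X \<omega> $ i\<bar> powr max (2 + \<delta>) (pi / arccos (- \<rho>))) < \<infinity>"
      have ne: "(1 :: 2) \<noteq> 2" by simp
      interpret mc: moment_chain law 1 2 "1 + min \<delta> 1 / 2"
      proof (rule chain_of_moments[OF ne \<delta>])
        show "\<exists>e\<ge>2 + \<delta>. nn_expectation M (\<lambda>\<omega>. \<bar>X \<omega> $ k\<bar> powr e) < \<infinity>" for k
          using A by (intro exI[of _ "max (2 + \<delta>) (pi / arccos (- \<rho>))"]) auto
      qed
      have mean: "mc.mean k = 0" for k
        using A by (simp add: mc.mean_def law_integral)
      note nd = mc.covariance_nondegenerate[OF nondegenerate[OF ne]]
      have cov: "covariance M (\<lambda>\<omega>. X \<omega> $ k) (\<lambda>\<omega>. X \<omega> $ l) = mc.mom k l" for k l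
        using A by (simp add: covariance_def mc.mom_def law_integral)
      have \<rho>: "\<rho> = mc.mom 1 2 / (sqrt (mc.mom 1 1) * sqrt (mc.mom 2 2))"
        using assms(6) by (simp add: correlation_def cov)
      have den: "sqrt (mc.mom 1 1) * sqrt (mc.mom 2 2) > 0"
        using nd by simp
      show "(\<rho> \<ge> 0 \<longrightarrow> null_recurrent M X Xs) \<and> (\<rho> < 0 \<longrightarrow> transient M Xs)"
      proof (intro conjI impI)
        assume "\<rho> \<ge> 0"
        then have "mc.mom 1 2 \<ge> 0"
          using den unfolding \<rho> by (simp add: zero_le_divide_iff)
        then show "null_recurrent M X Xs"
          using mc.return_of_nonneg_correlation[OF mean mean _ nd(3)]
            mc.return_probability_small_of_mean_zero[OF mean nd(1)]
          by (intro null_recurrent_of_return) auto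
      next
        assume "\<rho> < 0"
        then have "mc.mom 1 2 < 0"
          using den unfolding \<rho> by (simp add: divide_less_0_iff)
        then show "transient M Xs"
          using mc.summable_returns_of_neg_correlation[OF mean mean _ nd(3)]
          by (intro transient_of_summable_returns) auto
      qed
    qed
  next
    show "\<forall>\<delta>>0. \<forall>i j. i \<noteq> j \<longrightarrow>
        (\<forall>k. nn_expectation M (\<lambda>\<omega>. \<bar>X \<omega> $ k\<bar> powr (2 + \<delta>)) < \<infinity>) \<and>
        integrable M (\<lambda>\<omega>. X \<omega> $ i) \<and> (\<integral>\<omega>. X \<omega> $ i \<partial>M) = 0 \<and>
        integrable M (\<lambda>\<omega>. X \<omega> $ j) \<and> (\<integral>\<omega>. X \<omega> $ j \<partial>M) > 0 \<and>
        nn_expectation M (\<lambda>\<omega>. neg_part (X \<omega> $ j) powr (3 + \<delta>)) < \<infinity>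
        \<longrightarrow> null_recurrent M X Xs"
    proof (intro allI impI, elim conjE)
      fix \<delta> :: real and i j :: 2
      assume \<delta>: "\<delta> > 0" and ij: "i \<noteq> j"
        and moments: "\<forall>k. nn_expectation M (\<lambda>\<omega>. \<bar>X \<omega> $ k\<bar> powr (2 + \<delta>)) < \<infinity>"
        and means: "(\<integral>\<omega>. X \<omega> $ i \<partial>M) = 0" "(\<integral>\<omega>. X \<omega> $ j \<partial>M) > 0"
      interpret mc: moment_chain law i j "1 + min \<delta> 1 / 2"
        by (rule chain_of_moments[OF ij \<delta>]) (use moments in blast)
      have mean: "mc.mean i = 0" "mc.mean j > 0"
        using means by (simp_all add: mc.mean_def law_integral)
      note nd = mc.covariance_nondegenerate[OF nondegenerate[OF ij]]
      show "null_recurrent M X Xs"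
        using mc.return_of_mean_zero_and_mean_pos[OF mean nd(1,2)]
          mc.return_probability_small_of_mean_zero[OF mean(1) nd(1)]
        by (intro null_recurrent_of_return) auto
    qed
  qed
qed

end
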